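(* If $\varphi:\mathcal A\to\mathcal B$ is an epimorphism from a $\mathbb Z$-analytic triangular UHF algebra $\mathcal A$ onto a triangular UHF algebra $\mathcal B$, then $\varphi$ is an isomorphism.
   Context: For a $C^*$-algebra $\mathcal C$ and subalgebras $X,Y\subseteq\mathcal C$, the normalizer of $Y$ in $X$ is $N_Y(X)=\{x\in X : x \text{ is a partial isometry and } xyx^*,x^*yx\in Y \text{ for all } y\in Y\}$. Let $\mathbf T_n$ be the algebra of upper triangular $n\times n$ complex matrices, and let $D_n$ be the diagonal matrices, $D_n\subseteq\mathbf T_n\subseteq\mathbf M_n$. A triangular UHF algebra is a norm-closed direct limit $\mathcal A=\varinjlim(A_k,\alpha_k)$ where each $A_k$ is a single $\mathbf T_{n_k}$ and each $\alpha_k:\mathbf T_{n_k}\to\mathbf T_{n_{k+1}}$ extends to an injective $*$-homomorphism $\mathbf M_{n_k}\to\mathbf M_{n_{k+1}}$ mapping $N_{D_{n_k}}(\mathbf M_{n_k})$ into $N_{D_{n_{k+1}}}(\mathbf M_{n_{k+1}})$. It is regarded as a subalgebra of the corresponding $C^*$-algebra $\mathcal C=\varinjlim\mathbf M_{n_k}$, and $\mathcal D=\mathcal A\cap\mathcal A^*=\varinjlim D_{n_k}$ is its diagonal, a maximal abelian selfadjoint subalgebra of $\mathcal C$. Let $H$ be the maximal ideal space (space of characters) of $\mathcal D$. The spectrum of $\mathcal A$ is the relation $\mathrm R(\mathcal A)$ on $H$ with $(x,y)\in\mathrm R(\mathcal A)$ iff there is $v\in N_{\mathcal D}(\mathcal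 A)$ with $y(d)=x(vdv^* )$ for all $d\in\mathcal D$ (then $v$ relates $x$ and $y$). Let $\mathcal G$ be the equivalence relation on $H$ generated by $\mathrm R(\mathcal A)$, topologized with the sets $G(e)=\{(x,y): e \text{ relates } x \text{ and } y\}$, $e\in N_{\mathcal D}(\mathcal C)$, as a base of open sets. A cocycle is a continuous function $c:\mathcal G\to\mathbb R$ with $c(x,y)+c(y,z)=c(x,z)$ for all $(x,y),(y,z)\in\mathcal G$. The algebra $\mathcal A$ is $\mathbb Z$-analytic if there is an integer-valued cocycle $c$ on $\mathcal G$ with $c^{-1}([0,\infty))=\mathrm R(\mathcal A)$. An epimorphism is a surjective homomorphism of complex algebras, not assumed continuous; an isomorphism is a bijective such homomorphism.
   Formalization: Triangular UHF algebras are taken with unital connecting maps and unbounded matrix sizes n_k (unital, infinite-dimensional); without this the claim fails, e.g. for the epimorphism of T_2 onto T_1 sending a to its (1,1) entry. *)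

theory Defs
  imports "HOL-Analysis.Analysis" "Jordan_Normal_Form.Schur_Decomposition"
begin

text \<open>
  A complex (not necessarily unital) \<open>C\<^sup>*\<close>-algebra as a type class. It serves as an ambient algebra:
  the \<open>C\<^sup>*\<close>-algebras of interest are closed selfadjoint subalgebras, given as sets.
\<close>

class cstar_algebra = real_normed_algebra + complete_space +
  fixes scaleC :: "complex \<Rightarrow> 'a \<Rightarrow> 'a" (infixr \<open>*\<^sub>C\<close> 75)
    and cstar :: "'a \<Rightarrow> 'a"
  assumes scaleC_of_real: "complex_of_real r *\<^sub>C a = scaleR r a"
    and scaleC_add_right: "z *\<^sub>C (a + b) = z *\<^sub>C a + z *\<^sub>C b"
    and scaleC_add_left: "(z + w) *\<^sub>C a = z *\<^sub>C a + w *\<^sub>C a"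
    and scaleC_scaleC: "z *\<^sub>C (w *\<^sub>C a) = (z * w) *\<^sub>C a"
    and scaleC_mult_left: "(z *\<^sub>C a) * b = z *\<^sub>C (a * b)"
    and scaleC_mult_right: "a * (z *\<^sub>C b) = z *\<^sub>C (a * b)"
    and norm_scaleC: "norm (z *\<^sub>C a) = cmod z * norm a"
    and cstar_cstar: "cstar (cstar a) = a"
    and cstar_add: "cstar (a + b) = cstar a + cstar b"
    and cstar_scaleC: "cstar (z *\<^sub>C a) = cnj z *\<^sub>C cstar a"
    and cstar_mult: "cstar (a * b) = cstar b * cstar a"
    and cstar_identity: "norm (cstar a * a) = (norm a)\<^sup>2"


section \<open>Homomorphisms and normalizers\<close>

text \<open>
  Scalar multiplication and involution are explicit parameters, so that the same notions apply to
  subsets of a \<^class>\<open>cstar_algebra\<close>, to the complex numbers and to sets of square matrices of a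
  fixed size (the type \<^typ>\<open>complex mat\<close> contains matrices of all sizes and is not itself an
  algebra).
\<close>

definition alg_hom_on ::
  "(complex \<Rightarrow> 'a \<Rightarrow> 'a) \<Rightarrow> (complex \<Rightarrow> 'b \<Rightarrow> 'b) \<Rightarrow> 'a set \<Rightarrow> 'b set
    \<Rightarrow> ('a::{plus,times} \<Rightarrow> 'b::{plus,times}) \<Rightarrow> bool" where
  "alg_hom_on sc1 sc2 X Y f \<longleftrightarrow>
     (\<forall>a\<in>X. f a \<in> Y) \<and>
     (\<forall>a\<in>X. \<forall>b\<in>X. f (a + b) = f a + f b) \<and>
     (\<forall>a\<in>X. \<forall>b\<in>X. f (a * b) = f a * f b) \<and>
     (\<forall>z. \<forall>a\<in>X. f (sc1 z a) = sc2 z (f a))"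

definition algebra_epimorphism ::
  "'a::cstar_algebra set \<Rightarrow> 'b::cstar_algebra set \<Rightarrow> ('a \<Rightarrow> 'b) \<Rightarrow> bool" where
  "algebra_epimorphism A B f \<longleftrightarrow> alg_hom_on scaleC scaleC A B f \<and> f ` A = B"

definition algebra_isomorphism ::
  "'a::cstar_algebra set \<Rightarrow> 'b::cstar_algebra set \<Rightarrow> ('a \<Rightarrow> 'b) \<Rightarrow> bool" where
  "algebra_isomorphism A B f \<longleftrightarrow> alg_hom_on scaleC scaleC A B f \<and> bij_betw f A B"

definition partial_isometry :: "('a::times \<Rightarrow> 'a) \<Rightarrow> 'a \<Rightarrow> bool" where
  "partial_isometry st v \<longleftrightarrow> v * st v * v = v"

text \<open>\<open>normalizer st Y X\<close> is \<open>N\<^sub>Y(X)\<close>, with \<open>st\<close> the involution.\<close>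

definition normalizer :: "('a::times \<Rightarrow> 'a) \<Rightarrow> 'a set \<Rightarrow> 'a set \<Rightarrow> 'a set" where
  "normalizer st Y X =
     {x \<in> X. partial_isometry st x \<and> (\<forall>y\<in>Y. x * y * st x \<in> Y \<and> st x * y * x \<in> Y)}"


section \<open>Triangular UHF algebras\<close>

definition full_mats :: "nat \<Rightarrow> complex mat set" where
  "full_mats n = carrier_mat n n"

definition upper_mats :: "nat \<Rightarrow> complex mat set" where
  "upper_mats n = {M \<in> carrier_mat n n. upper_triangular M}"

definition diag_mats :: "nat \<Rightarrow> complex mat set" where
  "diag_mats n = {M \<in> carrier_mat n n. diagonal_mat M}"

text \<open>
  The maps \<open>\<alpha> k\<close> are given on the full matrix algebras (the extension of a map
  \<open>T\<^bsub>n k\<^esub> \<rightarrow> T\<^bsub>n (k+1)\<^esub>\<close> to a \<open>*\<close>-homomorphism is unique). As usual for UHF algebras, the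
  connecting maps are unital and the matrix sizes are unbounded, that is, the limit is
  infinite-dimensional. (Otherwise the upper triangular \<open>2 \<times> 2\<close> matrices, or
  the compact upper triangular operators on \<open>\<ell>\<^sup>2\<close>, would be included.)
\<close>

definition triangular_system ::
  "(nat \<Rightarrow> nat) \<Rightarrow> (nat \<Rightarrow> complex mat \<Rightarrow> complex mat) \<Rightarrow> bool" where
  "triangular_system n \<alpha> \<longleftrightarrow>
     (\<forall>k. 0 < n k) \<and>
     (\<forall>m. \<exists>k. m < n k) \<and>
     (\<forall>k. alg_hom_on smult_mat smult_mat (full_mats (n k)) (full_mats (n (Suc k))) (\<alpha> k) \<and>
          (\<forall>M \<in> full_mats (n k). \<alpha> k (mat_adjoint M) = mat_adjoint (\<alpha> k M)) \<and>
          inj_on (\<alpha> k) (full_mats (n k)) \<and>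
          \<alpha> k (1\<^sub>m (n k)) = 1\<^sub>m (n (Suc k)) \<and>
          \<alpha> k ` upper_mats (n k) \<subseteq> upper_mats (n (Suc k)) \<and>
          \<alpha> k ` normalizer mat_adjoint (diag_mats (n k)) (full_mats (n k))
            \<subseteq> normalizer mat_adjoint (diag_mats (n (Suc k))) (full_mats (n (Suc k))))"

text \<open>
  The \<open>C\<^sup>*\<close>-direct limit of the full matrix algebras: a \<open>C\<^sup>*\<close>-algebra \<open>C\<close> together with compatible
  injective \<open>*\<close>-homomorphisms \<open>\<iota> k\<close> whose ranges have dense union. Up to isomorphism these data are
  determined by the system.
\<close>

definition cstar_direct_limit ::
  "(nat \<Rightarrow> nat) \<Rightarrow> (nat \<Rightarrow> complex mat \<Rightarrow> complex mat)
    \<Rightarrow> (nat \<Rightarrow> complex mat \<Rightarrow> 'a::cstar_algebra) \<Rightarrow> 'a set \<Rightarrow> bool" where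
  "cstar_direct_limit n \<alpha> \<iota> C \<longleftrightarrow>
     (\<forall>k. alg_hom_on smult_mat scaleC (full_mats (n k)) C (\<iota> k) \<and>
          (\<forall>M \<in> full_mats (n k). \<iota> k (mat_adjoint M) = cstar (\<iota> k M)) \<and>
          inj_on (\<iota> k) (full_mats (n k)) \<and>
          (\<forall>M \<in> full_mats (n k). \<iota> (Suc k) (\<alpha> k M) = \<iota> k M)) \<and>
     C = closure (\<Union>k. \<iota> k ` full_mats (n k))"

text \<open>\<open>A\<close> is a triangular UHF algebra with enveloping \<open>C\<^sup>*\<close>-algebra \<open>C\<close>.\<close>

definition triangular_UHF :: "'a::cstar_algebra set \<Rightarrow> 'a set \<Rightarrow> bool" where
  "triangular_UHF C A \<longleftrightarrow>
     (\<exists>n \<alpha> \<iota>. triangular_system n \<alpha> \<and> cstar_direct_limit n \<alpha> \<iota> C \<and>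
              A = closure (\<Union>k. \<iota> k ` upper_mats (n k)))"


section \<open>Spectrum and cocycles\<close>

definition diagonal_of :: "'a::cstar_algebra set \<Rightarrow> 'a set" where
  "diagonal_of A = A \<inter> cstar ` A"

text \<open>
  Characters are normalized to be \<^const>\<open>undefined\<close> outside \<open>D\<close>, so that equality of characters is
  equality on \<open>D\<close>.
\<close>

definition characters :: "'a::cstar_algebra set \<Rightarrow> ('a \<Rightarrow> complex) set" where
  "characters D =
     {x \<in> extensional D. alg_hom_on scaleC (*) D UNIV x \<and> (\<exists>d\<in>D. x d \<noteq> 0)}"

definition relates ::
  "'a::cstar_algebra set \<Rightarrow> 'a \<Rightarrow> ('a \<Rightarrow> complex) \<Rightarrow> ('a \<Rightarrow> complex) \<Rightarrow> bool" where
  "relates D v x y \<longleftrightarrow> (\<forall>d\<in>D. y d = x (v * d * cstar v))"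

definition spectrum_rel ::
  "'a::cstar_algebra set \<Rightarrow> (('a \<Rightarrow> complex) \<times> ('a \<Rightarrow> complex)) set" where
  "spectrum_rel A =
     {(x, y). x \<in> characters (diagonal_of A) \<and> y \<in> characters (diagonal_of A) \<and>
        (\<exists>v \<in> normalizer cstar (diagonal_of A) A. relates (diagonal_of A) v x y)}"

definition generated_equiv :: "'x set \<Rightarrow> ('x \<times> 'x) set \<Rightarrow> ('x \<times> 'x) set" where
  "generated_equiv H R = \<Inter>{E. equiv H E \<and> R \<subseteq> E}"

definition groupoid ::
  "'a::cstar_algebra set \<Rightarrow> (('a \<Rightarrow> complex) \<times> ('a \<Rightarrow> complex)) set" where
  "groupoid A = generated_equiv (characters (diagonal_of A)) (spectrum_rel A)"

definition basic_open ::
  "'a::cstar_algebra set \<Rightarrow> 'a \<Rightarrow> (('a \<Rightarrow> complex) \<times> ('a \<Rightarrow> complex)) set" where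
  "basic_open D e = {(x, y). x \<in> characters D \<and> y \<in> characters D \<and> relates D e x y}"

text \<open>
  The sets \<open>basic_open D e\<close> form a base, so the topology generated by them as a subbase is the one
  having them as a base.
\<close>

definition groupoid_topology ::
  "'a::cstar_algebra set \<Rightarrow> 'a set \<Rightarrow> (('a \<Rightarrow> complex) \<times> ('a \<Rightarrow> complex)) topology" where
  "groupoid_topology C A =
     subtopology
       (topology_generated_by (basic_open (diagonal_of A) ` normalizer cstar (diagonal_of A) C))
       (groupoid A)"

definition cocycle ::
  "'a::cstar_algebra set \<Rightarrow> 'a set \<Rightarrow> (('a \<Rightarrow> complex) \<times> ('a \<Rightarrow> complex) \<Rightarrow> real) \<Rightarrow> bool" where
  "cocycle C A c \<longleftrightarrow>
     continuous_map (groupoid_topology C A) euclideanreal c \<and>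
     (\<forall>x y z. (x, y) \<in> groupoid A \<longrightarrow> (y, z) \<in> groupoid A \<longrightarrow> c (x, y) + c (y, z) = c (x, z))"

definition Z_analytic :: "'a::cstar_algebra set \<Rightarrow> 'a set \<Rightarrow> bool" where
  "Z_analytic C A \<longleftrightarrow>
     (\<exists>c. cocycle C A c \<and> (\<forall>p \<in> groupoid A. c p \<in> \<int>) \<and>
          {p \<in> groupoid A. c p \<in> {0..}} = spectrum_rel A)"

end

theory Submission
  imports Defs
begin

text \<open>
  Let \<open>J\<close> be the kernel of \<open>\<phi>\<close>. Suppose that \<open>J\<close> is not zero. The contradiction comes from an
  identity: for some \<open>L\<close>, every product of \<open>L + 1\<close> commutators of elements of \<open>\<A>\<close> lies in \<open>J\<close>, so in the
  quotient \<open>\<B>\<close> all such products vanish; but \<open>\<B>\<close> contains the upper triangular matrices of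
  arbitrarily large size \<open>N\<close>, where \<open>e\<^sub>0\<^sub>1 e\<^sub>1\<^sub>2 \<dots>\<close> is a non-zero product of \<open>N - 1\<close> commutators
  \<open>[e\<^sub>i\<^sub>i, e\<^sub>i\<^sub>,\<^sub>i\<^sub>+\<^sub>1]\<close>. Four facts lead to the identity.

  \<^item> \<open>J\<close> is closed, although \<open>\<phi>\<close> is not assumed continuous (\<open>kernel_closed\<close>). The separating
    space of \<open>\<phi>\<close> is a closed ideal of \<open>\<B>\<close>. Were it not zero, it would contain a matrix unit, and
    below the range of that unit there is an infinite strictly decreasing sequence of diagonal
    projections; a gliding hump along this sequence yields an element of \<open>\<A>\<close> whose image has
    infinite norm (\<open>no_hump\<close>).

  \<^item> A non-zero closed ideal of a triangular UHF algebra contains the corner unit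
    \<open>e\<^sub>0\<^sub>,\<^sub>n\<^sub>-\<^sub>1\<close> of some level (\<open>closed_ideal_contains_corner\<close>). This rests on the conditional
    expectation onto the diagonal and on its faithfulness (\<open>expectation_faithful\<close>), which also
    identifies \<open>\<A> \<inter> \<A>\<^sup>*\<close> with the closure of the diagonal matrices (\<open>diagonal_AA\<close>).

  \<^item> If \<open>\<A>\<close> is \<open>\<int>\<close>-analytic with cocycle \<open>c\<close>, then \<open>c\<close> is bounded on the compact open set of
    pairs related by a matrix unit \<open>v\<close> (\<open>cocycle_bounded\<close>). Between two indices \<open>s < t\<close> of a level
    there is a chain of \<open>t - s\<close> consecutive units, along each of which \<open>c\<close> increases by at
    least \<open>1\<close>. So the copies \<open>e\<^sub>s\<^sub>t\<close> of \<open>v\<close> in all later levels satisfy \<open>t - s \<le> M\<close> with one bound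
    \<open>M\<close> (\<open>copies_bounded\<close>). This is false, for instance, in a refinement limit algebra.

  \<^item> Take for \<open>v\<close> the corner unit in \<open>J\<close>. Every index of a later level lies between the two ends
    of some copy of \<open>v\<close>, hence every interval of length \<open>2 M\<close> contains a whole copy, and so
    \<open>e\<^sub>a\<^sub>b\<close> belongs to \<open>J\<close> as soon as \<open>b - a \<ge> 2 M\<close> (\<open>long_units_in_ideal\<close>). A commutator of upper
    triangular matrices is strictly upper triangular, so a product of \<open>2 M + 1\<close> commutators
    of matrices of the same level lies in \<open>J\<close>, and by closedness the same holds throughout \<open>\<A>\<close>
    (\<open>comm_prod_in_ideal\<close>).
\<close>

section \<open>\<open>C\<^sup>*\<close>-algebras without unit\<close>

subclass (in cstar_algebra) banach ..

lemma scaleC_zero_left [simp]: "0 *\<^sub>C (a::'a::cstar_algebra) = 0"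
  using scaleC_of_real[of 0 a] by simp

lemma scaleC_one [simp]: "1 *\<^sub>C (a::'a::cstar_algebra) = a"
  using scaleC_of_real[of 1 a] by simp

lemma scaleC_zero_right [simp]: "z *\<^sub>C (0::'a::cstar_algebra) = 0"
  using scaleC_add_right[of z 0 "0::'a"] by simp

lemma scaleC_minus_one: "(-1) *\<^sub>C (a::'a::cstar_algebra) = - a"
  using scaleC_of_real[of "-1" a] by simp

lemma scaleC_minus_left: "(- z) *\<^sub>C (a::'a::cstar_algebra) = - (z *\<^sub>C a)"
  using scaleC_scaleC[of "-1" z a] by (simp add: scaleC_minus_one)

lemma scaleC_minus_right: "z *\<^sub>C (- a) = - (z *\<^sub>C (a::'a::cstar_algebra))"
  using scaleC_scaleC[of z "-1" a] scaleC_scaleC[of "-1" z a]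
  by (simp add: scaleC_minus_one)

lemma scaleC_diff_left: "(z - w) *\<^sub>C (a::'a::cstar_algebra) = z *\<^sub>C a - w *\<^sub>C a"
  using scaleC_add_left[of z "-w" a] by (simp add: scaleC_minus_left)

lemma scaleC_diff_right: "z *\<^sub>C (a - b) = z *\<^sub>C a - z *\<^sub>C (b::'a::cstar_algebra)"
  using scaleC_add_right[of z a "-b"] by (simp add: scaleC_minus_right)

lemma scaleC_sum_right: "z *\<^sub>C (\<Sum>i\<in>I. f i) = (\<Sum>i\<in>I. z *\<^sub>C (f i :: 'a::cstar_algebra))"
  by (induction I rule: infinite_finite_induct) (auto simp: scaleC_add_right)

lemma scaleC_sum_left: "(\<Sum>i\<in>I. f i) *\<^sub>C (a::'a::cstar_algebra) = (\<Sum>i\<in>I. f i *\<^sub>C a)"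
  by (induction I rule: infinite_finite_induct) (auto simp: scaleC_add_left)

lemma scaleC_eq_0_iff: "z *\<^sub>C (a::'a::cstar_algebra) = 0 \<longleftrightarrow> z = 0 \<or> a = 0"
  using norm_scaleC[of z a] by (metis mult_eq_0_iff norm_eq_zero scaleC_zero_left scaleC_zero_right)

lemma scaleC_mult_scaleC:
  "(z *\<^sub>C (a::'a::cstar_algebra)) * (w *\<^sub>C b) = (z * w) *\<^sub>C (a * b)"
  by (simp add: scaleC_mult_left scaleC_mult_right scaleC_scaleC mult.commute)

lemma cstar_zero [simp]: "cstar (0::'a::cstar_algebra) = 0"
  using cstar_add[of 0 "0::'a"] by simp

lemma cstar_minus: "cstar (- a) = - cstar (a::'a::cstar_algebra)"
  using cstar_add[of a "-a"] by (simp add: add_eq_0_iff)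

lemma cstar_diff: "cstar (a - b) = cstar a - cstar (b::'a::cstar_algebra)"
  using cstar_add[of a "-b"] by (simp add: cstar_minus)

lemma cstar_sum: "cstar (\<Sum>i\<in>I. f i) = (\<Sum>i\<in>I. cstar (f i :: 'a::cstar_algebra))"
  by (induction I rule: infinite_finite_induct) (auto simp: cstar_add)

lemma norm_cstar_le: "norm a \<le> norm (cstar (a::'a::cstar_algebra))"
proof (cases "a = 0")
  case False
  have "norm a * norm a \<le> norm (cstar a) * norm a"
    using cstar_identity[of a] norm_mult_ineq[of "cstar a" a] by (simp add: power2_eq_square)
  then show ?thesis using False by simp
qed simp

lemma norm_cstar [simp]: "norm (cstar a) = norm (a::'a::cstar_algebra)"
  using norm_cstar_le[of a] norm_cstar_le[of "cstar a"] by (simp add: cstar_cstar)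

lemma norm_mult_cstar: "norm (a * cstar a) = (norm (a::'a::cstar_algebra))\<^sup>2"
  using cstar_identity[of "cstar a"] by (simp add: cstar_cstar)

lemma bounded_linear_cstar: "bounded_linear (cstar :: 'a::cstar_algebra \<Rightarrow> 'a)"
proof (rule bounded_linear_intro[where K = 1])
  fix r and x :: 'a
  show "cstar (scaleR r x) = scaleR r (cstar x)"
    using cstar_scaleC[of "complex_of_real r" x] by (simp add: scaleC_of_real)
qed (auto simp: cstar_add)

lemmas tendsto_cstar = bounded_linear.tendsto[OF bounded_linear_cstar]

lemma bounded_linear_scaleC: "bounded_linear (\<lambda>a. z *\<^sub>C (a::'a::cstar_algebra))"
proof (rule bounded_linear_intro[where K = "cmod z"])
  fix r and x :: 'a
  show "z *\<^sub>C (scaleR r x) = scaleR r (z *\<^sub>C x)"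
    unfolding scaleC_of_real[symmetric] scaleC_scaleC by (simp add: mult.commute)
qed (auto simp: scaleC_add_right norm_scaleC mult.commute)

lemmas tendsto_scaleC = bounded_linear.tendsto[OF bounded_linear_scaleC]

lemma norm_projection:
  assumes "cstar p = p" "p * p = p" "p \<noteq> (0::'a::cstar_algebra)"
  shows "norm p = 1"
  using cstar_identity[of p] assms by (simp add: power2_eq_square)

lemma norm_partial_isometry:
  assumes "cstar v * v * (cstar v * v) = cstar v * v" "v \<noteq> (0::'a::cstar_algebra)"
  shows "norm v = 1"
proof -
  have "norm (cstar v * v) = 1"
  proof (rule norm_projection)
    show "cstar v * v \<noteq> 0" using cstar_identity[of v] assms(2) by auto
  qed (use assms in \<open>simp_all add: cstar_mult cstar_cstar\<close>)
  then show ?thesis using cstar_identity[of v]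
    by (simp add: power2_eq_1_iff) (smt (verit) norm_ge_zero)
qed

text \<open>
  The power \<open>h^(2^j)\<close>. The algebra need not have a unit, so \<open>(^)\<close> is not available.
\<close>

primrec sq_iter :: "nat \<Rightarrow> 'a::times \<Rightarrow> 'a" where
  "sq_iter 0 h = h"
| "sq_iter (Suc j) h = sq_iter j h * sq_iter j h"

lemma cstar_sq_iter: "cstar h = h \<Longrightarrow> cstar (sq_iter j h) = sq_iter j (h::'a::cstar_algebra)"
  by (induction j) (auto simp: cstar_mult)

lemma norm_sq_iter_le: "norm (sq_iter j h) \<le> norm (h::'a::real_normed_algebra) ^ (2^j)"
proof (induction j)
  case (Suc j)
  have "norm (sq_iter (Suc j) h) \<le> norm (sq_iter j h) * norm (sq_iter j h)"
    by (simp add: norm_mult_ineq)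
  also have "\<dots> \<le> norm h ^ (2^j) * norm h ^ (2^j)"
    using Suc by (intro mult_mono) auto
  finally show ?case by (simp add: mult_2 power_add)
qed simp

lemma norm_sq_iter:
  assumes "cstar h = (h::'a::cstar_algebra)"
  shows "norm (sq_iter j h) = norm h ^ (2^j)"
proof (induction j)
  case (Suc j)
  have "norm (sq_iter (Suc j) h) = (norm (sq_iter j h))\<^sup>2"
    using cstar_identity[of "sq_iter j h"] cstar_sq_iter[OF assms, of j] by simp
  then show ?case using Suc by (simp add: power2_eq_square mult_2 power_add)
qed simp

text \<open>
  For self-adjoint \<open>h\<close> the \<open>C\<^sup>*\<close>-identity gives \<open>norm (h^(2^j)) = norm h ^ (2^j)\<close>, so the constant
  factor \<open>K\<close> is lost on taking roots.
\<close>

lemma norm_le_of_sq_iter_growth: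
  assumes h: "cstar h = (h::'a::cstar_algebra)" and R: "R \<ge> 0"
    and growth: "\<And>j. norm (sq_iter j h) \<le> K * R ^ (2^j)"
  shows "norm h \<le> R"
proof (rule ccontr)
  assume "\<not> norm h \<le> R"
  then have gt: "R < norm h" by simp
  show False
  proof (cases "R = 0")
    case True
    then have "norm (sq_iter 0 h) \<le> 0" using growth[of 0] by simp
    then show False using gt True by simp
  next
    case False
    then have R0: "R > 0" using R by simp
    define t where "t = norm h / R"
    have t1: "t > 1" using gt R0 by (simp add: t_def)
    obtain N where N: "K < t ^ N" using real_arch_pow[OF t1] by blast
    have "t ^ N \<le> t ^ (2^N)" using t1 by (intro power_increasing) (auto intro: less_imp_le less_exp)
    with N have "K < t ^ (2^N)" by simp
    then have "K * R ^ (2^N) < norm h ^ (2^N)"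
      using R0 by (simp add: t_def power_divide field_simps)
    then show False using growth[of N] norm_sq_iter[OF h, of N] by simp
  qed
qed

text \<open>
  The powers of \<open>h\<^sup>*h\<close> for a block diagonal \<open>h\<close> are formed blockwise, so they grow no faster than
  \<open>card I\<close> times the powers of the largest block.
\<close>

lemma norm_sum_blocks_le:
  fixes p h :: "'i \<Rightarrow> 'a::cstar_algebra"
  assumes fin: "finite I"
    and orth: "\<And>i j. i \<in> I \<Longrightarrow> j \<in> I \<Longrightarrow> p i * p j = (if i = j then p i else 0)"
    and block: "\<And>i. i \<in> I \<Longrightarrow> p i * h i = h i" "\<And>i. i \<in> I \<Longrightarrow> h i * p i = h i"
    and pst: "\<And>i. i \<in> I \<Longrightarrow> cstar (p i) = p i"
    and bound: "\<And>i. i \<in> I \<Longrightarrow> norm (h i) \<le> R" and R: "R \<ge> 0"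
  shows "norm (\<Sum>i\<in>I. h i) \<le> R"
proof -
  have orth0: "x i * y j = 0" if "i \<in> I" "j \<in> I" "i \<noteq> j" "x i * p i = x i" "p j * y j = y j" for x y i j
  proof -
    have "x i * y j = (x i * p i) * (p j * y j)" using that by simp
    also have "\<dots> = x i * (p i * p j) * y j" by (simp add: mult.assoc)
    also have "\<dots> = 0" using orth[of i j] that by simp
    finally show ?thesis .
  qed
  have prod: "(\<Sum>i\<in>I. x i) * (\<Sum>i\<in>I. y i) = (\<Sum>i\<in>I. x i * y i)"
    if x: "\<And>i. i \<in> I \<Longrightarrow> x i * p i = x i" and y: "\<And>i. i \<in> I \<Longrightarrow> p i * y i = y i" for x y
  proof -
    have "(\<Sum>i\<in>I. x i) * (\<Sum>i\<in>I. y i) = (\<Sum>i\<in>I. \<Sum>j\<in>I. x i * y j)"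
      by (simp add: sum_product)
    also have "\<dots> = (\<Sum>i\<in>I. \<Sum>j\<in>I. if j = i then x i * y i else 0)"
      by (intro sum.cong refl) (use orth0 x y in auto)
    also have "\<dots> = (\<Sum>i\<in>I. x i * y i)" using fin by simp
    finally show ?thesis .
  qed
  define g where "g i = cstar (h i) * h i" for i
  have gl: "p i * g i = g i" if "i \<in> I" for i
  proof -
    have "p i * cstar (h i) = cstar (h i * p i)" using pst[OF that] by (simp add: cstar_mult)
    then show ?thesis using block(2)[OF that] by (simp add: g_def mult.assoc[symmetric])
  qed
  have gr: "g i * p i = g i" if "i \<in> I" for i
    using block(2)[OF that] by (simp add: g_def mult.assoc)
  have sl: "p i * sq_iter j (g i) = sq_iter j (g i)" if "i \<in> I" for i j
    by (induction j) (simp_all add: gl[OF that] mult.assoc[symmetric])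
  have sr: "sq_iter j (g i) * p i = sq_iter j (g i)" if "i \<in> I" for i j
    by (induction j) (simp_all add: gr[OF that] mult.assoc)
  have sq: "sq_iter j (\<Sum>i\<in>I. g i) = (\<Sum>i\<in>I. sq_iter j (g i))" for j
    by (induction j) (auto simp: prod sl sr)
  have hh: "cstar (\<Sum>i\<in>I. h i) * (\<Sum>i\<in>I. h i) = (\<Sum>i\<in>I. g i)"
    unfolding cstar_sum g_def
  proof (rule prod)
    fix i assume i: "i \<in> I"
    have "cstar (p i * h i) = cstar (h i)" using block(1)[OF i] by simp
    then show "cstar (h i) * p i = cstar (h i)" using pst[OF i] by (simp add: cstar_mult)
  qed (use block in auto)
  have "norm (\<Sum>i\<in>I. g i) \<le> R\<^sup>2"
  proof (rule norm_le_of_sq_iter_growth[where K = "real (card I)"])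
    show "cstar (\<Sum>i\<in>I. g i) = (\<Sum>i\<in>I. g i)"
      by (simp add: cstar_sum g_def cstar_mult cstar_cstar)
    fix j
    have "norm (sq_iter j (\<Sum>i\<in>I. g i)) \<le> (\<Sum>i\<in>I. norm (sq_iter j (g i)))"
      unfolding sq by (rule norm_sum)
    also have "\<dots> \<le> (\<Sum>i\<in>I. (R\<^sup>2) ^ (2^j))"
    proof (rule sum_mono)
      fix i assume i: "i \<in> I"
      have "norm (g i) \<le> R\<^sup>2"
        using bound[OF i] by (simp add: g_def cstar_identity power_mono)
      then have "norm (g i) ^ (2^j) \<le> (R\<^sup>2) ^ (2^j)" by (simp add: power_mono)
      then show "norm (sq_iter j (g i)) \<le> (R\<^sup>2) ^ (2^j)"
        using norm_sq_iter_le[of j "g i"] by linarith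
    qed
    finally show "norm (sq_iter j (\<Sum>i\<in>I. g i)) \<le> real (card I) * (R\<^sup>2) ^ (2^j)" by simp
  qed simp
  then have "(norm (\<Sum>i\<in>I. h i))\<^sup>2 \<le> R\<^sup>2" using hh cstar_identity by metis
  then show ?thesis using R by (rule power2_le_imp_le)
qed

section \<open>Towers of matrix units\<close>

definition matrix_comb ::
  "(nat \<Rightarrow> nat) \<Rightarrow> (nat \<Rightarrow> nat \<Rightarrow> nat \<Rightarrow> 'a::cstar_algebra) \<Rightarrow> nat \<Rightarrow> (nat \<Rightarrow> nat \<Rightarrow> complex) \<Rightarrow> 'a" where
  "matrix_comb n e k f = (\<Sum>i<n k. \<Sum>j<n k. f i j *\<^sub>C e k i j)"

text \<open>
  The matrices of level \<open>k\<close> that are supported on a pattern \<open>P\<close> of index pairs. The patterns of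
  interest are \<open>\<lambda>_ _. True\<close>, \<open>(\<le>)\<close>, \<open>(=)\<close> and \<open>\<lambda>i j. i + l \<le> j\<close>.
\<close>

definition level_span ::
  "(nat \<Rightarrow> nat) \<Rightarrow> (nat \<Rightarrow> nat \<Rightarrow> nat \<Rightarrow> 'a::cstar_algebra) \<Rightarrow> (nat \<Rightarrow> nat \<Rightarrow> bool) \<Rightarrow> nat \<Rightarrow> 'a set" where
  "level_span n e P k = {matrix_comb n e k f |f. \<forall>i j. \<not> P i j \<longrightarrow> f i j = 0}"

text \<open>
  The images in the direct limit of the matrix units of all levels. A matrix unit of one level is a
  sum of matrix units of the next level only up to scalar factors of modulus \<open>1\<close>; all that is known
  about it is that it normalizes the later diagonals.
\<close>

locale matrix_tower =
  fixes n :: "nat \<Rightarrow> nat" and e :: "nat \<Rightarrow> nat \<Rightarrow> nat \<Rightarrow> 'a::cstar_algebra" and u :: 'a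
  assumes n_pos: "0 < n k"
    and n_unbounded: "\<exists>k. m < n k"
    and e_mult: "i < n k \<Longrightarrow> j < n k \<Longrightarrow> r < n k \<Longrightarrow> s < n k \<Longrightarrow>
                   e k i j * e k r s = (if j = r then e k i s else 0)"
    and e_star: "i < n k \<Longrightarrow> j < n k \<Longrightarrow> cstar (e k i j) = e k j i"
    and e_nonzero: "i < n k \<Longrightarrow> e k i i \<noteq> 0"
    and e_sum: "(\<Sum>i<n k. e k i i) = u"
    and e_nested: "i < n k \<Longrightarrow> j < n k \<Longrightarrow> e k i j \<in> level_span n e (\<lambda>_ _. True) (Suc k)"
    and e_upper: "i \<le> j \<Longrightarrow> j < n k \<Longrightarrow> e k i j \<in> level_span n e (\<le>) (Suc k)"
    and e_normalizes: "k \<le> m \<Longrightarrow> i < n k \<Longrightarrow> j < n k \<Longrightarrow> s < n m \<Longrightarrow>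
                   e k i j * e m s s * e k j i \<in> level_span n e (=) m"
begin

abbreviation "comb \<equiv> matrix_comb n e"
abbreviation "lspan \<equiv> level_span n e"
abbreviation "full \<equiv> level_span n e (\<lambda>_ _. True)"
abbreviation "upper \<equiv> level_span n e (\<le>)"
abbreviation "diag \<equiv> level_span n e (=)"

lemma comb_entry:
  assumes "i < n k" "j < n k" "r < n k" "s < n k"
  shows "e k r i * comb k f * e k j s = f i j *\<^sub>C e k r s"
proof -
  have "e k r i * comb k f * e k j s = (\<Sum>a<n k. \<Sum>b<n k. f a b *\<^sub>C (e k r i * e k a b * e k j s))"
    by (simp add: matrix_comb_def sum_distrib_left sum_distrib_right scaleC_mult_left scaleC_mult_right)
  also have "\<dots> = (\<Sum>a<n k. \<Sum>b<n k. if b = j then (if a = i then f i j *\<^sub>C e k r s else 0) else 0)"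
    by (intro sum.cong refl) (use assms in \<open>auto simp: e_mult\<close>)
  also have "\<dots> = f i j *\<^sub>C e k r s" using assms by simp
  finally show ?thesis .
qed

lemma in_lspanI: "x = comb k f \<Longrightarrow> (\<And>i j. \<not> P i j \<Longrightarrow> f i j = 0) \<Longrightarrow> x \<in> lspan P k"
  by (auto simp: level_span_def)

lemma lspan_mono: "(\<And>i j. P i j \<Longrightarrow> Q i j) \<Longrightarrow> lspan P k \<subseteq> lspan Q k"
  by (force simp: level_span_def)

lemma lspan_full: "x \<in> lspan P k \<Longrightarrow> x \<in> full k"
  by (force simp: level_span_def)

lemma lspan_zero [simp]: "0 \<in> lspan P k"
  by (rule in_lspanI[where f = "\<lambda>_ _. 0"]) (auto simp: matrix_comb_def)

lemma lspan_add: "x \<in> lspan P k \<Longrightarrow> y \<in> lspan P k \<Longrightarrow> x + y \<in> lspan P k"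
proof -
  assume "x \<in> lspan P k" "y \<in> lspan P k"
  then obtain f g where "x = comb k f" "\<forall>i j. \<not> P i j \<longrightarrow> f i j = 0"
      "y = comb k g" "\<forall>i j. \<not> P i j \<longrightarrow> g i j = 0" by (auto simp: level_span_def)
  then show ?thesis
    by (intro in_lspanI[where f = "\<lambda>i j. f i j + g i j"])
       (auto simp: matrix_comb_def scaleC_add_left sum.distrib)
qed

lemma lspan_scaleC: "x \<in> lspan P k \<Longrightarrow> z *\<^sub>C x \<in> lspan P k"
proof -
  assume "x \<in> lspan P k"
  then obtain f where "x = comb k f" "\<forall>i j. \<not> P i j \<longrightarrow> f i j = 0" by (auto simp: level_span_def)
  then show ?thesis
    by (intro in_lspanI[where f = "\<lambda>i j. z * f i j"])
       (auto simp: matrix_comb_def scaleC_sum_right scaleC_scaleC)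
qed

lemma lspan_minus: "x \<in> lspan P k \<Longrightarrow> - x \<in> lspan P k"
  using lspan_scaleC[of x P k "-1"] by (simp add: scaleC_minus_one)

lemma lspan_diff: "x \<in> lspan P k \<Longrightarrow> y \<in> lspan P k \<Longrightarrow> x - y \<in> lspan P k"
  using lspan_add[of x P k "-y"] lspan_minus[of y P k] by simp

lemma lspan_sum: "(\<And>i. i \<in> I \<Longrightarrow> f i \<in> lspan P k) \<Longrightarrow> (\<Sum>i\<in>I. f i) \<in> lspan P k"
  by (induction I rule: infinite_finite_induct) (auto intro: lspan_add)

lemma lspan_unit:
  assumes "i < n k" "j < n k" "P i j"
  shows "e k i j \<in> lspan P k"
proof (rule in_lspanI[where f = "\<lambda>a b. if a = i \<and> b = j then 1 else 0"])
  have "comb k (\<lambda>a b. if a = i \<and> b = j then 1 else 0) =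
      (\<Sum>a<n k. \<Sum>b<n k. if b = j then (if a = i then e k i j else 0) else 0)"
    unfolding matrix_comb_def by (intro sum.cong refl) auto
  also have "\<dots> = e k i j" using assms by simp
  finally show "e k i j = comb k (\<lambda>a b. if a = i \<and> b = j then 1 else 0)" by simp
qed (use assms in auto)

lemma lspan_induct [consumes 1, case_names zero add scale unit]:
  assumes "x \<in> lspan P k" and "Q 0"
    and "\<And>x y. Q x \<Longrightarrow> Q y \<Longrightarrow> Q (x + y)" and "\<And>z x. Q x \<Longrightarrow> Q (z *\<^sub>C x)"
    and "\<And>i j. i < n k \<Longrightarrow> j < n k \<Longrightarrow> P i j \<Longrightarrow> Q (e k i j)"
  shows "Q x"
proof -
  obtain f where x: "x = comb k f" and f: "\<forall>i j. \<not> P i j \<longrightarrow> f i j = 0"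
    using assms(1) by (auto simp: level_span_def)
  have Qs: "Q (\<Sum>i\<in>I. g i)" if "\<And>i. i \<in> I \<Longrightarrow> Q (g i)" for g :: "nat \<Rightarrow> 'a" and I
    using that by (induction I rule: infinite_finite_induct) (auto intro: assms(2,3))
  show ?thesis unfolding x matrix_comb_def
  proof (intro Qs)
    fix i j assume ij: "i \<in> {..<n k}" "j \<in> {..<n k}"
    show "Q (f i j *\<^sub>C e k i j)"
    proof (cases "P i j")
      case True
      then show ?thesis using ij assms(4,5) by auto
    qed (use f assms(2) in simp)
  qed
qed

lemma lspan_mult:
  assumes x: "x \<in> lspan P k" and y: "y \<in> lspan Q k"
    and PQ: "\<And>i j l. P i j \<Longrightarrow> Q j l \<Longrightarrow> R i l"
  shows "x * y \<in> lspan R k"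
  using x
proof (induction rule: lspan_induct)
  case (unit i j)
  show ?case using y
  proof (induction rule: lspan_induct)
    case (unit r s)
    then show ?case using \<open>i < n k\<close> \<open>j < n k\<close> \<open>P i j\<close> PQ[of i j s]
      by (auto simp: e_mult intro: lspan_unit)
  qed (auto simp: distrib_left scaleC_mult_right intro: lspan_add lspan_scaleC)
qed (auto simp: distrib_right scaleC_mult_left intro: lspan_add lspan_scaleC)

lemma lspan_cstar:
  assumes x: "x \<in> lspan P k" and PQ: "\<And>i j. P i j \<Longrightarrow> Q j i"
  shows "cstar x \<in> lspan Q k"
  using x
proof (induction rule: lspan_induct)
  case (unit i j)
  then show ?case by (auto simp: e_star intro!: lspan_unit PQ)
qed (auto simp: cstar_add cstar_scaleC intro: lspan_add lspan_scaleC)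

lemma full_mult: "x \<in> full k \<Longrightarrow> y \<in> full k \<Longrightarrow> x * y \<in> full k"
  by (rule lspan_mult) auto

lemma full_cstar: "x \<in> full k \<Longrightarrow> cstar x \<in> full k"
  by (rule lspan_cstar) auto

lemma upper_mult: "x \<in> upper k \<Longrightarrow> y \<in> upper k \<Longrightarrow> x * y \<in> upper k"
  by (rule lspan_mult[where P = "(\<le>)" and Q = "(\<le>)"]) auto

lemma diag_mult: "x \<in> diag k \<Longrightarrow> y \<in> diag k \<Longrightarrow> x * y \<in> diag k"
  by (rule lspan_mult[where P = "(=)" and Q = "(=)"]) auto

lemma full_entry:
  assumes "x \<in> full k" "i < n k" "j < n k"
  obtains c where "\<And>r s. r < n k \<Longrightarrow> s < n k \<Longrightarrow> e k r i * x * e k j s = c *\<^sub>C e k r s"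
proof -
  from assms obtain f where "x = comb k f" by (auto simp: level_span_def)
  then show ?thesis using that[of "f i j"] comb_entry assms by blast
qed

lemma lspan_entry_zero:
  assumes "x \<in> lspan P k" "i < n k" "j < n k" "\<not> P i j"
  shows "e k i i * x * e k j j = 0"
proof -
  from assms obtain f where "x = comb k f" "f i j = 0" by (auto simp: level_span_def)
  then show ?thesis using comb_entry[of i k j i j f] assms by simp
qed

lemma unit_scaleC_eq_0: "i < n k \<Longrightarrow> j < n k \<Longrightarrow> c *\<^sub>C e k i j = 0 \<longleftrightarrow> c = 0"
  using e_mult[of i k j j i] e_nonzero[of i k] by (auto simp: scaleC_eq_0_iff)

lemma lspanI_entries:
  assumes "x \<in> full k" and "\<And>i j. i < n k \<Longrightarrow> j < n k \<Longrightarrow> \<not> P i j \<Longrightarrow> e k i i * x * e k j j = 0"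
  shows "x \<in> lspan P k"
proof -
  from assms(1) obtain f where x: "x = comb k f" by (auto simp: level_span_def)
  have f0: "f i j = 0" if "i < n k" "j < n k" "\<not> P i j" for i j
    using assms(2)[OF that] comb_entry[of i k j i j f] that by (simp add: x unit_scaleC_eq_0)
  show ?thesis
  proof (rule in_lspanI[where f = "\<lambda>i j. if P i j then f i j else 0"])
    show "x = comb k (\<lambda>i j. if P i j then f i j else 0)"
      unfolding x matrix_comb_def by (intro sum.cong refl) (auto simp: f0)
  qed auto
qed

lemma u_full: "u \<in> diag k"
  unfolding e_sum[of k, symmetric] by (intro lspan_sum lspan_unit) auto

lemma u_mult_full: "x \<in> full k \<Longrightarrow> u * x = x" 
proof (induction rule: lspan_induct)
  case (unit i j)
  have "u * e k i j = (\<Sum>a<n k. if a = i then e k i j else 0)"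
    unfolding e_sum[of k, symmetric] sum_distrib_right
    by (intro sum.cong refl) (use unit in \<open>auto simp: e_mult\<close>)
  then show ?case using unit by simp
qed (auto simp: distrib_left scaleC_mult_right)

lemma full_mult_u: "x \<in> full k \<Longrightarrow> x * u = x" 
proof (induction rule: lspan_induct)
  case (unit i j)
  have "e k i j * u = (\<Sum>a<n k. if a = j then e k i j else 0)"
    unfolding e_sum[of k, symmetric] sum_distrib_left
    by (intro sum.cong refl) (use unit in \<open>auto simp: e_mult\<close>)
  then show ?case using unit by simp
qed (auto simp: distrib_right scaleC_mult_left)

lemma norm_unit: "i < n k \<Longrightarrow> j < n k \<Longrightarrow> norm (e k i j) = 1"
proof (rule norm_partial_isometry)
  assume "i < n k" "j < n k"
  then show "e k i j \<noteq> 0" using unit_scaleC_eq_0[of i k j 1] by simp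
qed (simp add: e_star e_mult)

lemma full_Suc: "x \<in> full k \<Longrightarrow> x \<in> full (Suc k)"
  by (induction rule: lspan_induct) (auto intro: lspan_add lspan_scaleC e_nested)

lemma upper_Suc: "x \<in> upper k \<Longrightarrow> x \<in> upper (Suc k)"
  by (induction rule: lspan_induct) (auto intro: lspan_add lspan_scaleC e_upper)

lemma full_le: "k \<le> m \<Longrightarrow> x \<in> full k \<Longrightarrow> x \<in> full m"
  by (induction rule: dec_induct) (auto intro: full_Suc)

lemma upper_le: "k \<le> m \<Longrightarrow> x \<in> upper k \<Longrightarrow> x \<in> upper m"
  by (induction rule: dec_induct) (auto intro: upper_Suc)

lemma upper_selfadjoint_diag:
  assumes "x \<in> upper m" "cstar x \<in> upper m"
  shows "x \<in> diag m"
proof (rule lspanI_entries)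
  fix i j assume ij: "i < n m" "j < n m" "i \<noteq> j"
  show "e m i i * x * e m j j = 0"
  proof (cases "i \<le> j")
    case False
    then show ?thesis using lspan_entry_zero[OF assms(1) ij(1,2)] by simp
  next
    case True
    then have "e m j j * cstar x * e m i i = 0"
      using lspan_entry_zero[OF assms(2) ij(2,1)] ij by simp
    then have "cstar (e m j j * cstar x * e m i i) = 0" by simp
    then show ?thesis using ij by (simp add: cstar_mult cstar_cstar e_star mult.assoc)
  qed
qed (use assms lspan_full in auto)

lemma diag_le:
  assumes "k \<le> m" "x \<in> diag k" shows "x \<in> diag m"
proof (rule upper_selfadjoint_diag)
  have "diag k \<subseteq> upper k" by (rule lspan_mono) auto
  moreover have "cstar x \<in> diag k" by (rule lspan_cstar[OF assms(2)]) auto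
  ultimately show "x \<in> upper m" "cstar x \<in> upper m" using assms upper_le by blast+
qed

lemma diag_comb:
  assumes "x \<in> diag k" obtains g where "x = (\<Sum>i<n k. g i *\<^sub>C e k i i)"
proof -
  from assms obtain f where f: "x = comb k f" "\<forall>i j. i \<noteq> j \<longrightarrow> f i j = 0"
    by (auto simp: level_span_def)
  have "x = (\<Sum>i<n k. \<Sum>j<n k. if j = i then f i i *\<^sub>C e k i i else 0)"
    unfolding f matrix_comb_def by (intro sum.cong refl) (use f in auto)
  then show ?thesis using that[of "\<lambda>i. f i i"] by simp
qed

lemma diag_comb_mult:
  assumes "s < n k"
  shows "(\<Sum>i<n k. g i *\<^sub>C e k i i) * e k s s = g s *\<^sub>C e k s s"
    and "e k s s * (\<Sum>i<n k. g i *\<^sub>C e k i i) = g s *\<^sub>C e k s s"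
proof -
  have "(\<Sum>i<n k. g i *\<^sub>C e k i i) * e k s s = (\<Sum>i<n k. if i = s then g s *\<^sub>C e k s s else 0)"
    unfolding sum_distrib_right
    by (intro sum.cong refl) (use assms in \<open>auto simp: e_mult scaleC_mult_left\<close>)
  then show "(\<Sum>i<n k. g i *\<^sub>C e k i i) * e k s s = g s *\<^sub>C e k s s" using assms by simp
  have "e k s s * (\<Sum>i<n k. g i *\<^sub>C e k i i) = (\<Sum>i<n k. if i = s then g s *\<^sub>C e k s s else 0)"
    unfolding sum_distrib_left
    by (intro sum.cong refl) (use assms in \<open>auto simp: e_mult scaleC_mult_right\<close>)
  then show "e k s s * (\<Sum>i<n k. g i *\<^sub>C e k i i) = g s *\<^sub>C e k s s" using assms by simp
qed

lemma diag_mult_unit: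
  assumes "x \<in> diag k" "s < n k"
  shows "\<exists>c. x * e k s s = c *\<^sub>C e k s s \<and> e k s s * x = c *\<^sub>C e k s s"
proof -
  obtain g where "x = (\<Sum>i<n k. g i *\<^sub>C e k i i)" using diag_comb assms(1) .
  then show ?thesis using diag_comb_mult[OF assms(2), of g] by blast
qed

lemma diag_commute:
  assumes "x \<in> diag k" "y \<in> diag k" shows "x * y = y * x"
  using assms(2)
proof (induction rule: lspan_induct)
  case (unit i j)
  then show ?case using diag_mult_unit[OF assms(1), of i] by auto
qed (auto simp: distrib_left distrib_right scaleC_mult_left scaleC_mult_right)

text \<open>
  Diagonal units of level \<open>k\<close> are diagonal at level \<open>m\<close>, hence act on \<open>e m s s\<close> as scalars. The
  scalars are idempotent and add up to \<open>1\<close>, so one of them is \<open>1\<close>.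
\<close>

lemma ex1_position:
  assumes km: "k \<le> m" and s: "s < n m"
  shows "\<exists>i<n k. e k i i * e m s s = e m s s"
proof -
  have "\<forall>i\<in>{..<n k}. \<exists>c. e k i i * e m s s = c *\<^sub>C e m s s"
  proof
    fix i assume "i \<in> {..<n k}"
    then have "e k i i \<in> diag m" by (intro diag_le[OF km] lspan_unit) auto
    then show "\<exists>c. e k i i * e m s s = c *\<^sub>C e m s s" using diag_mult_unit[OF _ s] by blast
  qed
  then obtain c where c: "\<And>i. i < n k \<Longrightarrow> e k i i * e m s s = c i *\<^sub>C e m s s" by (metis lessThan_iff)
  have ss: "e m s s \<in> full m" using s by (intro lspan_unit) auto
  have "(\<Sum>i<n k. c i) *\<^sub>C e m s s = (\<Sum>i<n k. e k i i) * e m s s"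
    by (simp add: scaleC_sum_left sum_distrib_right c)
  also have "\<dots> = 1 *\<^sub>C e m s s" using u_mult_full[OF ss] by (simp add: e_sum)
  finally have "((\<Sum>i<n k. c i) - 1) *\<^sub>C e m s s = 0" by (simp add: scaleC_diff_left)
  then have "(\<Sum>i<n k. c i) = 1" using unit_scaleC_eq_0[OF s s] by (metis right_minus_eq)
  then obtain i where i: "i < n k" "c i \<noteq> 0" by (metis lessThan_iff sum.neutral zero_neq_one)
  have "c i *\<^sub>C e m s s = (e k i i * e k i i) * e m s s" using i by (simp add: e_mult c)
  also have "\<dots> = e k i i * (e k i i * e m s s)" by (simp only: mult.assoc)
  also have "\<dots> = (c i * c i) *\<^sub>C e m s s" using i by (simp add: c scaleC_mult_right scaleC_scaleC)
  finally have "(c i - c i * c i) *\<^sub>C e m s s = 0" by (simp add: scaleC_diff_left)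
  then have "c i - c i * c i = 0" using unit_scaleC_eq_0[OF s s] by blast
  then have "c i = 1" using i by simp
  then show ?thesis using c i by auto
qed

text \<open>
  The index of level \<open>k\<close> that lies above the index \<open>s\<close> of level \<open>m\<close>.
\<close>

definition pos :: "nat \<Rightarrow> nat \<Rightarrow> nat \<Rightarrow> nat" where
  "pos k m s = (SOME i. i < n k \<and> e k i i * e m s s = e m s s)"

lemma pos_less: "k \<le> m \<Longrightarrow> s < n m \<Longrightarrow> pos k m s < n k"
  and pos_mult: "k \<le> m \<Longrightarrow> s < n m \<Longrightarrow> e k (pos k m s) (pos k m s) * e m s s = e m s s"
  unfolding pos_def using someI_ex[OF ex1_position[of k m s, simplified Bex_def]] by blast+

lemma unit_mult_child:
  assumes "k \<le> m" "s < n m" "i < n k"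
  shows "e k i i * e m s s = (if i = pos k m s then e m s s else 0)"
    and "e m s s * e k i i = (if i = pos k m s then e m s s else 0)"
proof -
  let ?j = "pos k m s"
  have j: "?j < n k" using pos_less assms by blast
  have "e k i i * e m s s = e k i i * (e k ?j ?j * e m s s)" using pos_mult assms by simp
  also have "\<dots> = (e k i i * e k ?j ?j) * e m s s" by (simp only: mult.assoc)
  finally show *: "e k i i * e m s s = (if i = ?j then e m s s else 0)"
    using j assms pos_mult by (auto simp: e_mult)
  have "cstar (e k i i * e m s s) = cstar (if i = ?j then e m s s else 0)" using * by simp
  then show "e m s s * e k i i = (if i = ?j then e m s s else 0)"
    using assms by (simp add: cstar_mult e_star split: if_splits)
qed

lemma pos_unique: "k \<le> m \<Longrightarrow> s < n m \<Longrightarrow> i < n k \<Longrightarrow> e k i i * e m s s \<noteq> 0 \<Longrightarrow> pos k m s = i"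
  using unit_mult_child(1)[of k m s i] by (auto split: if_splits)

lemma pos_self: "s < n k \<Longrightarrow> pos k k s = s"
  by (rule pos_unique) (auto simp: e_mult e_nonzero)

lemma pos_trans:
  assumes "k \<le> l" "l \<le> m" "s < n m"
  shows "pos k l (pos l m s) = pos k m s"
proof -
  let ?t = "pos l m s" and ?i = "pos k l (pos l m s)"
  have t: "?t < n l" "?i < n k" using assms pos_less by auto
  have "e k ?i ?i * e m s s = e k ?i ?i * (e l ?t ?t * e m s s)" using pos_mult assms by simp
  also have "\<dots> = (e k ?i ?i * e l ?t ?t) * e m s s" by (simp only: mult.assoc)
  also have "\<dots> = e m s s" using pos_mult assms t by simp
  finally have "e k ?i ?i * e m s s \<noteq> 0" using e_nonzero assms by simp
  then show ?thesis using pos_unique[of k m s ?i] assms t by simp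
qed

text \<open>
  The unit \<open>v = e k i j\<close> carries the indices of level \<open>m\<close> below \<open>i\<close> to those below \<open>j\<close>. Since \<open>v\<close>
  normalizes the diagonal, \<open>q = v\<^sup>* e\<^sub>s\<^sub>s v\<close> is a diagonal projection. Its entries are
  \<open>cnj (c r) * c r'\<close>, where \<open>c\<close> is row \<open>s\<close> of \<open>v\<close>. So at most one \<open>c t\<close> is different from \<open>0\<close>, and it
  has modulus \<open>1\<close>.
\<close>

lemma partner:
  assumes km: "k \<le> m" and i: "i < n k" and j: "j < n k" and s: "s < n m" and si: "pos k m s = i"
  obtains t \<mu> where "t < n m" "cmod \<mu> = 1" "pos k m t = j"
    "e m s s * e k i j = \<mu> *\<^sub>C e m s t" "e k i j * e m t t = \<mu> *\<^sub>C e m s t"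
    "e k j i * e m s s * e k i j = e m t t" "e k i j * e m t t * e k j i = e m s s"
    "i \<le> j \<Longrightarrow> s \<le> t"
proof -
  define v where "v = e k i j"
  define p where "p = e m s s"
  define q where "q = cstar v * p * v"
  have vst: "cstar v = e k j i" using i j by (simp add: v_def e_star)
  have vv: "v * cstar v = e k i i" "cstar v * v = e k j j" using i j by (simp_all add: v_def e_star e_mult)
  have pst: "cstar p = p" and pp: "p * p = p" using s by (simp_all add: p_def e_star e_mult)
  have ip: "e k i i * p = p" "p * e k i i = p"
    using unit_mult_child[OF km s i] si by (simp_all add: p_def)
  have qd: "q \<in> diag m" unfolding q_def vst unfolding p_def v_def by (rule e_normalizes[OF km j i s])
  have vf: "v \<in> full m" unfolding v_def using i j by (intro full_le[OF km] lspan_unit) auto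
  have qq: "q * q = q"
  proof -
    have "q * q = cstar v * (p * (v * cstar v) * p) * v" by (simp add: q_def mult.assoc)
    then show ?thesis by (simp add: vv ip pp q_def)
  qed
  have qback: "v * q * cstar v = p"
  proof -
    have "v * q * cstar v = (v * cstar v) * p * (v * cstar v)" by (simp add: q_def mult.assoc)
    then show ?thesis by (simp add: vv ip)
  qed
  obtain g where g: "q = (\<Sum>t<n m. g t *\<^sub>C e m t t)" using diag_comb[OF qd] .
  have "p \<noteq> 0" using s e_nonzero by (simp add: p_def)
  then have "q \<noteq> 0" using qback by auto
  then obtain t where t: "t < n m" "g t \<noteq> 0"
    unfolding g by (metis (no_types, lifting) lessThan_iff scaleC_zero_left sum.neutral)
  have ent: "\<exists>c. p * v * e m r r = c *\<^sub>C e m s r" if "r < n m" for r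
    using full_entry[OF vf s that] s that unfolding p_def by metis
  then obtain c where c: "\<And>r. r < n m \<Longrightarrow> p * v * e m r r = c r *\<^sub>C e m s r" by metis
  have qc: "e m r r * q * e m r' r' = (cnj (c r) * c r') *\<^sub>C e m r r'" if r: "r < n m" "r' < n m" for r r'
  proof -
    have "cstar (p * v * e m r r) * (p * v * e m r' r') = e m r r * (cstar v * (p * p) * v) * e m r' r'"
      using r by (simp only: cstar_mult pst e_star mult.assoc)
    then have "e m r r * q * e m r' r' = cstar (p * v * e m r r) * (p * v * e m r' r')"
      by (simp only: pp q_def)
    also have "\<dots> = (cnj (c r) * c r') *\<^sub>C e m r r'"
      using r s by (simp add: c cstar_scaleC e_star e_mult scaleC_mult_scaleC)
    finally show ?thesis .
  qed
  have gdiag: "e m r r * q * e m r r = g r *\<^sub>C e m r r" if "r < n m" for r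
    using that unfolding g by (simp add: diag_comb_mult scaleC_mult_left e_mult)
  have gc: "g r = cnj (c r) * c r" if "r < n m" for r
  proof -
    have "(g r - cnj (c r) * c r) *\<^sub>C e m r r = 0"
      using gdiag[OF that] qc[OF that that] by (simp add: scaleC_diff_left)
    then show ?thesis using unit_scaleC_eq_0[OF that that] by (metis right_minus_eq)
  qed
  have g01: "g r * g r = g r" if "r < n m" for r
  proof -
    have "(g r * g r) *\<^sub>C e m r r = q * (q * e m r r)"
      using that unfolding g by (simp add: diag_comb_mult scaleC_mult_right scaleC_scaleC)
    also have "\<dots> = g r *\<^sub>C e m r r" using that qq unfolding mult.assoc[symmetric] qq
      unfolding g by (simp add: diag_comb_mult)
    finally have "(g r * g r - g r) *\<^sub>C e m r r = 0" by (simp add: scaleC_diff_left)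
    then show ?thesis using unit_scaleC_eq_0[OF that that] by (metis right_minus_eq)
  qed
  have ct0: "c t \<noteq> 0" using t gc by auto
  have c0: "c r = 0" if r: "r < n m" "r \<noteq> t" for r
  proof -
    have "e m t t * q * e m r r = 0" using lspan_entry_zero[OF qd t(1) r(1)] r by auto
    then have "cnj (c t) * c r = 0" using qc[OF t(1) r(1)] unit_scaleC_eq_0[OF t(1) r(1)] by metis
    then show ?thesis using ct0 by simp
  qed
  have gt1: "g t = 1" using g01[OF t(1)] t by simp
  have cm: "cmod (c t) = 1"
  proof -
    have "complex_of_real ((cmod (c t))\<^sup>2) = 1" using gc[OF t(1)] gt1
      by (metis complex_norm_square mult.commute)
    then have "(cmod (c t))\<^sup>2 = 1" using of_real_eq_1_iff by blast
    then show ?thesis by (simp add: power2_eq_1_iff) (smt (verit) norm_ge_zero)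
  qed
  have qt: "q = e m t t"
  proof -
    have "q = (\<Sum>r<n m. if r = t then e m t t else 0)"
      unfolding g by (intro sum.cong refl) (use gc c0 gt1 in auto)
    then show ?thesis using t by simp
  qed
  have pv: "p * v = c t *\<^sub>C e m s t"
  proof -
    have "p * v = p * v * u"
      using full_mult_u[OF full_mult[OF _ vf, of p]] s by (simp add: p_def lspan_unit)
    also have "\<dots> = (\<Sum>r<n m. p * v * e m r r)" by (simp add: e_sum[of m, symmetric] sum_distrib_left)
    also have "\<dots> = (\<Sum>r<n m. if r = t then c t *\<^sub>C e m s t else 0)"
      by (intro sum.cong refl) (use c c0 in auto)
    finally show ?thesis using t by simp
  qed
  have vq: "v * q = p * v"
  proof -
    have "v * q = (v * cstar v) * p * v" by (simp add: q_def mult.assoc)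
    then show ?thesis by (simp add: vv ip)
  qed
  have posj: "pos k m t = j"
  proof (rule pos_unique[OF km t(1) j])
    have "e k j j * q = (cstar v * v * cstar v) * p * v" by (simp add: q_def vv(2)[symmetric] mult.assoc)
    also have "cstar v * v * cstar v = cstar v" using i j by (simp add: v_def e_star e_mult)
    finally have "e k j j * q = q" by (simp add: q_def)
    then show "e k j j * e m t t \<noteq> 0" using qt e_nonzero t by simp
  qed
  \<comment> \<open>order is kept because the upper triangular matrices of level k stay upper triangular\<close>
  have "s \<le> t" if "i \<le> j"
  proof (rule ccontr)
    assume st: "\<not> s \<le> t"
    have "v \<in> upper m" unfolding v_def using i j that by (intro upper_le[OF km] lspan_unit) auto
    then have "e m s s * v * e m t t = 0" using lspan_entry_zero[OF _ s t(1)] st by auto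
    then have "c t *\<^sub>C e m s t = 0" using c[OF t(1)] by (simp add: p_def)
    then show False using unit_scaleC_eq_0[OF s t(1)] ct0 by simp
  qed
  show ?thesis
  proof (rule that[of t "c t"])
    show "e m s s * e k i j = c t *\<^sub>C e m s t" using pv by (simp add: p_def v_def)
    show "e k i j * e m t t = c t *\<^sub>C e m s t" using pv vq by (simp add: qt v_def)
    show "e k j i * e m s s * e k i j = e m t t" using qt vst by (simp add: q_def p_def v_def)
    show "e k i j * e m t t * e k j i = e m s s" using qback vst qt by (simp add: p_def v_def)
    show "i \<le> j \<Longrightarrow> s \<le> t" by fact
  qed (use t cm posj in auto)
qed

end

section \<open>The limit algebras\<close>

text \<open>
  In an increasing union, the approximating sequence can be chosen to run through the levels in
  step; sequences for several elements are then automatically at a common level.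
\<close>

lemma closure_Union_seq_iff:
  fixes F :: "nat \<Rightarrow> 'x::metric_space set"
  assumes mono: "\<And>k m. k \<le> m \<Longrightarrow> F k \<subseteq> F m" and ne: "\<And>m. F m \<noteq> {}"
  shows "x \<in> closure (\<Union>k. F k) \<longleftrightarrow> (\<exists>X. (\<forall>m. X m \<in> F m) \<and> X \<longlonglongrightarrow> x)"
proof
  assume x: "x \<in> closure (\<Union>k. F k)"
  have "\<exists>y\<in>F m. dist x y < infdist x (F m) + inverse (real (Suc m))" for m
  proof -
    have "(INF a\<in>F m. dist x a) < infdist x (F m) + inverse (real (Suc m))"
      using infdist_notempty[OF ne, of x m] by simp
    moreover have "dist x ` F m \<noteq> {}" using ne by simp
    ultimately have "\<exists>d\<in>dist x ` F m. d < infdist x (F m) + inverse (real (Suc m))"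
      by (intro cInf_lessD)
    then show ?thesis by auto
  qed
  then obtain X where X: "\<And>m. X m \<in> F m" "\<And>m. dist x (X m) < infdist x (F m) + inverse (real (Suc m))"
    by metis
  have "X \<longlonglongrightarrow> x"
  proof (rule metric_LIMSEQ_I)
    fix r :: real assume r: "r > 0"
    obtain y k where y: "y \<in> F k" "dist y x < r / 2"
      using x r closure_approachable[of x "\<Union>k. F k"] by (metis UN_E half_gt_zero)
    obtain N where N: "inverse (real (Suc N)) < r / 2" using reals_Archimedean[of "r/2"] r by auto
    show "\<exists>no. \<forall>m\<ge>no. dist (X m) x < r"
    proof (intro exI allI impI)
      fix m assume m: "max k N \<le> m"
      have "infdist x (F m) \<le> dist x y" using m mono[of k m] y by (intro infdist_le) auto
      moreover have "inverse (real (Suc m)) \<le> inverse (real (Suc N))" using m by (simp add: field_simps)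
      ultimately show "dist (X m) x < r" using X(2)[of m] y(2)[unfolded dist_commute[of y x]] N unfolding dist_commute[of "X m"] by linarith
    qed
  qed
  then show "\<exists>X. (\<forall>m. X m \<in> F m) \<and> X \<longlonglongrightarrow> x" using X by blast
next
  assume "\<exists>X. (\<forall>m. X m \<in> F m) \<and> X \<longlonglongrightarrow> x"
  then show "x \<in> closure (\<Union>k. F k)" unfolding closure_sequential by blast
qed

context matrix_tower
begin

text \<open>
  \<open>CC\<close> is the enveloping \<open>C\<^sup>*\<close>-algebra, \<open>AA\<close> the triangular algebra, and \<open>DD\<close> the limit of the diagonal
  matrix algebras; \<open>diagonal_AA\<close> below shows that \<open>DD\<close> is the intersection of \<open>AA\<close> with its adjoint.
\<close>

definition "CC = closure (\<Union>k. full k)"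
definition "AA = closure (\<Union>k. upper k)"
definition "DD = closure (\<Union>k. diag k)"

lemma CC_iff: "x \<in> CC \<longleftrightarrow> (\<exists>X. (\<forall>m. X m \<in> full m) \<and> X \<longlonglongrightarrow> x)"
  unfolding CC_def by (rule closure_Union_seq_iff) (use full_le lspan_zero in blast)+

lemma AA_iff: "x \<in> AA \<longleftrightarrow> (\<exists>X. (\<forall>m. X m \<in> upper m) \<and> X \<longlonglongrightarrow> x)"
  unfolding AA_def by (rule closure_Union_seq_iff) (use upper_le lspan_zero in blast)+

lemma DD_iff: "x \<in> DD \<longleftrightarrow> (\<exists>X. (\<forall>m. X m \<in> diag m) \<and> X \<longlonglongrightarrow> x)"
  unfolding DD_def by (rule closure_Union_seq_iff) (use diag_le lspan_zero in blast)+

lemma AA_seqE: assumes "x \<in> AA" obtains X where "\<And>m. X m \<in> upper m" "X \<longlonglongrightarrow> x"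
  using assms AA_iff by blast
lemma DD_seqE: assumes "x \<in> DD" obtains X where "\<And>m. X m \<in> diag m" "X \<longlonglongrightarrow> x"
  using assms DD_iff by blast

lemma closed_AA: "closed AA" and closed_DD: "closed DD" by (simp_all add: AA_def DD_def)

lemma diag_upper: "diag k \<subseteq> upper k" by (rule lspan_mono) auto

lemma full_CC: "full k \<subseteq> CC" and upper_AA: "upper k \<subseteq> AA" and diag_DD: "diag k \<subseteq> DD"
  unfolding CC_def AA_def DD_def using closure_subset by fast+

lemma AA_CC: "AA \<subseteq> CC" unfolding AA_def CC_def by (intro closure_mono) (use lspan_full in blast)
lemma DD_AA: "DD \<subseteq> AA" unfolding AA_def DD_def by (intro closure_mono) (use diag_upper in blast)

lemma seq_op2:
  assumes "\<exists>X. (\<forall>m. X m \<in> F m) \<and> X \<longlonglongrightarrow> x" "\<exists>X. (\<forall>m. X m \<in> F m) \<and> X \<longlonglongrightarrow> y"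
    and "\<And>m a b. a \<in> F m \<Longrightarrow> b \<in> F m \<Longrightarrow> f a b \<in> F m"
    and "\<And>X Y. X \<longlonglongrightarrow> x \<Longrightarrow> Y \<longlonglongrightarrow> y \<Longrightarrow> (\<lambda>m. f (X m) (Y m)) \<longlonglongrightarrow> f x y"
  shows "\<exists>X. (\<forall>m. X m \<in> F m) \<and> X \<longlonglongrightarrow> f x y"
proof -
  from assms(1,2) obtain X Y where "\<forall>m. X m \<in> F m" "X \<longlonglongrightarrow> x" "\<forall>m. Y m \<in> F m" "Y \<longlonglongrightarrow> y" by blast
  then show ?thesis using assms(3,4) by (intro exI[of _ "\<lambda>m. f (X m) (Y m)"]) auto
qed

lemma CC_add: "x \<in> CC \<Longrightarrow> y \<in> CC \<Longrightarrow> x + y \<in> CC"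
  unfolding CC_iff by (rule seq_op2) (auto intro: lspan_add tendsto_add)
lemma AA_add: "x \<in> AA \<Longrightarrow> y \<in> AA \<Longrightarrow> x + y \<in> AA"
  unfolding AA_iff by (rule seq_op2) (auto intro: lspan_add tendsto_add)
lemma DD_add: "x \<in> DD \<Longrightarrow> y \<in> DD \<Longrightarrow> x + y \<in> DD"
  unfolding DD_iff by (rule seq_op2) (auto intro: lspan_add tendsto_add)

lemma CC_scaleC: "x \<in> CC \<Longrightarrow> z *\<^sub>C x \<in> CC"
  unfolding CC_iff by (elim exE conjE) (rule exI, rule conjI, rule allI, rule lspan_scaleC, auto intro: tendsto_scaleC)
lemma AA_scaleC: "x \<in> AA \<Longrightarrow> z *\<^sub>C x \<in> AA"
  unfolding AA_iff by (elim exE conjE) (rule exI, rule conjI, rule allI, rule lspan_scaleC, auto intro: tendsto_scaleC)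
lemma DD_scaleC: "x \<in> DD \<Longrightarrow> z *\<^sub>C x \<in> DD"
  unfolding DD_iff by (elim exE conjE) (rule exI, rule conjI, rule allI, rule lspan_scaleC, auto intro: tendsto_scaleC)

lemma CC_diff: "x \<in> CC \<Longrightarrow> y \<in> CC \<Longrightarrow> x - y \<in> CC"
  using CC_add[of x "-y"] CC_scaleC[of y "-1"] by (simp add: scaleC_minus_one)
lemma AA_diff: "x \<in> AA \<Longrightarrow> y \<in> AA \<Longrightarrow> x - y \<in> AA"
  using AA_add[of x "-y"] AA_scaleC[of y "-1"] by (simp add: scaleC_minus_one)
lemma DD_diff: "x \<in> DD \<Longrightarrow> y \<in> DD \<Longrightarrow> x - y \<in> DD"
  using DD_add[of x "-y"] DD_scaleC[of y "-1"] by (simp add: scaleC_minus_one)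

lemma CC_mult: "x \<in> CC \<Longrightarrow> y \<in> CC \<Longrightarrow> x * y \<in> CC"
  unfolding CC_iff by (rule seq_op2) (auto intro: full_mult tendsto_mult)
lemma AA_mult: "x \<in> AA \<Longrightarrow> y \<in> AA \<Longrightarrow> x * y \<in> AA"
  unfolding AA_iff by (rule seq_op2) (auto intro: upper_mult tendsto_mult)
lemma DD_mult: "x \<in> DD \<Longrightarrow> y \<in> DD \<Longrightarrow> x * y \<in> DD"
  unfolding DD_iff by (rule seq_op2) (auto intro: diag_mult tendsto_mult)

lemma CC_cstar: "x \<in> CC \<Longrightarrow> cstar x \<in> CC"
  unfolding CC_iff by (elim exE conjE) (rule exI, rule conjI, rule allI, rule full_cstar, auto intro: tendsto_cstar)

lemma diag_cstar: "x \<in> diag k \<Longrightarrow> cstar x \<in> diag k"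
  by (rule lspan_cstar[where P = "(=)"]) auto

lemma DD_cstar: "x \<in> DD \<Longrightarrow> cstar x \<in> DD"
  unfolding DD_iff by (elim exE conjE) (rule exI, rule conjI, rule allI, rule diag_cstar, auto intro: tendsto_cstar)

lemma unit_CC: "i < n k \<Longrightarrow> j < n k \<Longrightarrow> e k i j \<in> CC"
  using full_CC lspan_unit[of i k j "\<lambda>_ _. True"] by auto
lemma unit_AA: "i \<le> j \<Longrightarrow> j < n k \<Longrightarrow> e k i j \<in> AA"
  using upper_AA lspan_unit[of i k j "(\<le>)"] by auto
lemma unit_DD: "i < n k \<Longrightarrow> e k i i \<in> DD"
  using diag_DD lspan_unit[of i k i "(=)"] by auto
lemma u_DD: "u \<in> DD" using u_full diag_DD by blast

lemma u_mult: "x \<in> CC \<Longrightarrow> u * x = x"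
proof -
  assume "x \<in> CC"
  then obtain X where X: "\<And>m. X m \<in> full m" "X \<longlonglongrightarrow> x" using CC_iff by blast
  have "(\<lambda>m. u * X m) \<longlonglongrightarrow> u * x" using X by (intro tendsto_mult tendsto_const)
  then show ?thesis unfolding u_mult_full[OF X(1)] by (rule LIMSEQ_unique[OF _ X(2)])
qed

lemma mult_u: "x \<in> CC \<Longrightarrow> x * u = x"
proof -
  assume "x \<in> CC"
  then obtain X where X: "\<And>m. X m \<in> full m" "X \<longlonglongrightarrow> x" using CC_iff by blast
  have "(\<lambda>m. X m * u) \<longlonglongrightarrow> x * u" using X by (intro tendsto_mult tendsto_const)
  then show ?thesis unfolding full_mult_u[OF X(1)] by (rule LIMSEQ_unique[OF _ X(2)])
qed

lemma DD_commute: assumes "x \<in> DD" "y \<in> DD" shows "x * y = y * x"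
proof -
  obtain X Y where X: "\<And>m. X m \<in> diag m" "X \<longlonglongrightarrow> x" and Y: "\<And>m. Y m \<in> diag m" "Y \<longlonglongrightarrow> y"
    using DD_seqE assms by metis
  have "(\<lambda>m. X m * Y m) \<longlonglongrightarrow> x * y" "(\<lambda>m. X m * Y m) \<longlonglongrightarrow> y * x"
    using tendsto_mult[OF X(2) Y(2)] tendsto_mult[OF Y(2) X(2)] diag_commute[OF X(1) Y(1)] by simp_all
  then show ?thesis by (rule LIMSEQ_unique)
qed

lemma child_exists:
  assumes "k \<le> m" "i < n k" obtains s where "s < n m" "pos k m s = i"
proof -
  have "\<exists>s<n m. pos k m s = i"
  proof (rule ccontr)
    assume no: "\<not> (\<exists>s<n m. pos k m s = i)"
    have "e k i i = e k i i * u" using mult_u[OF unit_CC] assms by simp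
    also have "\<dots> = (\<Sum>s<n m. e k i i * e m s s)" by (simp add: e_sum[of m, symmetric] sum_distrib_left)
    also have "\<dots> = 0" using no assms by (intro sum.neutral) (auto simp: unit_mult_child)
    finally show False using e_nonzero assms by simp
  qed
  then show ?thesis using that by blast
qed

section \<open>The conditional expectation onto the diagonal\<close>

definition compression :: "nat \<Rightarrow> 'a \<Rightarrow> 'a" where
  "compression m c = (\<Sum>s<n m. e m s s * c * e m s s)"

lemma compression_add: "compression m (x + y) = compression m x + compression m y"
  by (simp add: compression_def distrib_left distrib_right sum.distrib)
lemma compression_diff: "compression m (x - y) = compression m x - compression m y"
  by (simp add: compression_def left_diff_distrib right_diff_distrib sum_subtractf)
lemma compression_scaleC: "compression m (z *\<^sub>C x) = z *\<^sub>C compression m x"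
  by (simp add: compression_def scaleC_mult_left scaleC_mult_right scaleC_sum_right)
lemma compression_zero [simp]: "compression m 0 = 0" by (simp add: compression_def)

lemma norm_unit_compress: "s < n m \<Longrightarrow> t < n m \<Longrightarrow> norm (e m s s * c * e m t t) \<le> norm c"
  using norm_mult_ineq[of "e m s s * c" "e m t t"] norm_mult_ineq[of "e m s s" c] by (simp add: norm_unit)

lemma norm_compression_blocks:
  assumes "\<And>s. s < n m \<Longrightarrow> norm (e m s s * c * e m s s) \<le> R" "R \<ge> 0"
  shows "norm (compression m c) \<le> R"
  unfolding compression_def
proof (rule norm_sum_blocks_le[where p = "\<lambda>s. e m s s"])
  fix s assume s: "s \<in> {..<n m}"
  have "e m s s * (e m s s * c * e m s s) = (e m s s * e m s s) * c * e m s s" by (simp only: mult.assoc)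
  then show "e m s s * (e m s s * c * e m s s) = e m s s * c * e m s s" using s by (simp add: e_mult)
  have "(e m s s * c * e m s s) * e m s s = e m s s * c * (e m s s * e m s s)" by (simp only: mult.assoc)
  then show "(e m s s * c * e m s s) * e m s s = e m s s * c * e m s s" using s by (simp add: e_mult)
qed (use assms in \<open>auto simp: e_mult e_star\<close>)

lemma norm_compression: "norm (compression m c) \<le> norm c"
  by (rule norm_compression_blocks) (auto intro: norm_unit_compress)

lemma compression_diag_fix: "d \<in> diag m \<Longrightarrow> compression m d = d"
proof -
  assume d: "d \<in> diag m"
  have "compression m d = (\<Sum>s<n m. d * e m s s)"
    unfolding compression_def
  proof (intro sum.cong refl)
    fix s assume "s \<in> {..<n m}"
    then show "e m s s * d * e m s s = d * e m s s"
      using diag_commute[OF d, of "e m s s"] mult.assoc[of d "e m s s" "e m s s"] by (simp add: lspan_unit e_mult)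
  qed
  also have "\<dots> = d * u" by (simp add: e_sum[of m, symmetric] sum_distrib_left)
  finally show ?thesis using full_mult_u lspan_full[OF d] by simp
qed

lemma compression_in_diag: "x \<in> full m \<Longrightarrow> compression m x \<in> diag m"
  unfolding compression_def
proof (rule lspan_sum)
  fix s assume x: "x \<in> full m" and s: "s \<in> {..<n m}"
  then have s: "s < n m" by simp
  obtain c where "e m s s * x * e m s s = c *\<^sub>C e m s s" using full_entry[OF x s s] s by metis
  then show "e m s s * x * e m s s \<in> diag m" using s by (simp add: lspan_scaleC lspan_unit)
qed

text \<open>
  An index of a later level lies below only one index of level \<open>k\<close>, so a unit \<open>e k i j\<close> with \<open>i \<noteq> j\<close>
  has zero diagonal at all later levels.
\<close>

lemma compression_stable:
  assumes km: "k \<le> m" and x: "x \<in> full k" shows "compression m x = compression k x"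
  using x
proof (induction rule: lspan_induct)
  case (unit i j)
  show ?case
  proof (cases "i = j")
    case True
    then have d: "e k i j \<in> diag k" using unit by (auto intro: lspan_unit)
    then show ?thesis using diag_le[OF km] by (simp add: compression_diag_fix)
  next
    case False
    have "compression l (e k i j) = 0" if l: "k \<le> l" for l
      unfolding compression_def
    proof (intro sum.neutral ballI)
      fix s assume "s \<in> {..<n l}"
      then have s: "s < n l" by simp
      have "e l s s * e k i j * e l s s = (e l s s * e k i i) * e k i j * (e k j j * e l s s)"
        using unit by (simp add: mult.assoc) (simp add: mult.assoc[symmetric] e_mult)
      then show "e l s s * e k i j * e l s s = 0"
        using unit_mult_child[OF l s] unit False by auto
    qed
    then show ?thesis using km by simp
  qed
qed (auto simp: compression_add compression_scaleC)

lemma compression_corner: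
  assumes t: "t < n m"
  shows "e m t t * compression m c * e m t t = e m t t * c * e m t t"
proof -
  have "e m t t * compression m c * e m t t = (\<Sum>r<n m. (e m t t * e m r r) * c * (e m r r * e m t t))"
    by (simp add: compression_def sum_distrib_left sum_distrib_right mult.assoc)
  also have "\<dots> = (\<Sum>r<n m. if r = t then e m t t * c * e m t t else 0)"
    by (intro sum.cong refl) (use t in \<open>auto simp: e_mult\<close>)
  finally show ?thesis using t by simp
qed

text \<open>
  The conditional expectation of \<open>CC\<close> onto \<open>DD\<close>. The limit exists because the compressions are
  contractive and stabilize on matrices.
\<close>

definition expectation :: "'a \<Rightarrow> 'a" where "expectation c = lim (\<lambda>m. compression m c)"

lemma expectation_tendsto: assumes "c \<in> CC" shows "(\<lambda>m. compression m c) \<longlonglongrightarrow> expectation c"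
proof -
  obtain X where X: "\<And>m. X m \<in> full m" "X \<longlonglongrightarrow> c" using assms CC_iff by blast
  have "Cauchy (\<lambda>m. compression m c)"
  proof (rule metric_CauchyI)
    fix r :: real assume r: "r > 0"
    obtain k where k: "dist (X k) c < r / 2"
      using metric_LIMSEQ_D[OF X(2), of "r/2"] r by auto
    show "\<exists>M. \<forall>m\<ge>M. \<forall>l\<ge>M. dist (compression m c) (compression l c) < r"
    proof (intro exI allI impI)
      fix m l assume ml: "k \<le> m" "k \<le> l"
      have *: "norm (compression m c - compression k (X k)) < r / 2" if "k \<le> m" for m
        using norm_compression[of m "c - X k"] k compression_stable[OF that X(1)]
        by (simp add: compression_diff dist_norm norm_minus_commute)
      show "dist (compression m c) (compression l c) < r"
        using *[OF ml(1)] *[OF ml(2)] unfolding dist_norm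
        using norm_triangle_ineq4[of "compression m c - compression k (X k)" "compression l c - compression k (X k)"] by simp
    qed
  qed
  then show ?thesis unfolding expectation_def by (simp add: Cauchy_convergent_iff convergent_LIMSEQ_iff)
qed

lemma expectation_tendsto_approx:
  assumes "\<And>m. X m \<in> full m" "X \<longlonglongrightarrow> c"
  shows "(\<lambda>m. compression m (X m)) \<longlonglongrightarrow> expectation c"
proof -
  have c: "c \<in> CC" using assms CC_iff by blast
  have "(\<lambda>m. compression m (X m - c)) \<longlonglongrightarrow> 0"
  proof (rule tendsto_norm_zero_cancel, rule tendsto_sandwich[OF _ _ tendsto_const])
    show "(\<lambda>m. norm (X m - c)) \<longlonglongrightarrow> 0" using assms(2) by (simp add: LIM_zero tendsto_norm_zero)
  qed (auto simp: norm_compression)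
  from tendsto_add[OF expectation_tendsto[OF c] this] show ?thesis by (simp add: compression_diff)
qed

lemma expectation_DD: "c \<in> CC \<Longrightarrow> expectation c \<in> DD"
proof -
  assume "c \<in> CC"
  then obtain X where X: "\<And>m. X m \<in> full m" "X \<longlonglongrightarrow> c" using CC_iff by blast
  show ?thesis unfolding DD_iff
    by (intro exI[of _ "\<lambda>m. compression m (X m)"] conjI allI compression_in_diag expectation_tendsto_approx X)
qed

lemma expectation_unique: "c \<in> CC \<Longrightarrow> (\<lambda>m. compression m c) \<longlonglongrightarrow> y \<Longrightarrow> expectation c = y"
  using expectation_tendsto LIMSEQ_unique by blast

lemma expectation_add: "x \<in> CC \<Longrightarrow> y \<in> CC \<Longrightarrow> expectation (x + y) = expectation x + expectation y"
  by (rule expectation_unique) (auto simp: compression_add intro: CC_add tendsto_add expectation_tendsto)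
lemma expectation_diff: "x \<in> CC \<Longrightarrow> y \<in> CC \<Longrightarrow> expectation (x - y) = expectation x - expectation y"
  by (rule expectation_unique) (auto simp: compression_diff intro: CC_diff tendsto_diff expectation_tendsto)
lemma expectation_scaleC: "x \<in> CC \<Longrightarrow> expectation (z *\<^sub>C x) = z *\<^sub>C expectation x"
  by (rule expectation_unique) (auto simp: compression_scaleC intro: CC_scaleC tendsto_scaleC expectation_tendsto)
lemma expectation_zero [simp]: "expectation 0 = 0" by (simp add: expectation_def)

lemma norm_expectation: "c \<in> CC \<Longrightarrow> norm (expectation c) \<le> norm c"
  by (rule LIMSEQ_le_const2[OF tendsto_norm[OF expectation_tendsto]]) (auto simp: norm_compression)

lemma expectation_DD_fix: "d \<in> DD \<Longrightarrow> expectation d = d"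
proof -
  assume "d \<in> DD"
  then obtain X where X: "\<And>m. X m \<in> diag m" "X \<longlonglongrightarrow> d" using DD_iff by blast
  have "(\<lambda>m. compression m (X m)) \<longlonglongrightarrow> expectation d" by (rule expectation_tendsto_approx) (use X lspan_full in auto)
  then show ?thesis unfolding compression_diag_fix[OF X(1)] by (rule LIMSEQ_unique[OF _ X(2)])
qed

text \<open>
  Diagonal entries of upper triangular matrices multiply: a product \<open>x\<^sub>s\<^sub>r y\<^sub>r\<^sub>s\<close> needs both \<open>s \<le> r\<close> and
  \<open>r \<le> s\<close>. In the limit, the expectation is multiplicative on \<open>AA\<close>.
\<close>

lemma compression_upper_mult:
  assumes x: "x \<in> upper m" and y: "y \<in> upper m"
  shows "compression m (x * y) = compression m x * compression m y"
proof -
  have a: "e m s s * (x * y) * e m s s = (e m s s * x * e m s s) * (e m s s * y * e m s s)" if s: "s < n m" for s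
  proof -
    have xf: "x \<in> CC" "y \<in> CC" using x y upper_AA AA_CC by blast+
    have "e m s s * (x * y) * e m s s = e m s s * x * (u * y) * e m s s"
      by (simp add: u_mult[OF xf(2)] mult.assoc)
    also have "\<dots> = (\<Sum>r<n m. e m s s * x * (e m r r * y) * e m s s)"
      by (simp add: e_sum[of m, symmetric] sum_distrib_left sum_distrib_right)
    also have "\<dots> = (\<Sum>r<n m. if r = s then (e m s s * x * e m s s) * (e m s s * y * e m s s) else 0)"
    proof (intro sum.cong refl)
      fix r assume "r \<in> {..<n m}"
      then have r: "r < n m" by simp
      have "e m s s * x * (e m r r * y) * e m s s = (e m s s * x * (e m r r * e m r r)) * y * e m s s"
        using r by (simp add: e_mult mult.assoc)
      also have "\<dots> = (e m s s * x * e m r r) * (e m r r * y * e m s s)" by (simp only: mult.assoc)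
      finally show "e m s s * x * (e m r r * y) * e m s s =
          (if r = s then (e m s s * x * e m s s) * (e m s s * y * e m s s) else 0)"
        using lspan_entry_zero[OF x s r] lspan_entry_zero[OF y r s] by (cases "s \<le> r") auto
    qed
    finally show ?thesis using s by simp
  qed
  have b: "(e m s s * x * e m s s) * (e m t t * y * e m t t) = 0" if "s < n m" "t < n m" "s \<noteq> t" for s t
  proof -
    have "(e m s s * x * e m s s) * (e m t t * y * e m t t) = (e m s s * x) * (e m s s * e m t t) * (y * e m t t)"
      by (simp only: mult.assoc)
    then show ?thesis using that by (simp add: e_mult)
  qed
  have "compression m x * compression m y = (\<Sum>s<n m. \<Sum>t<n m. (e m s s * x * e m s s) * (e m t t * y * e m t t))"
    by (simp add: compression_def sum_product)
  also have "\<dots> = (\<Sum>s<n m. \<Sum>t<n m. if t = s then e m s s * (x * y) * e m s s else 0)"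
    by (intro sum.cong refl) (use a b in auto)
  also have "\<dots> = compression m (x * y)" by (simp add: compression_def)
  finally show ?thesis by simp
qed

lemma expectation_AA_mult:
  assumes "x \<in> AA" "y \<in> AA" shows "expectation (x * y) = expectation x * expectation y"
proof -
  obtain X Y where X: "\<And>m. X m \<in> upper m" "X \<longlonglongrightarrow> x" and Y: "\<And>m. Y m \<in> upper m" "Y \<longlonglongrightarrow> y"
    using AA_seqE assms by metis
  have XY: "(\<lambda>m. X m * Y m) \<longlonglongrightarrow> x * y" using X Y by (intro tendsto_mult)
  have "(\<lambda>m. compression m (X m * Y m)) \<longlonglongrightarrow> expectation (x * y)"
    by (rule expectation_tendsto_approx) (use X Y XY full_mult lspan_full in blast)+
  moreover have "(\<lambda>m. compression m (X m) * compression m (Y m)) \<longlonglongrightarrow> expectation x * expectation y"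
    by (intro tendsto_mult expectation_tendsto_approx) (use X Y lspan_full in blast)+
  ultimately show ?thesis using compression_upper_mult X Y LIMSEQ_unique by auto
qed

section \<open>Faithfulness of the expectation\<close>

lemma zero_CC [simp]: "0 \<in> CC"
  using lspan_zero[of "\<lambda>_ _. True" 0] full_CC[of 0] by blast

lemma zero_AA [simp]: "0 \<in> AA"
  using lspan_zero[of "(\<le>)" 0] upper_AA[of 0] by blast

text \<open>
  The expectation is not a trace, but conjugation by \<open>v = e k i j\<close> maps the diagonal blocks of \<open>b v\<close> to
  those of \<open>v b\<close>, so one expectation vanishes if the other does.
\<close>

lemma norm_compression_unit_commute:
  assumes km: "k \<le> m" and i: "i < n k" and j: "j < n k"
  shows "norm (compression m (e k i j * b)) \<le> norm (compression m (b * e k i j))"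
proof (rule norm_compression_blocks)
  fix s assume s: "s < n m"
  show "norm (e m s s * (e k i j * b) * e m s s) \<le> norm (compression m (b * e k i j))"
  proof (cases "pos k m s = i")
    case False
    have "e m s s * (e k i j * b) * e m s s = (e m s s * e k i i) * e k i j * b * e m s s"
      using i j by (simp add: mult.assoc) (simp add: mult.assoc[symmetric] e_mult)
    then show ?thesis using unit_mult_child(2)[OF km s i] False by simp
  next
    case True
    obtain t \<mu> where t: "t < n m" "e m s s * e k i j = \<mu> *\<^sub>C e m s t" "e k i j * e m t t = \<mu> *\<^sub>C e m s t"
      "e k i j * e m t t * e k j i = e m s s"
      using partner[OF km i j s True] by metis
    let ?c = "b * e k i j"
    have "e m s s * (e k i j * b) * e m s s = (e m s s * e k i j) * b * e m s s" by (simp only: mult.assoc)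
    also have "\<dots> = (e k i j * e m t t) * b * (e k i j * e m t t * e k j i)" using t by simp
    also have "\<dots> = e k i j * (e m t t * ?c * e m t t) * e k j i" by (simp only: mult.assoc)
    finally have *: "e m s s * (e k i j * b) * e m s s = e k i j * (e m t t * ?c * e m t t) * e k j i" .
    have "e m t t * ?c * e m t t = e m t t * compression m ?c * e m t t"
      using compression_corner[OF t(1)] by simp
    then have "norm (e m t t * ?c * e m t t) \<le> norm (compression m ?c)"
      using norm_unit_compress[OF t(1) t(1)] by simp
    moreover have "norm (e k i j * (e m t t * ?c * e m t t) * e k j i) \<le> norm (e m t t * ?c * e m t t)"
      using norm_mult_ineq[of "e k i j * (e m t t * ?c * e m t t)" "e k j i"]
        norm_mult_ineq[of "e k i j" "e m t t * ?c * e m t t"] i j by (simp add: norm_unit)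
    ultimately show ?thesis unfolding * by linarith
  qed
qed simp

lemma expectation_unit_left_zero:
  assumes b: "b \<in> CC" and i: "i < n k" "j < n k" and 0: "expectation (b * e k i j) = 0"
  shows "expectation (e k i j * b) = 0"
proof (rule expectation_unique)
  show "e k i j * b \<in> CC" using b i by (intro CC_mult unit_CC)
  have "(\<lambda>m. norm (compression m (b * e k i j))) \<longlonglongrightarrow> 0"
    using tendsto_norm[OF expectation_tendsto[of "b * e k i j"]] 0 b i by (simp add: CC_mult unit_CC)
  then have "(\<lambda>m. norm (compression m (e k i j * b))) \<longlonglongrightarrow> 0"
  proof (rule tendsto_sandwich[rotated 3])
    show "\<forall>\<^sub>F m in sequentially. norm (compression m (e k i j * b)) \<le> norm (compression m (b * e k i j))"
      using norm_compression_unit_commute[of k _ i j b] i by (auto simp: eventually_sequentially intro!: exI[of _ k])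
  qed auto
  then show "(\<lambda>m. compression m (e k i j * b)) \<longlonglongrightarrow> 0" by (rule tendsto_norm_zero_cancel)
qed

lemma expectation_zero_limit:
  assumes X: "\<And>m. X m \<in> CC" "X \<longlonglongrightarrow> c" "c \<in> CC" and 0: "\<And>m. expectation (X m) = 0"
  shows "expectation c = 0"
proof -
  have "norm (expectation c) \<le> norm (X m - c)" for m
  proof -
    have "norm (expectation c) = norm (expectation (X m - c))" using expectation_diff[OF X(1) X(3), of m] 0[of m] by simp
    also have "\<dots> \<le> norm (X m - c)" by (intro norm_expectation CC_diff X)
    finally show ?thesis .
  qed
  moreover have "(\<lambda>m. norm (X m - c)) \<longlonglongrightarrow> 0" using X(2) by (simp add: LIM_zero tendsto_norm_zero)
  ultimately have "norm (expectation c) \<le> 0" by (intro LIMSEQ_le_const) auto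
  then show ?thesis by simp
qed

text \<open>
  By construction a right ideal; \<open>expectation_unit_left_zero\<close> makes it a left ideal as well. It
  cannot be the whole of the simple algebra \<open>CC\<close>, because the expectation fixes diagonal units; hence it
  is zero.
\<close>

definition null_ideal :: "'a set" where "null_ideal = {a \<in> CC. \<forall>x\<in>CC. expectation (a * x) = 0}"

lemma null_ideal_right: "a \<in> null_ideal \<Longrightarrow> c \<in> CC \<Longrightarrow> a * c \<in> null_ideal"
  unfolding null_ideal_def using CC_mult by (auto simp: mult.assoc)

lemma null_ideal_left:
  assumes a: "a \<in> null_ideal" and c: "c \<in> CC" shows "c * a \<in> null_ideal"
proof -
  have aC: "a \<in> CC" using a by (simp add: null_ideal_def)
  have unit: "expectation (e k i j * (a * x)) = 0" if "x \<in> CC" "i < n k" "j < n k" for x k i j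
    using that a aC unit_CC[of i k j]
    by (intro expectation_unit_left_zero) (auto simp: CC_mult null_ideal_def mult.assoc)
  have full: "expectation (y * (a * x)) = 0" if y: "y \<in> full k" and x: "x \<in> CC" for x y k
  proof -
    have "y \<in> CC \<and> expectation (y * (a * x)) = 0"
      using y
    proof (induction rule: lspan_induct)
      case zero then show ?case by simp
    qed (use x aC unit in \<open>auto simp: distrib_right scaleC_mult_left expectation_add expectation_scaleC CC_mult CC_add CC_scaleC unit_CC\<close>)
    then show ?thesis by simp
  qed
  have "expectation (c * (a * x)) = 0" if x: "x \<in> CC" for x
  proof -
    obtain X where X: "\<And>m. X m \<in> full m" "X \<longlonglongrightarrow> c" using c CC_iff by blast
    have XC: "X m \<in> CC" for m using X(1)[of m] full_CC by auto
    show ?thesis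
    proof (rule expectation_zero_limit)
      show "(\<lambda>m. X m * (a * x)) \<longlonglongrightarrow> c * (a * x)" by (intro tendsto_mult X tendsto_const)
    qed (use full[OF X(1) x] XC c aC x in \<open>auto intro: CC_mult\<close>)
  qed
  then show ?thesis using aC c by (auto simp: null_ideal_def CC_mult mult.assoc)
qed

text \<open>
  The norm of a matrix is its operator norm on columns (the elements \<open>X\<close> with \<open>X e\<^sub>0\<^sub>0 = X\<close>): with
  \<open>h = b\<^sup>*b\<close>, the norm of \<open>h^(2^j)\<close> is at most \<open>n k\<close> times its norm on columns. In this way no
  eigenvectors are needed.
\<close>

lemma norm_le_on_columns:
  assumes b: "b \<in> full k" and R: "R \<ge> 0"
    and col: "\<And>X. X \<in> full k \<Longrightarrow> X * e k 0 0 = X \<Longrightarrow> norm (b * X) \<le> R * norm X"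
  shows "norm b \<le> R"
proof -
  \<comment> \<open>the same bound for the adjoint, as for operators on a Hilbert space\<close>
  have col': "norm (cstar b * Y) \<le> R * norm Y" if Y: "Y \<in> full k" "Y * e k 0 0 = Y" for Y
  proof (cases "cstar b * Y = 0")
    case False
    define W where "W = cstar b * Y"
    have W: "W \<in> full k" "W * e k 0 0 = W" using Y b by (auto simp: W_def full_mult full_cstar mult.assoc)
    have "cstar W * W = cstar Y * (b * W)" by (simp add: W_def cstar_mult cstar_cstar mult.assoc)
    then have "(norm W)\<^sup>2 = norm (cstar Y * (b * W))" using cstar_identity[of W] by simp
    also have "\<dots> \<le> norm Y * norm (b * W)" using norm_mult_ineq[of "cstar Y"] by simp
    also have "\<dots> \<le> norm Y * (R * norm W)" using col[OF W] by (intro mult_left_mono) auto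
    finally have "norm W * norm W \<le> (R * norm Y) * norm W" by (simp add: power2_eq_square mult_ac)
    then show ?thesis using False by (simp add: W_def)
  qed (simp add: R)
  define h where "h = cstar b * b"
  have h: "h \<in> full k" by (simp add: h_def full_mult full_cstar b)
  have sq: "sq_iter j h \<in> full k \<and> (\<forall>X. X \<in> full k \<longrightarrow> X * e k 0 0 = X \<longrightarrow>
      norm (sq_iter j h * X) \<le> (R\<^sup>2) ^ (2^j) * norm X)" for j
  proof (induction j)
    case 0
    have "norm (h * X) \<le> R\<^sup>2 * norm X" if X: "X \<in> full k" "X * e k 0 0 = X" for X
    proof -
      have bX: "b * X \<in> full k" "(b * X) * e k 0 0 = b * X" using X b by (auto simp: full_mult mult.assoc)
      have "norm (h * X) \<le> R * norm (b * X)" using col'[OF bX] by (simp add: h_def mult.assoc)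
      also have "\<dots> \<le> R * (R * norm X)" using col[OF X] R by (intro mult_left_mono)
      finally show ?thesis by (simp add: power2_eq_square mult_ac)
    qed
    then show ?case using h by simp
  next
    case (Suc j)
    let ?S = "sq_iter j h"
    have "norm (?S * ?S * X) \<le> (R\<^sup>2) ^ (2 ^ Suc j) * norm X" if X: "X \<in> full k" "X * e k 0 0 = X" for X
    proof -
      have SX: "?S * X \<in> full k" "(?S * X) * e k 0 0 = ?S * X" using X Suc by (auto simp: full_mult mult.assoc)
      have "norm (?S * ?S * X) \<le> (R\<^sup>2) ^ (2^j) * norm (?S * X)" using Suc SX by (simp add: mult.assoc)
      also have "\<dots> \<le> (R\<^sup>2) ^ (2^j) * ((R\<^sup>2) ^ (2^j) * norm X)" using Suc X by (intro mult_left_mono) auto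
      also have "\<dots> = (R\<^sup>2) ^ (2^j + 2^j) * norm X" by (simp only: power_add mult.assoc)
      finally show ?thesis by (simp only: power_Suc mult_2)
    qed
    then show ?case using Suc by (simp add: full_mult)
  qed
  have "norm h \<le> R\<^sup>2"
  proof (rule norm_le_of_sq_iter_growth[where K = "real (n k)"])
    show "cstar h = h" by (simp add: h_def cstar_mult cstar_cstar)
    fix j
    let ?S = "sq_iter j h"
    have "?S = ?S * u" using sq[of j] full_mult_u[of ?S k] by simp
    also have "\<dots> = (\<Sum>i<n k. ?S * e k i i)" by (simp add: e_sum[of k, symmetric] sum_distrib_left)
    also have "norm \<dots> \<le> (\<Sum>i<n k. (R\<^sup>2) ^ (2^j))"
    proof (rule sum_norm_le)
      fix i assume "i \<in> {..<n k}"
      then have i: "i < n k" by simp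
      have "e k i i = e k i 0 * e k 0 i" using i n_pos by (simp add: e_mult)
      then have "norm (?S * e k i i) \<le> norm (?S * e k i 0) * norm (e k 0 i)"
        using norm_mult_ineq[of "?S * e k i 0" "e k 0 i"] by (simp add: mult.assoc)
      also have "\<dots> \<le> (R\<^sup>2) ^ (2^j)"
        using sq[of j] i n_pos[of k] lspan_unit[of i k 0 "\<lambda>_ _. True"] by (auto simp: norm_unit e_mult)
      finally show "norm (?S * e k i i) \<le> (R\<^sup>2) ^ (2^j)" .
    qed
    finally show "norm ?S \<le> real (n k) * (R\<^sup>2) ^ (2^j)" by simp
  qed simp
  then have "(norm b)\<^sup>2 \<le> R\<^sup>2" by (simp add: h_def cstar_identity)
  then show ?thesis using R by (rule power2_le_imp_le)
qed

text \<open>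
  Approximate \<open>a\<close> by a matrix \<open>b\<close>, choose a column \<open>X\<close> on which \<open>b\<close> is large, and compare
  \<open>w = X\<^sup>* a\<^sup>* a X\<close> with \<open>y = X\<^sup>* b\<^sup>* b X\<close>. The element \<open>w\<close> is in the ideal, so its expectation is \<open>0\<close>, while \<open>y\<close> is
  a scalar multiple of \<open>e\<^sub>0\<^sub>0\<close>, hence fixed by the expectation. So \<open>norm y\<close> is at most the norm of
  \<open>y - w\<close>, which is small.
\<close>

lemma null_ideal_trivial: assumes a: "a \<in> null_ideal" shows "a = 0"
proof (rule ccontr)
  assume a0: "a \<noteq> 0"
  have aC: "a \<in> CC" using a by (simp add: null_ideal_def)
  \<comment> \<open>small enough for the final comparison of (19/40)^2 with (1/20) * (41/20)\<close>
  define \<epsilon> where "\<epsilon> = norm a / 20"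
  have \<epsilon>: "\<epsilon> > 0" using a0 by (simp add: \<epsilon>_def)
  obtain b k where b: "b \<in> full k" "dist b a < \<epsilon>"
    using aC \<epsilon> unfolding CC_def closure_approachable by blast
  have ab: "norm (a - b) < \<epsilon>" using b(2) by (simp add: dist_norm norm_minus_commute)
  have nb1: "norm b < norm a + \<epsilon>" and nb2: "norm a < norm b + \<epsilon>"
    using ab norm_triangle_ineq2[of a b] norm_triangle_ineq3[of a b] by linarith+
  have "norm b > 0" using nb2 a0 zero_less_norm_iff[of a] unfolding \<epsilon>_def by linarith
  then have "\<not> norm b \<le> norm b / 2" by simp
  then obtain X where X: "X \<in> full k" "X * e k 0 0 = X" "norm b / 2 * norm X < norm (b * X)"
    using norm_le_on_columns[OF b(1), of "norm b / 2"] by (meson not_le norm_ge_zero divide_nonneg_pos zero_less_numeral)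
  have XC: "X \<in> CC" "b \<in> CC" using X b full_CC by auto
  have k0: "0 < n k" by (rule n_pos)
  define Y where "Y = b * X"
  define w where "w = cstar X * (cstar a * (a * X))"
  have "w \<in> null_ideal" unfolding w_def using a XC aC by (intro null_ideal_left null_ideal_right CC_cstar)
  then have wC: "w \<in> CC" and "expectation (w * u) = 0" using u_DD DD_AA AA_CC by (auto simp: null_ideal_def)
  then have w0: "expectation w = 0" by (simp add: mult_u)
  define y where "y = cstar Y * Y"
  have Yf: "Y \<in> full k" "Y * e k 0 0 = Y" using X b by (auto simp: Y_def full_mult mult.assoc)
  have yy: "e k 0 0 * y * e k 0 0 = y"
  proof -
    have "cstar (Y * e k 0 0) = cstar Y" using Yf by simp
    then have "e k 0 0 * cstar Y = cstar Y" using k0 by (simp add: cstar_mult e_star)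
    then show ?thesis using Yf(2) by (simp add: y_def mult.assoc) (simp add: mult.assoc[symmetric])
  qed
  have yf: "y \<in> full k" by (simp add: y_def full_mult full_cstar Yf)
  then obtain \<mu> where "e k 0 0 * y * e k 0 0 = \<mu> *\<^sub>C e k 0 0" using full_entry[OF yf k0 k0] k0 by metis
  then have "y \<in> diag k" using yy k0 by (metis lspan_scaleC lspan_unit)
  then have yE: "expectation y = y" using diag_DD expectation_DD_fix by blast
  have yC: "y \<in> CC" using yf full_CC by auto
  have "norm y = norm (expectation (y - w))" using expectation_diff[OF yC wC] w0 yE by simp
  also have "\<dots> \<le> norm (y - w)" by (intro norm_expectation CC_diff yC wC)
  also have "y - w = cstar X * ((cstar b * b - cstar a * a) * X)"
    by (simp add: y_def w_def Y_def cstar_mult algebra_simps mult.assoc)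
  also have "norm \<dots> \<le> norm X * (norm (cstar b * b - cstar a * a) * norm X)"
    using norm_mult_ineq[of "cstar X" "(cstar b * b - cstar a * a) * X"]
      mult_left_mono[OF norm_mult_ineq[of "cstar b * b - cstar a * a" X], of "norm X"] by simp
  also have "norm (cstar b * b - cstar a * a) \<le> \<epsilon> * (norm a + norm b)"
  proof -
    have "cstar b * b - cstar a * a = cstar (b - a) * b + cstar a * (b - a)"
      by (simp add: cstar_diff algebra_simps)
    also have "norm \<dots> \<le> norm (cstar (b - a) * b) + norm (cstar a * (b - a))" by (rule norm_triangle_ineq)
    also have "\<dots> \<le> norm (b - a) * norm b + norm a * norm (b - a)"
      using norm_mult_ineq[of "cstar (b - a)" b] norm_mult_ineq[of "cstar a" "b - a"] by simp
    also have "\<dots> = norm (a - b) * (norm a + norm b)" by (simp add: norm_minus_commute algebra_simps)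
    also have "\<dots> \<le> \<epsilon> * (norm a + norm b)" using ab by (intro mult_right_mono) auto
    finally show ?thesis .
  qed
  finally have le: "norm y \<le> norm X * (\<epsilon> * (norm a + norm b) * norm X)" by (simp add: mult_left_mono mult_right_mono)
  have "norm y = (norm Y)\<^sup>2" by (simp add: y_def cstar_identity)
  moreover have "(norm b / 2 * norm X)\<^sup>2 < (norm Y)\<^sup>2" using X(3) unfolding Y_def by (intro power_strict_mono) auto
  moreover have "norm X * (\<epsilon> * (norm a + norm b) * norm X) = \<epsilon> * (norm a + norm b) * (norm X)\<^sup>2"
    by (simp only: power2_eq_square mult_ac)
  ultimately have "(norm b / 2)\<^sup>2 * (norm X)\<^sup>2 < \<epsilon> * (norm a + norm b) * (norm X)\<^sup>2"
    using le unfolding power_mult_distrib by linarith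
  then have lt: "(norm b / 2)\<^sup>2 < \<epsilon> * (norm a + norm b)"
    by (metis mult_less_cancel_right zero_le_power2 not_less)
  define A where "A = norm a"
  have A0: "A > 0" and eA: "\<epsilon> = A / 20" using a0 by (simp_all add: A_def \<epsilon>_def)
  have b1: "norm b < A * (21/20)" and b2: "norm b > A * (19/20)" using nb1 nb2 eA by (simp_all add: A_def)
  have "(A * (19/40))\<^sup>2 < (norm b / 2)\<^sup>2" using b2 A0 by (intro power_strict_mono) auto
  also note lt
  also have "\<epsilon> * (norm a + norm b) \<le> A / 20 * (A * (41/20))" unfolding eA using b1 A0 
    by (intro mult_left_mono) (auto simp: A_def)
  finally show False using A0 by (simp add: power2_eq_square field_simps)
qed

text \<open>
  By the Cauchy-Schwarz inequality for the blocks \<open>p x y p\<close>, an element \<open>x\<close> with \<open>E (x x\<^sup>*) = 0\<close> is in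
  the null ideal.
\<close>

lemma expectation_faithful:
  assumes x: "x \<in> CC" and 0: "expectation (x * cstar x) = 0" shows "x = 0"
proof -
  have "expectation (x * y) = 0" if y: "y \<in> CC" for y
  proof (rule expectation_unique)
    show "x * y \<in> CC" using x y by (rule CC_mult)
    let ?r = "\<lambda>m. sqrt (norm (compression m (x * cstar x)))"
    have le: "norm (compression m (x * y)) \<le> ?r m * norm y" for m
    proof (rule norm_compression_blocks)
      fix s assume s: "s < n m"
      have "(norm (e m s s * x))\<^sup>2 = norm (e m s s * (x * cstar x) * e m s s)"
        using norm_mult_cstar[of "e m s s * x"] s by (simp add: cstar_mult e_star mult.assoc)
      also have "e m s s * (x * cstar x) * e m s s = e m s s * compression m (x * cstar x) * e m s s"
        using compression_corner[OF s] by simp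
      also have "norm \<dots> \<le> norm (compression m (x * cstar x))" by (rule norm_unit_compress[OF s s])
      finally have "norm (e m s s * x) \<le> ?r m" by (rule real_le_rsqrt)
      have "norm (e m s s * (x * y) * e m s s) \<le> norm (e m s s * x * y)"
        using norm_mult_ineq[of "e m s s * x * y" "e m s s"] s by (simp add: norm_unit mult.assoc)
      also have "\<dots> \<le> norm (e m s s * x) * norm y" by (rule norm_mult_ineq)
      also have "\<dots> \<le> ?r m * norm y" by (intro mult_right_mono) (fact, simp)
      finally show "norm (e m s s * (x * y) * e m s s) \<le> ?r m * norm y" .
    qed simp
    have "(\<lambda>m. ?r m * norm y) \<longlonglongrightarrow> sqrt (norm (expectation (x * cstar x))) * norm y"
      by (intro tendsto_mult tendsto_const tendsto_real_sqrt tendsto_norm expectation_tendsto CC_mult CC_cstar x)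
    then have "(\<lambda>m. ?r m * norm y) \<longlonglongrightarrow> 0" using 0 by simp
    then have "(\<lambda>m. norm (compression m (x * y))) \<longlonglongrightarrow> 0"
      by (rule tendsto_sandwich[rotated 3]) (auto simp: le)
    then show "(\<lambda>m. compression m (x * y)) \<longlonglongrightarrow> 0" by (rule tendsto_norm_zero_cancel)
  qed
  then show ?thesis using null_ideal_trivial[of x] x by (simp add: null_ideal_def)
qed

section \<open>The diagonal and the closed ideals of a triangular algebra\<close>

text \<open>
  Triangular truncation is unbounded, so closeness to upper and to lower triangular matrices does
  not by itself give closeness to diagonal matrices. Instead, if \<open>d\<close> and \<open>d\<^sup>*\<close> are in \<open>AA\<close>, then
  \<open>y = d - E d\<close> satisfies \<open>E (y y\<^sup>*) = E y * E (y\<^sup>*) = 0\<close>, and \<open>y = 0\<close> by faithfulness.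
\<close>

theorem diagonal_AA: "diagonal_of AA = DD"
proof
  show "DD \<subseteq> diagonal_of AA"
    unfolding diagonal_of_def using DD_AA DD_cstar by (auto intro!: image_eqI[of _ cstar "cstar _"] simp: cstar_cstar)
  show "diagonal_of AA \<subseteq> DD"
  proof
    fix d assume "d \<in> diagonal_of AA"
    then obtain d' where d: "d \<in> AA" "d' \<in> AA" "d = cstar d'" by (auto simp: diagonal_of_def)
    then have d': "cstar d \<in> AA" by (simp add: cstar_cstar)
    have dC: "d \<in> CC" using d AA_CC by auto
    define y where "y = d - expectation d"
    have Ed: "expectation d \<in> DD" using expectation_DD dC .
    then have Ed': "expectation d \<in> CC" "expectation d \<in> AA" "cstar (expectation d) \<in> AA" using DD_AA AA_CC DD_cstar by blast+
    have yA: "y \<in> AA" "cstar y \<in> AA" using d d' Ed' by (auto simp: y_def cstar_diff intro: AA_diff)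
    have "expectation y = 0" using expectation_diff[OF dC Ed'(1)] expectation_DD_fix[OF Ed] by (simp add: y_def)
    then have "expectation (y * cstar y) = 0" using expectation_AA_mult[OF yA] by simp
    then have "y = 0" using expectation_faithful yA AA_CC by blast
    then show "d \<in> DD" using Ed by (simp add: y_def)
  qed
qed

text \<open>
  If \<open>t < s\<close>, then \<open>e m t s\<close> is upper triangular at every later level, so \<open>e m s t\<close> has an entry of
  modulus \<open>1\<close> below the diagonal there and keeps distance \<open>1\<close> from the upper triangular matrices.
\<close>

lemma unit_in_AA_iff:
  assumes s: "s < n m" and t: "t < n m" shows "e m s t \<in> AA \<longleftrightarrow> s \<le> t"
proof
  assume w: "e m s t \<in> AA"
  show "s \<le> t"
  proof (rule ccontr)
    assume st: "\<not> s \<le> t"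
    obtain X where X: "\<And>l. X l \<in> upper l" "X \<longlonglongrightarrow> e m s t" using w AA_iff by blast
    obtain N where N: "\<And>l. l \<ge> N \<Longrightarrow> norm (X l - e m s t) < 1" using LIMSEQ_D[OF X(2), of 1] by auto
    define l where "l = max m N"
    have ml: "m \<le> l" and Nl: "norm (X l - e m s t) < 1" using N by (auto simp: l_def)
    obtain b where b: "b < n l" "pos m l b = t" using child_exists[OF ml t] .
    obtain a \<mu> where a: "a < n l" "cmod \<mu> = 1" "pos m l a = s" "e l b b * e m t s = \<mu> *\<^sub>C e l b a" "b \<le> a"
      using partner[OF ml t s b] st by (metis nat_le_linear)
    have "cstar (e m t s) * cstar (e l b b) = cstar (\<mu> *\<^sub>C e l b a)" by (simp only: cstar_mult[symmetric] a(4))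
    then have w1: "e m s t * e l b b = cnj \<mu> *\<^sub>C e l a b"
      using a b s t by (simp add: cstar_mult cstar_scaleC e_star)
    have "a \<noteq> b" using a b st by auto
    then have "e l a a * X l * e l b b = 0" using lspan_entry_zero[OF X(1) a(1) b(1)] a(5) by auto
    moreover have "e l a a * e m s t * e l b b = cnj \<mu> *\<^sub>C e l a b"
      using w1 a b by (simp add: mult.assoc scaleC_mult_right e_mult)
    ultimately have "e l a a * (X l - e m s t) * e l b b = - (cnj \<mu> *\<^sub>C e l a b)"
      by (simp add: algebra_simps)
    then have "norm (e l a a * (X l - e m s t) * e l b b) = 1"
      using a b by (simp add: norm_scaleC norm_unit)
    then show False using norm_unit_compress[OF a(1) b(1), of "X l - e m s t"] Nl by linarith
  qed
qed (use t unit_AA in blast)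

text \<open>
  For \<open>a \<noteq> 0\<close> in the ideal there is a unit \<open>v = e k i j\<close> with \<open>d = E (a v\<^sup>*) \<noteq> 0\<close>, because \<open>a\<close> is not in the
  null ideal. Each \<open>p a v\<^sup>* p v = p a (v\<^sup>* p v)\<close> with a diagonal unit \<open>p\<close> belongs to \<open>J\<close>, as
  \<open>v\<^sup>* p v\<close> is diagonal; summing over \<open>p\<close> and passing to the limit, \<open>d v\<close> belongs to \<open>J\<close>. Some diagonal
  unit \<open>p\<close> makes \<open>p d\<close> a small perturbation of a non-zero multiple of \<open>p\<close>. Inverting it in the
  diagonal gives \<open>p v\<close>, a multiple of a matrix unit, which reaches the corner from both sides.
\<close>

theorem closed_ideal_contains_corner:
  assumes JA: "J \<subseteq> AA" and cl: "closed J"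
    and add: "\<And>x y. x \<in> J \<Longrightarrow> y \<in> J \<Longrightarrow> x + y \<in> J"
    and left: "\<And>x y. x \<in> AA \<Longrightarrow> y \<in> J \<Longrightarrow> x * y \<in> J"
    and right: "\<And>x y. x \<in> J \<Longrightarrow> y \<in> AA \<Longrightarrow> x * y \<in> J"
    and a: "a \<in> J" "a \<noteq> 0"
  obtains k where "e k 0 (n k - 1) \<in> J"
proof -
  have aC: "a \<in> CC" using a JA AA_CC by blast
  have uA: "u \<in> AA" using u_DD DD_AA by blast
  have J0: "0 \<in> J" using left[of 0 a] a by simp
  have Jscale: "z *\<^sub>C x \<in> J" if "x \<in> J" for z x
    using left[OF AA_scaleC[OF uA, of z] that] u_mult[of x] that JA AA_CC by (auto simp: scaleC_mult_left)
  have Jsum: "(\<Sum>i\<in>I. f i) \<in> J" if "\<And>i. i \<in> I \<Longrightarrow> f i \<in> J" for f :: "nat \<Rightarrow> 'a" and I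
    using that by (induction I rule: infinite_finite_induct) (auto intro: add J0)
  have Jlim: "x \<in> J" if "\<And>m::nat. m \<ge> k \<Longrightarrow> X m \<in> J" "X \<longlonglongrightarrow> x" for X x k
    using closed_sequentially[OF cl, of "\<lambda>m. X (m + k)" x] that LIMSEQ_ignore_initial_segment by auto
  have "a \<notin> null_ideal" using null_ideal_trivial a by blast
  then obtain x where x: "x \<in> CC" "expectation (a * x) \<noteq> 0" using aC by (auto simp: null_ideal_def)
  have "\<exists>k i j. i < n k \<and> j < n k \<and> expectation (a * e k j i) \<noteq> 0"
  proof (rule ccontr)
    assume no: "\<not> (\<exists>k i j. i < n k \<and> j < n k \<and> expectation (a * e k j i) \<noteq> 0)"
    have full: "y \<in> CC \<and> expectation (a * y) = 0" if y: "y \<in> full k" for y k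
      using y
    proof (induction rule: lspan_induct)
      case zero then show ?case by simp
    qed (use aC no in \<open>auto simp: distrib_left scaleC_mult_right expectation_add expectation_scaleC CC_mult CC_add CC_scaleC unit_CC\<close>)
    obtain X where X: "\<And>m. X m \<in> full m" "X \<longlonglongrightarrow> x" using x CC_iff by blast
    have "expectation (a * x) = 0"
    proof (rule expectation_zero_limit)
      show "(\<lambda>m. a * X m) \<longlonglongrightarrow> a * x" by (intro tendsto_mult X tendsto_const)
    qed (use full[OF X(1)] aC x in \<open>auto intro: CC_mult\<close>)
    then show False using x by simp
  qed
  then obtain k i j where ij: "i < n k" "j < n k" and d0: "expectation (a * e k j i) \<noteq> 0" by blast
  define v where "v = e k i j"
  define d where "d = expectation (a * e k j i)"
  have avC: "a * e k j i \<in> CC" using aC ij by (intro CC_mult unit_CC)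
  have dD: "d \<in> DD" unfolding d_def using expectation_DD avC .
  have in_level: "compression m (a * e k j i) * v \<in> J \<and> compression m (a * e k j i) * e k i i = compression m (a * e k j i)"
    if km: "k \<le> m" for m
  proof -
    have zero: "e k j i * e m s s = 0" if "s < n m" "pos k m s \<noteq> i" for s
    proof -
      have "e k j i * e m s s = e k j i * (e k i i * e m s s)"
        using ij by (simp add: mult.assoc[symmetric] e_mult)
      then show ?thesis using unit_mult_child(1)[OF km that(1) ij(1)] that by simp
    qed
    have "e m s s * (a * e k j i) * e m s s * v \<in> J" if s: "s < n m" for s
    proof (cases "pos k m s = i")
      case True
      obtain t where t: "t < n m" "e k j i * e m s s * e k i j = e m t t"
        using partner[OF km ij s True] by metis
      have "e m s s * (a * e k j i) * e m s s * v = e m s s * (a * (e k j i * e m s s * e k i j))"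
        by (simp add: v_def mult.assoc)
      also have "\<dots> = e m s s * (a * e m t t)" using t by simp
      also have "\<dots> \<in> J" using t s a by (intro left[OF unit_AA] right[OF _ unit_AA]) auto
      finally show ?thesis .
    next
      case False
      then show ?thesis using zero[OF s] J0 by (simp add: mult.assoc)
    qed
    then have "compression m (a * e k j i) * v \<in> J"
      unfolding compression_def sum_distrib_right by (intro Jsum) auto
    moreover have "e m s s * (a * e k j i) * e m s s * e k i i = e m s s * (a * e k j i) * e m s s" if s: "s < n m" for s
      using zero[OF s] unit_mult_child(2)[OF km s ij(1)] by (cases "pos k m s = i") (simp_all add: mult.assoc)
    then have "compression m (a * e k j i) * e k i i = compression m (a * e k j i)"
      unfolding compression_def sum_distrib_right by (intro sum.cong) auto
    ultimately show ?thesis by simp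
  qed
  have lim: "(\<lambda>m. compression m (a * e k j i)) \<longlonglongrightarrow> d" unfolding d_def using expectation_tendsto avC .
  have dv: "d * v \<in> J"
    by (rule Jlim[of k "\<lambda>m. compression m (a * e k j i) * v"]) (use in_level lim in \<open>auto intro: tendsto_mult\<close>)
  have di: "d * e k i i = d"
  proof (rule LIMSEQ_unique)
    show "(\<lambda>m. compression m (a * e k j i) * e k i i) \<longlonglongrightarrow> d * e k i i" by (intro tendsto_mult lim tendsto_const)
    show "(\<lambda>m. compression m (a * e k j i) * e k i i) \<longlonglongrightarrow> d"
      by (rule Lim_transform_eventually[OF lim]) (use in_level in \<open>auto simp: eventually_sequentially intro!: exI[of _ k]\<close>)
  qed
  define \<delta> where "\<delta> = norm d / 4"
  have \<delta>: "\<delta> > 0" using d0 by (simp add: \<delta>_def d_def)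
  obtain X where X: "\<And>m. X m \<in> diag m" "X \<longlonglongrightarrow> d" using dD DD_iff by blast
  obtain N where N: "\<And>m. m \<ge> N \<Longrightarrow> norm (X m - d) < \<delta>" using LIMSEQ_D[OF X(2) \<delta>] by auto
  define K where "K = max k N"
  have kK: "k \<le> K" and XK: "norm (X K - d) < \<delta>" using N by (auto simp: K_def)
  obtain g where g: "X K = (\<Sum>s<n K. g s *\<^sub>C e K s s)" using diag_comb[OF X(1)] .
  have "\<exists>s<n K. cmod (g s) > 2 * \<delta>"
  proof (rule ccontr)
    assume "\<not> (\<exists>s<n K. cmod (g s) > 2 * \<delta>)"
    then have small: "\<And>s. s < n K \<Longrightarrow> cmod (g s) \<le> 2 * \<delta>" by force
    have "norm (compression K (X K)) \<le> 2 * \<delta>"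
    proof (rule norm_compression_blocks)
      fix s assume s: "s < n K"
      have "e K s s * X K * e K s s = g s *\<^sub>C e K s s"
        using s unfolding g by (simp add: diag_comb_mult scaleC_mult_left e_mult)
      then show "norm (e K s s * X K * e K s s) \<le> 2 * \<delta>" using small[OF s] s by (simp add: norm_scaleC norm_unit)
    qed (use \<delta> in simp)
    then have "norm (X K) \<le> 2 * \<delta>" using compression_diag_fix[OF X(1)] by simp
    then show False
      using XK norm_triangle_ineq2[of d "X K"] \<delta> norm_minus_commute[of d "X K"] unfolding \<delta>_def by linarith
  qed
  then obtain s where s: "s < n K" "cmod (g s) > 2 * \<delta>" by blast
  define p where "p = e K s s"
  define \<eta> where "\<eta> = g s"
  have lam: "cmod \<eta> > 2 * \<delta>" and l0: "\<eta> \<noteq> 0" using s \<delta> by (auto simp: \<eta>_def)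
  have pD: "p \<in> DD" "p \<in> AA" and pp: "p * p = p" using s unit_DD DD_AA by (auto simp: p_def e_mult)
  have pX: "p * X K = \<eta> *\<^sub>C p" using s unfolding g p_def \<eta>_def by (simp add: diag_comb_mult)
  have near: "norm (\<eta> *\<^sub>C p - p * d) \<le> \<delta>"
  proof -
    have "norm (p * (X K - d)) \<le> norm p * norm (X K - d)" by (rule norm_mult_ineq)
    then show ?thesis using XK s by (simp add: p_def[symmetric] right_diff_distrib pX) (simp add: p_def norm_unit)
  qed
  have posi: "pos k K s = i"
  proof (rule ccontr)
    assume "pos k K s \<noteq> i"
    then have pi: "p * e k i i = 0" using unit_mult_child(2)[OF kK s(1) ij(1)] by (simp add: p_def)
    have "p * d = d * p" using DD_commute pD dD by blast
    also have "\<dots> = d * (e k i i * p)" using di by (metis mult.assoc)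
    also have "e k i i * p = p * e k i i" using DD_commute pD unit_DD ij by blast
    finally have "p * d = 0" using pi by simp
    then have "norm (\<eta> *\<^sub>C p) \<le> \<delta>" using near by simp
    then show False using lam s \<delta> by (simp add: norm_scaleC p_def norm_unit)
  qed
  obtain t \<mu> where t: "t < n K" "cmod \<mu> = 1" "e K s s * e k i j = \<mu> *\<^sub>C e K s t"
    using partner[OF kK ij s(1) posi] by metis
  define r where "r = p - inverse \<eta> *\<^sub>C (p * d)"
  have rD: "r \<in> DD" unfolding r_def by (intro DD_diff DD_scaleC DD_mult pD dD)
  have pr: "p * r = r" by (simp add: r_def right_diff_distrib scaleC_mult_right pp mult.assoc[symmetric])
  have rp: "r * p = r" using pr DD_commute[OF pD(1) rD] by simp
  have nr: "norm r \<le> 1/2"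
  proof -
    have "r = inverse \<eta> *\<^sub>C (\<eta> *\<^sub>C p - p * d)" using l0 by (simp add: r_def scaleC_diff_right scaleC_scaleC)
    then have "norm r = norm (\<eta> *\<^sub>C p - p * d) / cmod \<eta>" by (simp add: norm_scaleC norm_inverse divide_inverse)
    also have "\<dots> \<le> \<delta> / cmod \<eta>" using near by (intro divide_right_mono) auto
    also have "\<dots> \<le> 1/2" using lam \<delta> l0 by (simp add: field_simps)
    finally show ?thesis .
  qed
  \<comment> \<open>inversion by (p + r^(2^l)) (p - r^(2^l)) = p - r^(2^(l+1)), without a Neumann series\<close>
  have sqJ: "(p - sq_iter l r) * v \<in> J \<and> sq_iter l r \<in> DD \<and> p * sq_iter l r = sq_iter l r \<and> sq_iter l r * p = sq_iter l r" for l
  proof (induction l)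
    case 0
    have "(p - r) * v = inverse \<eta> *\<^sub>C (p * (d * v))" by (simp add: r_def scaleC_mult_left mult.assoc)
    then show ?case using Jscale[OF left[OF pD(2) dv]] rD pr rp by simp
  next
    case (Suc l)
    let ?q = "sq_iter l r"
    have "p + ?q \<in> AA" using Suc pD DD_AA by (intro AA_add) auto
    then have "(p + ?q) * ((p - ?q) * v) \<in> J" using Suc by (intro left[of "p + ?q"]) auto
    moreover have "(p + ?q) * ((p - ?q) * v) = (p - ?q * ?q) * v"
    proof -
      have "(p + ?q) * (p - ?q) = p - ?q * ?q" using Suc by (simp add: algebra_simps pp)
      then show ?thesis by (simp add: mult.assoc[symmetric])
    qed
    moreover have "p * (?q * ?q) = ?q * ?q" using Suc by (simp add: mult.assoc[symmetric])
    moreover have "?q * ?q * p = ?q * ?q" using Suc by (simp add: mult.assoc)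
    ultimately show ?case using Suc by (simp add: DD_mult)
  qed
  have "(\<lambda>l. sq_iter l r) \<longlonglongrightarrow> 0"
  proof (rule tendsto_norm_zero_cancel, rule tendsto_sandwich[OF _ _ tendsto_const])
    show "(\<lambda>l. (1/2::real) ^ l) \<longlonglongrightarrow> 0" by (rule LIMSEQ_realpow_zero) auto
    have "norm (sq_iter l r) \<le> (1/2) ^ l" for l
    proof -
      have "norm (sq_iter l r) \<le> norm r ^ (2^l)" by (rule norm_sq_iter_le)
      also have "\<dots> \<le> (1/2) ^ (2^l)" using nr by (intro power_mono) auto
      also have "\<dots> \<le> (1/2) ^ l" by (intro power_decreasing) (auto intro: less_imp_le less_exp)
      finally show ?thesis .
    qed
    then show "\<forall>\<^sub>F l in sequentially. norm (sq_iter l r) \<le> (1/2) ^ l" by simp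
  qed auto
  then have "(\<lambda>l. (p - sq_iter l r) * v) \<longlonglongrightarrow> (p - 0) * v" by (intro tendsto_mult tendsto_diff tendsto_const)
  then have "p * v \<in> J" using Jlim[of 0 "\<lambda>l. (p - sq_iter l r) * v"] sqJ by simp
  then have "inverse \<mu> *\<^sub>C (p * v) \<in> J" by (rule Jscale)
  moreover have "\<mu> \<noteq> 0" using t by auto
  ultimately have st: "e K s t \<in> J" using t(3) by (simp add: p_def v_def scaleC_scaleC)
  then have "s \<le> t" using unit_in_AA_iff s t JA by blast
  have nK: "n K - 1 < n K" "0 < n K" using n_pos[of K] by auto
  have "e K 0 s * e K s t * e K t (n K - 1) \<in> J"
    using st s t nK by (intro right left unit_AA) auto
  moreover have "e K 0 s * e K s t * e K t (n K - 1) = e K 0 (n K - 1)" using s t nK by (simp add: e_mult)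
  ultimately show ?thesis using that by simp
qed

end

section \<open>The spectrum and the characters of the diagonal\<close>

lemma spectrum_rel_groupoid: "spectrum_rel A \<subseteq> groupoid A"
  by (auto simp: groupoid_def generated_equiv_def)

lemma groupoid_sym: "(x, y) \<in> groupoid A \<Longrightarrow> (y, x) \<in> groupoid A"
  unfolding groupoid_def generated_equiv_def by (auto simp: equiv_def dest: symD)

lemma groupoid_refl: "x \<in> characters (diagonal_of A) \<Longrightarrow> (x, x) \<in> groupoid A"
  unfolding groupoid_def generated_equiv_def by (auto simp: equiv_def dest: refl_onD)

context matrix_tower
begin

abbreviation "chars \<equiv> characters DD"

lemma char_add: "x \<in> chars \<Longrightarrow> a \<in> DD \<Longrightarrow> b \<in> DD \<Longrightarrow> x (a + b) = x a + x b"
  and char_mult: "x \<in> chars \<Longrightarrow> a \<in> DD \<Longrightarrow> b \<in> DD \<Longrightarrow> x (a * b) = x a * x b"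
  and char_scaleC: "x \<in> chars \<Longrightarrow> a \<in> DD \<Longrightarrow> x (z *\<^sub>C a) = z * x a"
  by (auto simp: characters_def alg_hom_on_def)

lemma char_diff: "x \<in> chars \<Longrightarrow> a \<in> DD \<Longrightarrow> b \<in> DD \<Longrightarrow> x (a - b) = x a - x b"
  using char_add[of x "a - b" b] by (simp add: DD_diff)

lemma DD_CC: "DD \<subseteq> CC" using DD_AA AA_CC by blast

lemma zero_DD [simp]: "0 \<in> DD" using DD_diff[OF u_DD u_DD] by simp

lemma char_u: assumes x: "x \<in> chars" shows "x u = 1"
proof -
  obtain d where d: "d \<in> DD" "x d \<noteq> 0" using x by (auto simp: characters_def)
  then have "x d = x u * x d" using char_mult[OF x u_DD d(1)] u_mult[of d] DD_CC by auto
  then show ?thesis using d by simp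
qed

text \<open>
  If \<open>x r = 1\<close> and \<open>norm r < 1\<close>, then \<open>y = u + r + r\<^sup>2 + \<dots>\<close> satisfies \<open>y = u + r y\<close>, and so
  \<open>x y = 1 + x y\<close>.
\<close>

lemma char_bound:
  assumes x: "x \<in> chars" and d: "d \<in> DD" shows "cmod (x d) \<le> norm d"
proof (rule ccontr)
  assume gt: "\<not> cmod (x d) \<le> norm d"
  then have xd: "x d \<noteq> 0" by auto
  define r where "r = inverse (x d) *\<^sub>C d"
  have rD: "r \<in> DD" using d by (simp add: r_def DD_scaleC)
  have xr: "x r = 1" using xd by (simp add: r_def char_scaleC[OF x d])
  have "norm r = norm d / cmod (x d)" by (simp add: r_def norm_scaleC norm_inverse divide_inverse mult.commute)
  then have nr: "norm r < 1" using gt xd by simp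
  define f where "f l = (((*) r) ^^ l) u" for l
  have fD: "f l \<in> DD" for l by (induction l) (auto simp: f_def u_DD DD_mult rD)
  have fn: "norm (f l) \<le> norm r ^ l * norm u" for l
  proof (induction l)
    case (Suc l)
    have "norm (f (Suc l)) \<le> norm r * norm (f l)" by (simp add: f_def norm_mult_ineq)
    also have "\<dots> \<le> norm r * (norm r ^ l * norm u)" using Suc by (intro mult_left_mono) auto
    finally show ?case by (simp add: mult_ac)
  qed (simp add: f_def)
  have sm: "summable f"
    by (rule summable_comparison_test'[where g = "\<lambda>l. norm r ^ l * norm u" and N = 0])
       (use nr fn in \<open>auto intro: summable_mult2 summable_geometric\<close>)
  define y where "y = suminf f"
  have "(\<lambda>N. \<Sum>l<N. f l) \<longlonglongrightarrow> y" using sm by (simp add: y_def summable_LIMSEQ)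
  moreover have "(\<Sum>l<N. f l) \<in> DD" for N by (induction N) (auto simp: fD DD_add)
  ultimately have yD: "y \<in> DD"
    using closed_sequentially[OF closed_DD, of "\<lambda>N. \<Sum>l<N. f l"] by simp
  have f0: "f 0 = u" and fS: "f (Suc l) = r * f l" for l by (simp_all add: f_def)
  have "y = u + r * y"
    using suminf_split_head[OF sm] suminf_mult[OF sm, of r] unfolding f0 fS y_def by (simp add: algebra_simps)
  then have "x y = 1 + x r * x y" using char_add[OF x u_DD DD_mult[OF rD yD]] char_mult[OF x rD yD] char_u[OF x] by metis
  then show False by (simp add: xr)
qed

lemma char_idem: "x \<in> chars \<Longrightarrow> p \<in> DD \<Longrightarrow> p * p = p \<Longrightarrow> x p = 0 \<or> x p = 1"
  using char_mult[of x p p] by auto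

lemma char_sum:
  assumes x: "x \<in> chars" and I: "finite I" "\<And>i. i \<in> I \<Longrightarrow> f i \<in> DD"
  shows "x (\<Sum>i\<in>I. f i) = (\<Sum>i\<in>I. x (f i)) \<and> (\<Sum>i\<in>I. f i) \<in> DD"
  using I
proof (induction I rule: finite_induct)
  case empty
  then show ?case using char_diff[of x u u] u_DD x by simp
qed (use x in \<open>auto simp: char_add DD_add\<close>)

lemma char_zero: "x \<in> chars \<Longrightarrow> x 0 = 0"
  using char_sum[of x "{}" "\<lambda>_. 0"] by simp

lemma char_locate: assumes x: "x \<in> chars" obtains s where "s < n m" "x (e m s s) = 1"
proof -
  have "(\<Sum>s<n m. x (e m s s)) = 1"
    using char_sum[OF x, of "{..<n m}" "\<lambda>s. e m s s"] char_u[OF x] by (simp add: unit_DD e_sum)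
  then have "(\<Sum>s<n m. x (e m s s)) \<noteq> 0" by simp
  then obtain s where "s \<in> {..<n m}" "x (e m s s) \<noteq> 0" by (rule sum.not_neutral_contains_not_neutral)
  then have s: "s < n m" "x (e m s s) \<noteq> 0" by auto
  then have "x (e m s s) = 1" using char_idem[OF x unit_DD[OF s(1)]] by (simp add: e_mult)
  then show ?thesis using s that by blast
qed

lemma char_unit_other:
  assumes x: "x \<in> chars" and "s < n m" "t < n m" "x (e m s s) = 1"
  shows "x (e m t t) = (if t = s then 1 else 0)"
  using char_mult[OF x unit_DD[OF assms(2)] unit_DD[OF assms(3)]] assms char_zero[OF x]
  by (auto simp: e_mult)

lemma char_pos:
  assumes x: "x \<in> chars" and km: "k \<le> m" and s: "s < n m" "x (e m s s) = 1" and i: "i < n k"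
  shows "x (e k i i) = 1 \<longleftrightarrow> pos k m s = i"
proof -
  have "x (e k i i) * x (e m s s) = x (e k i i * e m s s)"
    using char_mult[OF x unit_DD[OF i] unit_DD[OF s(1)]] by simp
  also have "\<dots> = (if i = pos k m s then 1 else 0)"
    using unit_mult_child(1)[OF km s(1) i] s char_zero[OF x] by simp
  finally show ?thesis using s by auto
qed

text \<open>
  A character takes the value \<open>1\<close> at exactly one diagonal unit of each level, and these positions
  determine it on the diagonal matrices, hence on \<open>DD\<close> by continuity.
\<close>

lemma char_eqI:
  assumes x: "x \<in> chars" and y: "y \<in> chars"
    and loc: "\<And>m. m \<ge> k \<Longrightarrow> \<exists>s<n m. x (e m s s) = 1 \<and> y (e m s s) = 1"
  shows "x = y"
proof (rule extensionalityI[of _ DD])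
  show "x \<in> extensional DD" "y \<in> extensional DD" using x y by (auto simp: characters_def)
  fix d assume d: "d \<in> DD"
  have unit: "x (e m t t) = y (e m t t)" if m: "k \<le> m" "t < n m" for m t
  proof -
    obtain s where s: "s < n m" "x (e m s s) = 1" "y (e m s s) = 1" using loc[OF m(1)] by auto
    show ?thesis using char_unit_other[OF x s(1) m(2) s(2)] char_unit_other[OF y s(1) m(2) s(3)] by simp
  qed
  have diag: "x a = y a" if m: "k \<le> m" and a: "a \<in> diag m" for a m
  proof -
    have "a \<in> DD \<and> x a = y a"
      using a
    proof (induction rule: lspan_induct)
      case zero show ?case by (simp add: char_zero[OF x] char_zero[OF y])
    qed (use unit[OF m] x y in \<open>auto simp: char_add char_scaleC DD_add DD_scaleC unit_DD\<close>)
    then show ?thesis by simp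
  qed
  obtain X where X: "\<And>m. X m \<in> diag m" "X \<longlonglongrightarrow> d" using d DD_iff by blast
  have "cmod (x d - y d) \<le> 2 * norm (X m - d)" if m: "k \<le> m" for m
  proof -
    have XD: "X m \<in> DD" using X(1)[of m] diag_DD by auto
    have "x d - y d = y (X m - d) - x (X m - d)"
      using diag[OF m X(1)] by (simp add: char_diff x y d XD)
    then have "cmod (x d - y d) \<le> cmod (y (X m - d)) + cmod (x (X m - d))"
      by (simp add: norm_triangle_ineq4)
    then show ?thesis using char_bound[OF x DD_diff[OF XD d]] char_bound[OF y DD_diff[OF XD d]] by simp
  qed
  moreover have "(\<lambda>m. 2 * norm (X m - d)) \<longlonglongrightarrow> 2 * 0"
    using X(2) by (intro tendsto_mult tendsto_const) (simp add: LIM_zero tendsto_norm_zero)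
  ultimately have "cmod (x d - y d) \<le> 2 * 0"
    by (intro LIMSEQ_le_const[of "\<lambda>m. 2 * norm (X m - d)" "2 * 0"] exI[of _ k]) auto
  then show "x d = y d" by simp
qed

text \<open>
  Along a nested sequence of diagonal units \<open>p l\<close>, the elements \<open>d * p l\<close> are asymptotically scalar
  multiples of \<open>p l\<close>; the scalar is the value of the character at \<open>d\<close>.
\<close>

lemma char_exists:
  assumes \<sigma>: "\<And>l. \<sigma> l < n (k + l)" and nested: "\<And>l. pos (k + l) (k + Suc l) (\<sigma> (Suc l)) = \<sigma> l"
  shows "\<exists>x\<in>chars. \<forall>l. x (e (k + l) (\<sigma> l) (\<sigma> l)) = 1"
proof -
  define p where "p l = e (k + l) (\<sigma> l) (\<sigma> l)" for l
  have pD: "p l \<in> DD" and pn: "norm (p l) = 1" for l using \<sigma> by (simp_all add: p_def unit_DD norm_unit)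
  have posn: "pos (k + l) (k + (l + i)) (\<sigma> (l + i)) = \<sigma> l" for l i
  proof (induction i)
    case (Suc i)
    have "pos (k + l) (k + (l + Suc i)) (\<sigma> (l + Suc i)) =
        pos (k + l) (k + (l + i)) (pos (k + (l + i)) (k + Suc (l + i)) (\<sigma> (Suc (l + i))))"
      using pos_trans[of "k + l" "k + (l + i)" "k + Suc (l + i)" "\<sigma> (Suc (l + i))"] \<sigma>[of "Suc (l + i)"] by simp
    then show ?case using nested[of "l + i"] Suc by simp
  qed (simp add: pos_self \<sigma>)
  have pp: "p l * p l' = p l'" if "l \<le> l'" for l l'
    using posn[of l "l' - l"] pos_mult[of "k + l" "k + l'" "\<sigma> l'"] that \<sigma> by (simp add: p_def)
  have uniq: "z = w" if "(\<lambda>l. d * p l - z *\<^sub>C p l) \<longlonglongrightarrow> 0" "(\<lambda>l. d * p l - w *\<^sub>C p l) \<longlonglongrightarrow> 0" for d z w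
  proof -
    have "(\<lambda>l. norm ((d * p l - z *\<^sub>C p l) - (d * p l - w *\<^sub>C p l))) \<longlonglongrightarrow> norm (0 - 0::'a)"
      using that by (intro tendsto_norm tendsto_diff)
    moreover have "norm ((d * p l - z *\<^sub>C p l) - (d * p l - w *\<^sub>C p l)) = cmod (w - z)" for l
    proof -
      have "(d * p l - z *\<^sub>C p l) - (d * p l - w *\<^sub>C p l) = (w - z) *\<^sub>C p l" by (simp add: scaleC_diff_left)
      then show ?thesis by (simp add: norm_scaleC pn)
    qed
    ultimately have "(\<lambda>l::nat. cmod (w - z)) \<longlonglongrightarrow> 0" by simp
    then have "cmod (w - z) = 0" by (simp add: LIMSEQ_const_iff)
    then show ?thesis by simp
  qed
  have ex: "\<exists>z. (\<lambda>l. d * p l - z *\<^sub>C p l) \<longlonglongrightarrow> 0" if d: "d \<in> DD" for d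
  proof -
    obtain X where X: "\<And>m. X m \<in> diag m" "X \<longlonglongrightarrow> d" using d DD_iff by blast
    define Y where "Y l = X (k + l)" for l
    have Y: "Y \<longlonglongrightarrow> d" using LIMSEQ_ignore_initial_segment[OF X(2), of k] unfolding Y_def by (simp only: add.commute)
    have "\<forall>l. \<exists>c. Y l * p l = c *\<^sub>C p l"
      using diag_mult_unit[OF X(1) \<sigma>] unfolding Y_def p_def by blast
    then obtain c where c: "\<And>l. Y l * p l = c l *\<^sub>C p l" by metis
    have c': "Y l * p l' = c l *\<^sub>C p l'" if "l \<le> l'" for l l'
    proof -
      have "Y l * p l' = (Y l * p l) * p l'" using pp[OF that] by (simp add: mult.assoc)
      then show ?thesis using pp[OF that] by (simp add: c scaleC_mult_left)
    qed
    have cc: "cmod (c l - c l') \<le> norm (Y l - Y l')" if "l \<le> l'" for l l'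
    proof -
      have "(c l - c l') *\<^sub>C p l' = (Y l - Y l') * p l'"
        using c'[OF that] c[of l'] by (simp add: scaleC_diff_left left_diff_distrib)
      then have "cmod (c l - c l') = norm ((Y l - Y l') * p l')" using pn norm_scaleC by (metis mult.right_neutral)
      then show ?thesis using norm_mult_ineq[of "Y l - Y l'" "p l'"] pn by simp
    qed
    have "Cauchy c"
    proof (rule CauchyI)
      fix r :: real assume "0 < r"
      then obtain M where M: "\<And>l l'. l \<ge> M \<Longrightarrow> l' \<ge> M \<Longrightarrow> norm (Y l - Y l') < r"
        using CauchyD[OF LIMSEQ_imp_Cauchy[OF Y]] by blast
      have "cmod (c l - c l') < r" if "l \<ge> M" "l' \<ge> M" for l l'
      proof (cases "l \<le> l'")
        case True then show ?thesis using cc[OF True] M[OF that] by simp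
      next
        case False
        then have "cmod (c l' - c l) \<le> norm (Y l' - Y l)" using cc[of l' l] by simp
        then show ?thesis using M[OF that(2,1)] by (simp add: norm_minus_commute)
      qed
      then show "\<exists>M. \<forall>m\<ge>M. \<forall>l\<ge>M. cmod (c m - c l) < r" by blast
    qed
    then obtain z where z: "c \<longlonglongrightarrow> z" using Cauchy_convergent_iff convergent_def by blast
    have "(\<lambda>l. d * p l - z *\<^sub>C p l) \<longlonglongrightarrow> 0"
    proof (rule tendsto_norm_zero_cancel, rule tendsto_sandwich[OF _ _ tendsto_const])
      show "(\<lambda>l. norm (d - Y l) + cmod (c l - z)) \<longlonglongrightarrow> 0"
      proof -
        have "(\<lambda>l. norm (d - Y l) + cmod (c l - z)) \<longlonglongrightarrow> norm (d - d) + cmod (z - z)"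
          by (intro tendsto_intros Y z)
        then show ?thesis by simp
      qed
      have "norm (d * p l - z *\<^sub>C p l) \<le> norm (d - Y l) + cmod (c l - z)" for l
      proof -
        have "d * p l - z *\<^sub>C p l = (d - Y l) * p l + (c l - z) *\<^sub>C p l"
          by (simp add: left_diff_distrib c scaleC_diff_left)
        also have "norm \<dots> \<le> norm ((d - Y l) * p l) + norm ((c l - z) *\<^sub>C p l)" by (rule norm_triangle_ineq)
        also have "\<dots> \<le> norm (d - Y l) + cmod (c l - z)"
          using norm_mult_ineq[of "d - Y l" "p l"] by (simp add: norm_scaleC pn)
        finally show ?thesis .
      qed
      then show "\<forall>\<^sub>F l in sequentially. norm (d * p l - z *\<^sub>C p l) \<le> norm (d - Y l) + cmod (c l - z)" by simp
    qed auto
    then show ?thesis ..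
  qed
  define x where "x = restrict (\<lambda>d. SOME z. (\<lambda>l. d * p l - z *\<^sub>C p l) \<longlonglongrightarrow> 0) DD"
  have xlim: "(\<lambda>l. d * p l - x d *\<^sub>C p l) \<longlonglongrightarrow> 0" if "d \<in> DD" for d
    using someI_ex[OF ex[OF that]] that by (simp add: x_def)
  have xI: "x d = z" if "d \<in> DD" "(\<lambda>l. d * p l - z *\<^sub>C p l) \<longlonglongrightarrow> 0" for d z
    using uniq[OF xlim[OF that(1)] that(2)] .
  have xp: "x (p l) = 1" for l
  proof (rule xI[OF pD])
    have "\<forall>\<^sub>F i in sequentially. 0 = p l * p i - 1 *\<^sub>C p i"
      using pp by (auto simp: eventually_sequentially intro!: exI[of _ l])
    then show "(\<lambda>i. p l * p i - 1 *\<^sub>C p i) \<longlonglongrightarrow> 0" by (rule Lim_transform_eventually[OF tendsto_const])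
  qed
  have "x \<in> chars"
    unfolding characters_def alg_hom_on_def
  proof (intro CollectI conjI ballI allI)
    show "x \<in> extensional DD" by (simp add: x_def)
    show "\<exists>d\<in>DD. x d \<noteq> 0" using xp[of 0] pD by (intro bexI[of _ "p 0"]) auto
  next
    fix a b assume ab: "a \<in> DD" "b \<in> DD"
    show "x (a + b) = x a + x b"
    proof (rule xI[OF DD_add[OF ab]])
      show "(\<lambda>l. (a + b) * p l - (x a + x b) *\<^sub>C p l) \<longlonglongrightarrow> 0"
        using tendsto_add[OF xlim[OF ab(1)] xlim[OF ab(2)]]
        by (simp add: distrib_right scaleC_add_left algebra_simps)
    qed
    show "x (a * b) = x a * x b"
    proof (rule xI[OF DD_mult[OF ab]])
      have eq: "a * b * p l - (x a * x b) *\<^sub>C p l = a * (b * p l - x b *\<^sub>C p l) + x b *\<^sub>C (a * p l - x a *\<^sub>C p l)" for l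
        by (simp add: right_diff_distrib scaleC_mult_right scaleC_diff_right scaleC_scaleC mult.assoc mult.commute)
      have "(\<lambda>l. a * (b * p l - x b *\<^sub>C p l) + x b *\<^sub>C (a * p l - x a *\<^sub>C p l)) \<longlonglongrightarrow> a * 0 + x b *\<^sub>C 0"
        by (intro tendsto_add tendsto_mult tendsto_const tendsto_scaleC xlim ab)
      then show "(\<lambda>l. a * b * p l - (x a * x b) *\<^sub>C p l) \<longlonglongrightarrow> 0" unfolding eq by simp
    qed
  next
    fix z a assume a: "a \<in> DD"
    show "x (z *\<^sub>C a) = z * x a"
    proof (rule xI[OF DD_scaleC[OF a]])
      show "(\<lambda>l. (z *\<^sub>C a) * p l - (z * x a) *\<^sub>C p l) \<longlonglongrightarrow> 0"
        using tendsto_scaleC[OF xlim[OF a], of z]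
        by (simp add: scaleC_mult_left scaleC_diff_right scaleC_scaleC)
    qed
  qed auto
  then show ?thesis using xp by (auto simp: p_def)
qed

lemma char_exists_at:
  assumes s: "s < n k" shows "\<exists>x\<in>chars. x (e k s s) = 1"
proof -
  have "\<exists>\<sigma>. \<forall>l. (\<sigma> l < n (k + l) \<and> (l = 0 \<longrightarrow> \<sigma> l = s)) \<and> pos (k + l) (k + Suc l) (\<sigma> (Suc l)) = \<sigma> l"
  proof (rule dependent_nat_choice)
    show "\<exists>x. x < n (k + 0) \<and> (0 = (0::nat) \<longrightarrow> x = s)" using s by auto
    fix t l assume "t < n (k + l) \<and> (l = 0 \<longrightarrow> t = s)"
    then show "\<exists>y. (y < n (k + Suc l) \<and> (Suc l = 0 \<longrightarrow> y = s)) \<and> pos (k + l) (k + Suc l) y = t"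
      using child_exists[of "k + l" "k + Suc l" t] by auto
  qed
  then obtain \<sigma> where "\<And>l. \<sigma> l < n (k + l)" "\<sigma> 0 = s" "\<And>l. pos (k + l) (k + Suc l) (\<sigma> (Suc l)) = \<sigma> l" by blast
  then show ?thesis using char_exists[of \<sigma> k] by (metis add.right_neutral)
qed

text \<open>
  The character that \<open>v\<close> relates to \<open>x\<close>, if \<open>x\<close> does not vanish on \<open>v DD v\<^sup>*\<close>.
\<close>

definition pull :: "('a \<Rightarrow> complex) \<Rightarrow> 'a \<Rightarrow> 'a \<Rightarrow> complex" where
  "pull x v = restrict (\<lambda>d. x (v * d * cstar v)) DD"

lemma normalizer_D:
  assumes "v \<in> normalizer cstar DD X" "d \<in> DD"
  shows "v * d * cstar v \<in> DD" "cstar v * d * v \<in> DD" "v * cstar v * v = v" "v \<in> X"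
  using assms by (auto simp: normalizer_def partial_isometry_def)

lemma normalizer_cc:
  assumes v: "v \<in> normalizer cstar DD CC"
  shows "v * cstar v \<in> DD" "cstar v * v \<in> DD"
  using normalizer_D[OF v u_DD] mult_u[of v] u_mult[of v] mult_u[of "cstar v"] CC_cstar[of v] by (auto simp: mult.assoc)

lemma normalizer_mult:
  assumes v: "v \<in> normalizer cstar DD CC" and a: "a \<in> DD" and b: "b \<in> DD"
  shows "(v * a * cstar v) * (v * b * cstar v) = v * (a * b) * cstar v"
proof -
  have "(v * a * cstar v) * (v * b * cstar v) = v * a * ((cstar v * v) * b) * cstar v" by (simp only: mult.assoc)
  also have "(cstar v * v) * b = b * (cstar v * v)" using normalizer_cc[OF v] b by (intro DD_commute)
  also have "v * a * (b * (cstar v * v)) * cstar v = v * (a * b) * (cstar v * v * cstar v)" by (simp only: mult.assoc)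
  also have "cstar v * v * cstar v = cstar (v * cstar v * v)" by (simp add: cstar_mult cstar_cstar mult.assoc)
  finally show ?thesis using normalizer_D(3)[OF v a] by simp
qed

lemma pull_char:
  assumes x: "x \<in> chars" and v: "v \<in> normalizer cstar DD CC" and d0: "d0 \<in> DD" "x (v * d0 * cstar v) \<noteq> 0"
  shows "pull x v \<in> chars"
  unfolding characters_def alg_hom_on_def
proof (intro CollectI conjI ballI allI)
  show "pull x v \<in> extensional DD" by (simp add: pull_def)
  show "\<exists>d\<in>DD. pull x v d \<noteq> 0" using d0 by (intro bexI[of _ d0]) (auto simp: pull_def)
next
  fix a b assume ab: "a \<in> DD" "b \<in> DD"
  show "pull x v (a + b) = pull x v a + pull x v b"
    using ab normalizer_D[OF v] char_add[OF x] by (simp add: pull_def DD_add distrib_left distrib_right)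
  show "pull x v (a * b) = pull x v a * pull x v b"
    using ab normalizer_D[OF v] char_mult[OF x, symmetric] by (simp add: pull_def DD_mult normalizer_mult[OF v])
next
  fix z a assume a: "a \<in> DD"
  show "pull x v (z *\<^sub>C a) = z * pull x v a"
    using a normalizer_D[OF v] char_scaleC[OF x]
    by (simp add: pull_def DD_scaleC scaleC_mult_left scaleC_mult_right)
qed auto

lemma unit_conj_DD:
  assumes ij: "i < n k" "j < n k" and d: "d \<in> DD" shows "e k i j * d * e k j i \<in> DD"
proof -
  obtain X where X: "\<And>m. X m \<in> diag m" "X \<longlonglongrightarrow> d" using d DD_iff by blast
  have "e k i j * x * e k j i \<in> diag m" if km: "k \<le> m" and x: "x \<in> diag m" for x m
    using x
  proof (induction rule: lspan_induct)
    case (unit s t) then show ?case using e_normalizes[OF km ij] by simp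
  qed (auto simp: distrib_left distrib_right scaleC_mult_left scaleC_mult_right intro: lspan_add lspan_scaleC)
  then have "e k i j * X (m + k) * e k j i \<in> DD" for m using X(1) diag_DD by (meson le_add2 subsetD)
  moreover have "(\<lambda>m. e k i j * X (m + k) * e k j i) \<longlonglongrightarrow> e k i j * d * e k j i"
    by (intro tendsto_mult tendsto_const LIMSEQ_ignore_initial_segment X)
  ultimately show ?thesis
    by (rule closed_sequentially[OF closed_DD, of "\<lambda>m. e k i j * X (m + k) * e k j i"])
qed

lemma unit_normalizer:
  assumes ij: "i < n k" "j < n k" shows "e k i j \<in> normalizer cstar DD CC"
    and "i \<le> j \<Longrightarrow> e k i j \<in> normalizer cstar DD AA"
  using assms unit_conj_DD[OF ij] unit_conj_DD[OF ij(2,1)]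
  by (auto simp: normalizer_def partial_isometry_def e_star e_mult unit_CC unit_AA)

lemma pull_unit_char:
  assumes x: "x \<in> chars" and ij: "i < n k" "j < n k" and xi: "x (e k i i) = 1"
  shows "pull x (e k i j) \<in> chars" "pull x (e k i j) (e k j j) = 1"
proof -
  have *: "e k i j * e k j j * cstar (e k i j) = e k i i" using ij by (simp add: e_star e_mult)
  show "pull x (e k i j) \<in> chars"
    using pull_char[OF x unit_normalizer(1)[OF ij] unit_DD[OF ij(2)]] * xi by simp
  show "pull x (e k i j) (e k j j) = 1" using * xi ij by (simp add: pull_def unit_DD)
qed

lemma pull_unit_pull_unit:
  assumes ij: "i < n k" "j < n k" "l < n k"
  shows "pull (pull x (e k i j)) (e k j l) = pull x (e k i l)"
proof
  fix d
  show "pull (pull x (e k i j)) (e k j l) d = pull x (e k i l) d"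
  proof (cases "d \<in> DD")
    case True
    have "e k i j * (e k j l * d * e k l j) * e k j i = (e k i j * e k j l) * d * (e k l j * e k j i)"
      by (simp only: mult.assoc)
    then show ?thesis using True ij unit_conj_DD[of j k l d] by (simp add: pull_def e_star e_mult)
  qed (simp add: pull_def)
qed

lemma pull_unit_spectrum:
  assumes x: "x \<in> chars" and ij: "i \<le> j" "j < n k" and xi: "x (e k i i) = 1"
  shows "(x, pull x (e k i j)) \<in> spectrum_rel AA"
  unfolding spectrum_rel_def diagonal_AA
  using x pull_unit_char[OF x _ ij(2) xi] ij unit_normalizer(2)[of i k j]
  by (auto simp: relates_def pull_def intro!: bexI[of _ "e k i j"])

text \<open>
  Antisymmetry of the spectrum. If \<open>v\<close> in \<open>AA\<close> related the pair in the reverse order, then at a late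
  level, where \<open>x\<close> and its image sit at \<open>a < b\<close>, the entry \<open>e\<^sub>b\<^sub>b v e\<^sub>a\<^sub>a\<close> would have norm at least \<open>1\<close>, whereas
  \<open>v\<close> is approximated by upper triangular matrices of that level.
\<close>

lemma pull_unit_not_spectrum:
  assumes x: "x \<in> chars" and ij: "i < j" "j < n k" and xi: "x (e k i i) = 1"
  shows "(pull x (e k i j), x) \<notin> spectrum_rel AA"
proof
  let ?y = "pull x (e k i j)"
  have ik: "i < n k" using ij by simp
  assume "(?y, x) \<in> spectrum_rel AA"
  then obtain v where v: "v \<in> normalizer cstar DD AA" and rel: "\<And>d. d \<in> DD \<Longrightarrow> x d = ?y (v * d * cstar v)"
    by (auto simp: spectrum_rel_def diagonal_AA relates_def)
  have y: "?y \<in> chars" using pull_unit_char[OF x ik ij(2) xi] by simp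
  have "v \<in> AA" using v by (simp add: normalizer_def)
  then obtain X where X: "\<And>l. X l \<in> upper l" "X \<longlonglongrightarrow> v" using AA_iff by blast
  obtain N where N: "\<And>l. l \<ge> N \<Longrightarrow> norm (X l - v) < 1" using LIMSEQ_D[OF X(2), of 1] by auto
  define l where "l = max k N"
  have kl: "k \<le> l" and Nl: "norm (X l - v) < 1" using N by (auto simp: l_def)
  obtain a where a: "a < n l" "x (e l a a) = 1" using char_locate[OF x] .
  have pa: "pos k l a = i" using char_pos[OF x kl a ik] xi by simp
  obtain b \<mu> where b: "b < n l" "pos k l b = j" "e k i j * e l b b * e k j i = e l a a" "a \<le> b"
    using partner[OF kl ik ij(2) a(1) pa] ij by (metis less_imp_le)
  have ab: "a < b" using b ij pa by (metis le_neq_implies_less less_irrefl)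
  have yb: "?y (e l b b) = 1" using b a ij by (simp add: pull_def unit_DD e_star)
  have vD: "v * e l a a * cstar v \<in> DD" using normalizer_D[OF v unit_DD[OF a(1)]] by simp
  have bD: "e l b b \<in> DD" using unit_DD b by simp
  have "?y (v * e l a a * cstar v) = 1" using rel[OF unit_DD[OF a(1)]] a by simp
  then have y1: "?y (e l b b * (v * e l a a * cstar v) * e l b b) = 1"
    using char_mult[OF y] yb bD vD by (simp add: DD_mult)
  define w where "w = e l b b * v * e l a a"
  have "e l b b * (v * e l a a * cstar v) * e l b b = e l b b * v * (e l a a * e l a a) * cstar v * e l b b"
    using a by (simp add: e_mult mult.assoc)
  also have "\<dots> = w * cstar w" using a b by (simp add: w_def cstar_mult e_star mult.assoc)
  finally have "?y (w * cstar w) = 1" "w * cstar w \<in> DD" using y1 DD_mult[OF DD_mult[OF bD vD] bD] by simp_all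
  then have "1 \<le> norm (w * cstar w)" using char_bound[OF y] by force
  then have w1: "1 \<le> norm w" using norm_mult_cstar[of w] by (simp add: abs_le_square_iff[of 1 "norm w", simplified])
  have "e l b b * X l * e l a a = 0" using lspan_entry_zero[OF X(1) b(1) a(1)] ab by auto
  then have "e l b b * (X l - v) * e l a a = - w" by (simp add: w_def algebra_simps)
  then have "norm w \<le> norm (X l - v)" using norm_unit_compress[OF b(1) a(1), of "X l - v"] by simp
  then show False using w1 Nl by simp
qed

section \<open>Boundedness of integer cocycles\<close>

lemma nested_pos:
  assumes \<sigma>: "\<And>l. \<sigma> l < n (k + l)" and nested: "\<And>l. pos (k + l) (k + Suc l) (\<sigma> (Suc l)) = \<sigma> l"
    and le: "l \<le> l'"
  shows "pos (k + l) (k + l') (\<sigma> l') = \<sigma> l"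
  using le
proof (induction rule: dec_induct)
  case (step i)
  have "pos (k + l) (k + Suc i) (\<sigma> (Suc i)) = pos (k + l) (k + i) (pos (k + i) (k + Suc i) (\<sigma> (Suc i)))"
    using pos_trans[of "k + l" "k + i" "k + Suc i" "\<sigma> (Suc i)"] \<sigma>[of "Suc i"] step by simp
  then show ?case using nested[of i] step by simp
qed (simp add: pos_self \<sigma>)

lemma char_close:
  assumes x: "x \<in> chars" and p: "p \<in> DD" "p * p = p" and q: "q \<in> DD" "x q = 1" and near: "norm (p - q) < 1"
  shows "x p = 1"
proof -
  have "cmod (x p - 1) < 1" using char_bound[OF x DD_diff[OF p(1) q(1)]] near q char_diff[OF x p(1) q(1)] by simp
  then show ?thesis using char_idem[OF x p] by auto
qed

lemma norm_partial_isometry_le: "v * cstar v * v = v \<Longrightarrow> norm v \<le> 1"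
  using norm_partial_isometry[of v] by (cases "v = 0") (auto simp: mult.assoc)

text \<open>
  If a normalizer \<open>f\<close> relates the same pair as a matrix unit \<open>v\<close>, then it agrees with \<open>v\<close> near this
  pair. At a level \<open>m\<close> where \<open>f\<close> is close to a matrix, let \<open>p\<close> and \<open>q\<close> be the diagonal units at which
  the two characters live. Then \<open>w = p f q\<close> is close to \<open>z = \<gamma> e\<^sub>s\<^sub>t\<close>, and evaluating \<open>w q w\<^sup>*\<close> at \<open>x\<close>
  shows that \<open>|\<gamma>|\<^sup>2\<close> is close to \<open>1\<close>. So for every later diagonal unit \<open>d\<close> below \<open>q\<close>, the projections
  \<open>w d w\<^sup>*\<close> and \<open>v d v\<^sup>*\<close> have distance less than \<open>1\<close>, and a character, being \<open>0\<close> or \<open>1\<close> on projections,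
  cannot distinguish them.
\<close>

lemma relates_locally:
  assumes ij: "i < n k" "j < n k" and km: "k \<le> m" and s: "s < n m"
    and x: "x \<in> chars" "x (e k i i) = 1" "x (e m s s) = 1"
    and f: "f \<in> normalizer cstar DD CC" and rel: "relates DD f x (pull x (e k i j))"
    and X: "X \<in> full m" "norm (X - f) < 1/20"
    and x': "x' \<in> chars" "x' (e m s s) = 1"
  shows "relates DD f x' (pull x' (e k i j))"
proof -
  define v where "v = e k i j"
  define p where "p = e m s s"
  have vst: "cstar v = e k j i" using ij by (simp add: v_def e_star)
  have ps: "pos k m s = i" using char_pos[OF x(1) km s x(3) ij(1)] x by simp
  obtain t \<mu> where t: "t < n m" and mu: "cmod \<mu> = 1" and post: "pos k m t = j"
    and vq: "v * e m t t = \<mu> *\<^sub>C e m s t" and vqv: "v * e m t t * cstar v = p"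
    unfolding vst unfolding v_def p_def using partner[OF km ij s ps] by metis
  define q where "q = e m t t"
  have pD: "p \<in> DD" and qD: "q \<in> DD" using s t by (auto simp: p_def q_def unit_DD)
  have pst: "cstar p = p" "cstar q = q" "p * p = p" "q * q = q" using s t by (simp_all add: p_def q_def e_star e_mult)
  have pn: "norm p = 1" "norm q = 1" using s t by (simp_all add: p_def q_def norm_unit)
  have fn: "norm f \<le> 1" using normalizer_D(3)[OF f u_DD] by (rule norm_partial_isometry_le)
  define w where "w = p * f * q"
  define z where "z = p * X * q"
  have compress: "norm (p * c * q) \<le> norm c" for c
    using norm_unit_compress[OF s t, of c] by (simp add: p_def q_def)
  have wn: "norm w \<le> 1" using compress[of f] fn by (simp add: w_def)
  have wz: "norm (w - z) \<le> 1/20"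
  proof -
    have "w - z = p * (f - X) * q" by (simp add: w_def z_def algebra_simps)
    then show ?thesis using compress[of "f - X"] X(2) by (simp add: norm_minus_commute)
  qed
  have zn: "norm z \<le> 21/20" using norm_triangle_ineq3[of w z] wn wz by linarith
  obtain \<gamma> where g: "z = \<gamma> *\<^sub>C e m s t"
    using full_entry[OF X(1) s t] s t unfolding z_def p_def q_def by metis
  have near1: "norm (w * d * cstar w - z * d * cstar z) \<le> 3/20" if d: "norm d \<le> 1" for d
  proof -
    have "w * d * cstar w - z * d * cstar z = (w - z) * d * cstar w + z * d * cstar (w - z)"
      by (simp add: cstar_diff algebra_simps)
    also have "norm \<dots> \<le> norm ((w - z) * d * cstar w) + norm (z * d * cstar (w - z))" by (rule norm_triangle_ineq)
    also have "norm ((w - z) * d * cstar w) \<le> 1/20 * 1 * 1"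
      by (rule order_trans[OF norm_mult_ineq], rule mult_mono, rule order_trans[OF norm_mult_ineq], rule mult_mono)
         (use wz d wn in auto)
    also have "norm (z * d * cstar (w - z)) \<le> 21/20 * 1 * (1/20)"
      by (rule order_trans[OF norm_mult_ineq], rule mult_mono, rule order_trans[OF norm_mult_ineq], rule mult_mono)
         (use wz d zn in auto)
    finally show ?thesis by simp
  qed
  define g2 where "g2 = complex_of_real ((cmod \<gamma>)\<^sup>2)"
  have zdz: "z * d * cstar z = g2 *\<^sub>C (v * d * cstar v)" if d: "q * d = d" "d * q = d" for d
  proof -
    have "v * d * cstar v = v * (q * d * q) * cstar v" using d by simp
    also have "\<dots> = (v * q) * d * cstar (v * q)" by (simp add: cstar_mult pst mult.assoc)
    also have "\<dots> = (\<mu> * cnj \<mu>) *\<^sub>C (e m s t * d * e m t s)"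
      using s t vq by (simp add: q_def cstar_scaleC e_star scaleC_mult_left scaleC_mult_right scaleC_scaleC mult.commute)
    also have "\<mu> * cnj \<mu> = 1" using mu complex_norm_square[of \<mu>] by simp
    finally have vd: "v * d * cstar v = e m s t * d * e m t s" by simp
    have "z * d * cstar z = (\<gamma> * cnj \<gamma>) *\<^sub>C (e m s t * d * e m t s)"
      using s t by (simp add: g cstar_scaleC e_star scaleC_mult_left scaleC_mult_right scaleC_scaleC mult.commute)
    then show ?thesis using vd complex_norm_square[of \<gamma>] by (simp add: g2_def)
  qed
  have wdw: "w * d * cstar w = p * (f * d * cstar f) * p" if d: "q * d = d" "d * q = d" for d
  proof -
    have "w * d * cstar w = p * f * (q * d * q) * cstar f * p" by (simp add: w_def cstar_mult pst mult.assoc)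
    then show ?thesis using d by (simp add: mult.assoc)
  qed
  have xw: "y (w * d * cstar w) = y (f * d * cstar f)"
    if "y \<in> chars" "y p = 1" "d \<in> DD" "q * d = d" "d * q = d" for y d
    using that wdw[of d] char_mult[OF that(1)] pD normalizer_D(1)[OF f] by (simp add: DD_mult)
  have wD: "w * d * cstar w \<in> DD" if "d \<in> DD" "q * d = d" "d * q = d" for d
    using that wdw[of d] pD normalizer_D(1)[OF f] by (simp add: DD_mult)
  have "x (f * q * cstar f) = 1"
    using rel qD vqv x(3) by (auto simp: relates_def pull_def v_def q_def p_def)
  then have xq: "x (w * q * cstar w) = 1" using xw[OF x(1) _ qD] x pst by (simp add: p_def)
  have "z * q * cstar z = g2 *\<^sub>C p" using zdz[of q] pst vqv by (simp add: q_def)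
  then have "x (w * q * cstar w - z * q * cstar z) = 1 - g2"
    using char_diff[OF x(1) wD[OF qD pst(4) pst(4)] DD_scaleC[OF pD]] xq char_scaleC[OF x(1) pD] x(3)
    by (simp add: p_def)
  then have g2n: "cmod (1 - g2) \<le> 3/20"
    using char_bound[OF x(1), of "w * q * cstar w - z * q * cstar z"] near1[of q] pn wD[OF qD pst(4) pst(4)]
      \<open>z * q * cstar z = g2 *\<^sub>C p\<close> pD by (simp add: DD_diff DD_scaleC)
  have key: "x' (f * d * cstar f) = 1"
    if d: "d \<in> DD" "q * d = d" "d * q = d" "d * d = d" "norm d \<le> 1" "x' (v * d * cstar v) = 1" for d
  proof -
    have vdD: "v * d * cstar v \<in> DD" using unit_conj_DD[OF ij d(1)] by (simp add: vst) (simp add: v_def)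
    have vn: "norm (v * d * cstar v) \<le> 1"
    proof -
      have "norm v = 1" using ij by (simp add: v_def norm_unit)
      then show ?thesis using norm_mult_ineq[of "v * d" "cstar v"] norm_mult_ineq[of v d] d by simp
    qed
    have "w * d * cstar w - v * d * cstar v = (w * d * cstar w - z * d * cstar z) - (1 - g2) *\<^sub>C (v * d * cstar v)"
      using zdz[OF d(2,3)] by (simp add: scaleC_diff_left)
    also have "norm \<dots> \<le> norm (w * d * cstar w - z * d * cstar z) + norm ((1 - g2) *\<^sub>C (v * d * cstar v))"
      by (rule norm_triangle_ineq4)
    also have "\<dots> \<le> 3/20 + 3/20 * 1"
      using near1[OF d(5)] g2n vn unfolding norm_scaleC by (intro add_mono mult_mono) auto
    finally have near: "norm (w * d * cstar w - v * d * cstar v) < 1" by simp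
    have idem: "(w * d * cstar w) * (w * d * cstar w) = w * d * cstar w"
    proof -
      have fD: "f * d * cstar f \<in> DD" using normalizer_D(1)[OF f d(1)] .
      have ff: "(f * d * cstar f) * (f * d * cstar f) = f * d * cstar f" using normalizer_mult[OF f d(1) d(1)] d by simp
      have eq: "w * d * cstar w = p * (f * d * cstar f)"
        using wdw[OF d(2,3)] DD_commute[OF pD fD] pst by (metis mult.assoc)
      define F where "F = f * d * cstar f"
      have "(p * F) * (p * F) = p * (F * p) * F" by (simp only: mult.assoc)
      also have "F * p = p * F" using DD_commute[OF pD fD] by (simp add: F_def)
      also have "p * (p * F) * F = (p * p) * (F * F)" by (simp only: mult.assoc)
      also have "\<dots> = p * F" using ff pst by (simp add: F_def)
      finally show ?thesis unfolding eq F_def .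
    qed
    have "x' (w * d * cstar w) = 1"
      by (rule char_close[OF x'(1) wD[OF d(1-3)] idem vdD d(6) near])
    then show ?thesis using xw[OF x'(1) _ d(1-3)] x' by (simp add: p_def)
  qed
  have "x' (v * q * cstar v) = 1" using vqv x'(2) by (simp add: q_def p_def)
  then have "x' (f * q * cstar f) = 1" using key[OF qD] pst pn by simp
  then have c1: "pull x' f \<in> chars" using pull_char[OF x'(1) f qD] by simp
  have xi': "x' (e k i i) = 1" using char_pos[OF x'(1) km s x'(2) ij(1)] ps by simp
  then have c2: "pull x' v \<in> chars" unfolding v_def using pull_unit_char[OF x'(1) ij] by simp
  have vqt: "pull x' v (e m t t) = 1" using vqv x'(2) t by (simp add: pull_def unit_DD p_def)
  have "pull x' v = pull x' f"
  proof (rule char_eqI[OF c2 c1, of m])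
    fix l assume ml: "m \<le> l"
    obtain b where b: "b < n l" "pull x' v (e l b b) = 1" using char_locate[OF c2] .
    have pb: "pos m l b = t" using char_pos[OF c2 ml b t] vqt by simp
    have bD: "e l b b \<in> DD" using b unit_DD by simp
    have "x' (f * e l b b * cstar f) = 1"
    proof (rule key[OF bD])
      show "q * e l b b = e l b b" "e l b b * q = e l b b"
        using unit_mult_child[OF ml b(1) t] pb by (simp_all add: q_def)
      show "x' (v * e l b b * cstar v) = 1" using b bD by (simp add: pull_def)
    qed (use b in \<open>simp_all add: e_mult norm_unit\<close>)
    then show "\<exists>s<n l. pull x' v (e l s s) = 1 \<and> pull x' f (e l s s) = 1"
      using b bD by (auto simp: pull_def)
  qed
  then show ?thesis unfolding relates_def v_def[symmetric] by (simp add: pull_def)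
qed

text \<open>
  At a pair related by a matrix unit, the sets of pairs that the unit relates and whose first member
  lies below \<open>\<sigma> l\<close> at level \<open>k + l\<close> form a neighbourhood base.
\<close>

lemma open_contains_level:
  assumes \<sigma>: "\<And>l. \<sigma> l < n (k + l)" and nested: "\<And>l. pos (k + l) (k + Suc l) (\<sigma> (Suc l)) = \<sigma> l"
    and j: "j < n k" and x: "x \<in> chars" "\<And>l. x (e (k + l) (\<sigma> l) (\<sigma> l)) = 1"
    and T: "generate_topology_on (basic_open DD ` normalizer cstar DD CC) T" "(x, pull x (e k (\<sigma> 0) j)) \<in> T"
  shows "\<exists>l. \<forall>x'\<in>chars. x' (e (k + l) (\<sigma> l) (\<sigma> l)) = 1 \<longrightarrow> (x', pull x' (e k (\<sigma> 0) j)) \<in> T"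
  using T
proof (induction rule: generate_topology_on.induct)
  case (Int S T)
  then obtain l1 l2 where l: "\<forall>x'\<in>chars. x' (e (k + l1) (\<sigma> l1) (\<sigma> l1)) = 1 \<longrightarrow> (x', pull x' (e k (\<sigma> 0) j)) \<in> S"
      "\<forall>x'\<in>chars. x' (e (k + l2) (\<sigma> l2) (\<sigma> l2)) = 1 \<longrightarrow> (x', pull x' (e k (\<sigma> 0) j)) \<in> T" by auto
  have down: "x' (e (k + l') (\<sigma> l') (\<sigma> l')) = 1"
    if "x' \<in> chars" "l' \<le> l" "x' (e (k + l) (\<sigma> l) (\<sigma> l)) = 1" for x' l l'
    using char_pos[OF that(1), of "k + l'" "k + l" "\<sigma> l" "\<sigma> l'"] nested_pos[of \<sigma> k l' l, OF \<sigma> nested that(2)] \<sigma> that by simp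
  have "\<forall>x'\<in>chars. x' (e (k + max l1 l2) (\<sigma> (max l1 l2)) (\<sigma> (max l1 l2))) = 1 \<longrightarrow> (x', pull x' (e k (\<sigma> 0) j)) \<in> S \<inter> T"
    using l down[of _ l1 "max l1 l2"] down[of _ l2 "max l1 l2"] by auto
  then show ?case ..
next
  case (Basis T)
  then obtain f where f: "f \<in> normalizer cstar DD CC" "T = basic_open DD f" by auto
  have i: "\<sigma> 0 < n k" using \<sigma>[of 0] by simp
  have x0: "x (e k (\<sigma> 0) (\<sigma> 0)) = 1" using x(2)[of 0] by simp
  have rel: "relates DD f x (pull x (e k (\<sigma> 0) j))" using Basis f by (auto simp: basic_open_def)
  have "f \<in> CC" using f by (simp add: normalizer_def)
  then obtain X where X: "\<And>m. X m \<in> full m" "X \<longlonglongrightarrow> f" using CC_iff by blast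
  obtain N where N: "\<And>m. m \<ge> N \<Longrightarrow> norm (X m - f) < 1/20" using LIMSEQ_D[OF X(2), of "1/20"] by auto
  have "(x', pull x' (e k (\<sigma> 0) j)) \<in> T" if x': "x' \<in> chars" "x' (e (k + N) (\<sigma> N) (\<sigma> N)) = 1" for x'
  proof -
    have kN: "k \<le> k + N" by simp
    have xi: "x' (e k (\<sigma> 0) (\<sigma> 0)) = 1"
      using char_pos[OF x'(1) kN \<sigma> x'(2) i] nested_pos[of \<sigma> k 0 N, OF \<sigma> nested] by simp
    have "relates DD f x' (pull x' (e k (\<sigma> 0) j))"
      by (rule relates_locally[OF i j kN \<sigma> x(1) x0 x(2) f(1) rel X(1) N x']) simp
    then show ?thesis using x' pull_unit_char[OF x'(1) i j xi] f by (simp add: basic_open_def)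
  qed
  then show ?case by blast
next
  case (UN K)
  then obtain S where "S \<in> K" "(x, pull x (e k (\<sigma> 0) j)) \<in> S" by blast
  with UN obtain l where "\<forall>x'\<in>chars. x' (e (k + l) (\<sigma> l) (\<sigma> l)) = 1 \<longrightarrow> (x', pull x' (e k (\<sigma> 0) j)) \<in> S"
    by blast
  then show ?case using \<open>S \<in> K\<close> by blast
qed simp

context
  fixes c :: "('a \<Rightarrow> complex) \<times> ('a \<Rightarrow> complex) \<Rightarrow> real"
  assumes coc: "cocycle CC AA c" and int: "\<And>p. p \<in> groupoid AA \<Longrightarrow> c p \<in> \<int>"
    and nonneg: "{p \<in> groupoid AA. c p \<in> {0..}} = spectrum_rel AA"
begin

lemma cocycle_add: "(x, y) \<in> groupoid AA \<Longrightarrow> (y, z) \<in> groupoid AA \<Longrightarrow> c (x, z) = c (x, y) + c (y, z)"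
  using coc by (auto simp: cocycle_def)

text \<open>
  The value is a non-negative integer as the pair is in the spectrum, and it is not \<open>0\<close>, since
  otherwise the reversed pair would be in the spectrum as well.
\<close>

lemma cocycle_step:
  assumes x: "x \<in> chars" and ij: "i < j" "j < n k" and xi: "x (e k i i) = 1"
  shows "c (x, pull x (e k i j)) \<ge> 1"
proof -
  let ?y = "pull x (e k i j)"
  have xy: "(x, ?y) \<in> spectrum_rel AA" using pull_unit_spectrum[OF x _ ij(2) xi] ij by simp
  have g: "(x, ?y) \<in> groupoid AA" "(?y, x) \<in> groupoid AA" using xy spectrum_rel_groupoid groupoid_sym by blast+
  have xx: "(x, x) \<in> groupoid AA" using groupoid_refl[of x AA] x by (simp add: diagonal_AA)
  have "c (x, x) = 0" using cocycle_add[OF xx xx] by simp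
  then have neg: "c (?y, x) = - c (x, ?y)" using cocycle_add[OF g] by simp
  have c0: "c (x, ?y) \<ge> 0" using xy nonneg by auto
  have "(?y, x) \<notin> spectrum_rel AA" using pull_unit_not_spectrum[OF x ij xi] .
  then have "\<not> c (?y, x) \<ge> 0" using nonneg g by auto
  then have pos: "c (x, ?y) > 0" using neg by simp
  obtain z where "c (x, ?y) = of_int z" using int[OF g(1)] by (auto elim: Ints_cases)
  then show ?thesis using pos by simp
qed

lemma cocycle_length:
  assumes x: "x \<in> chars" and xs: "x (e m s s) = 1" and st: "s \<le> t" "t < n m"
  shows "real t - real s \<le> c (x, pull x (e m s t))"
  using st
proof (induction t rule: dec_induct)
  case base
  have "(x, pull x (e m s s)) \<in> spectrum_rel AA" using pull_unit_spectrum[OF x _ base xs] by simp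
  then show ?case using nonneg by auto
next
  case (step t)
  let ?y = "pull x (e m s t)"
  have s: "s < n m" and t: "t < n m" using step by auto
  have y: "?y \<in> chars" "?y (e m t t) = 1" using pull_unit_char[OF x s t xs] by auto
  have z: "pull ?y (e m t (Suc t)) = pull x (e m s (Suc t))"
    using pull_unit_pull_unit[of s m t "Suc t" x] s t step by simp
  have "(x, ?y) \<in> groupoid AA" "(?y, pull ?y (e m t (Suc t))) \<in> groupoid AA"
    using pull_unit_spectrum[OF x _ t xs] pull_unit_spectrum[OF y(1) _ _ y(2), of "Suc t"] step spectrum_rel_groupoid
    by (auto dest: subsetD[OF spectrum_rel_groupoid])
  from cocycle_add[OF this] show ?case
    using step cocycle_step[OF y(1) _ _ y(2), of "Suc t"] unfolding z by simp
qed

text \<open>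
  Compactness in the form of Koenig's lemma: if \<open>c\<close> were unbounded, it would be unbounded on the
  pairs below some child of \<open>i\<close>, below some child of that child, and so on. At the character
  determined by this branch the continuity of \<open>c\<close> gives a bound on all pairs below one of its
  members.
\<close>

lemma cocycle_bounded:
  assumes ij: "i \<le> j" "j < n k"
  shows "\<exists>M. \<forall>x\<in>chars. x (e k i i) = 1 \<longrightarrow> c (x, pull x (e k i j)) \<le> M"
proof (rule ccontr)
  assume unb: "\<not> (\<exists>M. \<forall>x\<in>chars. x (e k i i) = 1 \<longrightarrow> c (x, pull x (e k i j)) \<le> M)"
  define bad where "bad l s \<longleftrightarrow> s < n (k + l) \<and>
      (\<forall>M. \<exists>x\<in>chars. x (e (k + l) s s) = 1 \<and> x (e k i i) = 1 \<and> \<not> c (x, pull x (e k i j)) \<le> M)" for l s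
  have i: "i < n k" using ij by simp
  have "\<exists>\<sigma>. \<forall>l. (bad l (\<sigma> l) \<and> (l = 0 \<longrightarrow> \<sigma> l = i)) \<and> pos (k + l) (k + Suc l) (\<sigma> (Suc l)) = \<sigma> l"
  proof (rule dependent_nat_choice)
    show "\<exists>s. bad 0 s \<and> (0 = (0::nat) \<longrightarrow> s = i)" using unb i by (auto simp: bad_def)
    fix s l assume s: "bad l s \<and> (l = 0 \<longrightarrow> s = i)"
    have "\<exists>t. bad (Suc l) t \<and> pos (k + l) (k + Suc l) t = s"
    proof (rule ccontr)
      assume no: "\<not> (\<exists>t. bad (Suc l) t \<and> pos (k + l) (k + Suc l) t = s)"
      let ?K = "{t. t < n (k + Suc l) \<and> pos (k + l) (k + Suc l) t = s}"
      have "\<forall>t\<in>?K. \<exists>M. \<forall>x\<in>chars. x (e (k + Suc l) t t) = 1 \<longrightarrow> x (e k i i) = 1 \<longrightarrow> c (x, pull x (e k i j)) \<le> M"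
      proof
        fix t assume t: "t \<in> ?K"
        then have "\<not> bad (Suc l) t" using no by auto
        then show "\<exists>M. \<forall>x\<in>chars. x (e (k + Suc l) t t) = 1 \<longrightarrow> x (e k i i) = 1 \<longrightarrow> c (x, pull x (e k i j)) \<le> M"
          using t unfolding bad_def by blast
      qed
      from bchoice[OF this] obtain M where M: "\<forall>t\<in>?K. \<forall>x\<in>chars. x (e (k + Suc l) t t) = 1 \<longrightarrow>
          x (e k i i) = 1 \<longrightarrow> c (x, pull x (e k i j)) \<le> M t" ..
      have fin: "finite ?K" by simp
      obtain x where x: "x \<in> chars" "x (e (k + l) s s) = 1" "x (e k i i) = 1"
          "\<not> c (x, pull x (e k i j)) \<le> (\<Sum>t\<in>?K. \<bar>M t\<bar>)" using s unfolding bad_def by blast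
      obtain t where t: "t < n (k + Suc l)" "x (e (k + Suc l) t t) = 1" using char_locate[OF x(1)] .
      have "pos (k + l) (k + Suc l) t = s"
        using char_pos[OF x(1), of "k + l" "k + Suc l" t s] t x s by (auto simp: bad_def)
      then have tK: "t \<in> ?K" using t by simp
      have "M t \<le> \<bar>M t\<bar>" by simp
      also have "\<dots> \<le> (\<Sum>t\<in>?K. \<bar>M t\<bar>)" using tK fin by (intro member_le_sum) auto
      finally show False using M[rule_format, OF tK x(1) t(2) x(3)] x(4) by linarith
    qed
    then show "\<exists>t. (bad (Suc l) t \<and> (Suc l = 0 \<longrightarrow> t = i)) \<and> pos (k + l) (k + Suc l) t = s" by auto
  qed
  then obtain \<sigma> where bad: "\<And>l. bad l (\<sigma> l)" and \<sigma>0: "\<sigma> 0 = i"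
    and nested: "\<And>l. pos (k + l) (k + Suc l) (\<sigma> (Suc l)) = \<sigma> l" by blast
  have \<sigma>: "\<sigma> l < n (k + l)" for l using bad by (simp add: bad_def)
  obtain x where x: "x \<in> chars" "\<And>l. x (e (k + l) (\<sigma> l) (\<sigma> l)) = 1" using char_exists[OF \<sigma> nested] by blast
  have xi: "x (e k i i) = 1" using x(2)[of 0] \<sigma>0 by simp
  let ?y = "pull x (e k i j)"
  let ?G = "groupoid_topology CC AA"
  have gr: "(x', pull x' (e k i j)) \<in> groupoid AA" if "x' \<in> chars" "x' (e k i i) = 1" for x'
    using pull_unit_spectrum[OF that(1) ij that(2)] spectrum_rel_groupoid by blast
  have y: "?y \<in> chars" using pull_unit_char[OF x(1) i ij(2) xi] by simp
  have "(x, ?y) \<in> basic_open DD (e k i j)" using x y by (auto simp: basic_open_def relates_def pull_def)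
  then have top: "(x, ?y) \<in> topspace ?G"
    using gr[OF x(1) xi] unit_normalizer(1)[OF i ij(2)]
    unfolding groupoid_topology_def topspace_subtopology topology_generated_by_topspace diagonal_AA by blast
  have "continuous_map ?G euclideanreal c" using coc by (simp add: cocycle_def)
  then have "openin ?G {p \<in> topspace ?G. c p \<in> {..<c (x, ?y) + 1}}"
    by (rule openin_continuous_map_preimage) simp
  then obtain T where T: "openin (topology_generated_by (basic_open DD ` normalizer cstar DD CC)) T"
    "{p \<in> topspace ?G. c p \<in> {..<c (x, ?y) + 1}} = T \<inter> groupoid AA"
    unfolding groupoid_topology_def diagonal_AA openin_subtopology by blast
  have "(x, ?y) \<in> T" using top T(2) by fastforce
  then obtain l where l: "\<forall>x'\<in>chars. x' (e (k + l) (\<sigma> l) (\<sigma> l)) = 1 \<longrightarrow> (x', pull x' (e k i j)) \<in> T"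
    using open_contains_level[OF \<sigma> nested ij(2) x] T(1) \<sigma>0 unfolding openin_topology_generated_by_iff by blast
  obtain x' where x': "x' \<in> chars" "x' (e (k + l) (\<sigma> l) (\<sigma> l)) = 1" "x' (e k i i) = 1"
    "\<not> c (x', pull x' (e k i j)) \<le> c (x, ?y) + 1" using bad[of l] unfolding bad_def by blast
  have "(x', pull x' (e k i j)) \<in> T \<inter> groupoid AA" using l x' gr by blast
  then have "c (x', pull x' (e k i j)) < c (x, ?y) + 1" using T(2) by blast
  then show False using x'(4) by simp
qed

text \<open>
  The difference \<open>t - s\<close> is bounded by the value of \<open>c\<close> at a pair that \<open>e m s t\<close>, and therefore
  \<open>e k i j\<close>, relates.
\<close>

lemma copies_bounded:
  assumes ij: "i \<le> j" "j < n k"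
  shows "\<exists>M::nat. \<forall>m s t \<mu>. k \<le> m \<longrightarrow> s < n m \<longrightarrow> t < n m \<longrightarrow> pos k m s = i \<longrightarrow> s \<le> t \<longrightarrow> cmod \<mu> = 1 \<longrightarrow>
     e m s s * e k i j = \<mu> *\<^sub>C e m s t \<longrightarrow> t \<le> s + M"
proof -
  obtain M where M: "\<And>x. x \<in> chars \<Longrightarrow> x (e k i i) = 1 \<Longrightarrow> c (x, pull x (e k i j)) \<le> M"
    using cocycle_bounded[OF ij] by blast
  have "t \<le> s + nat \<lceil>M\<rceil>"
    if km: "k \<le> m" and s: "s < n m" and t: "t < n m" and ps: "pos k m s = i" and st: "s \<le> t"
      and mu: "cmod \<mu> = 1" and eq: "e m s s * e k i j = \<mu> *\<^sub>C e m s t" for m s t \<mu>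
  proof -
    obtain x where x: "x \<in> chars" "x (e m s s) = 1" using char_exists_at[OF s] by blast
    have i: "i < n k" using ij by simp
    have xi: "x (e k i i) = 1" using char_pos[OF x(1) km s x(2) i] ps by simp
    have pe: "pull x (e k i j) = pull x (e m s t)"
    proof
      fix d
      show "pull x (e k i j) d = pull x (e m s t) d"
      proof (cases "d \<in> DD")
        case True
        let ?v = "e k i j * d * cstar (e k i j)"
        have vD: "?v \<in> DD" using unit_conj_DD[OF i ij(2) True] i ij by (simp add: e_star)
        have "x ?v = x (e m s s * ?v * e m s s)"
          using char_mult[OF x(1)] x(2) vD unit_DD[OF s] by (simp add: DD_mult)
        also have "e m s s * ?v * e m s s = (e m s s * e k i j) * d * cstar (e m s s * e k i j)"
          using s by (simp add: cstar_mult e_star mult.assoc)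
        also have "\<dots> = (\<mu> * cnj \<mu>) *\<^sub>C (e m s t * d * cstar (e m s t))"
          by (simp add: eq cstar_scaleC scaleC_mult_left scaleC_mult_right scaleC_scaleC mult.commute)
        also have "\<mu> * cnj \<mu> = 1" using mu complex_norm_square[of \<mu>] by simp
        finally show ?thesis using True by (simp add: pull_def)
      qed (simp add: pull_def)
    qed
    have "real t - real s \<le> M" using cocycle_length[OF x st t] M[OF x(1) xi] pe by simp
    then have "real t \<le> real s + real_of_int \<lceil>M\<rceil>" by linarith
    then show ?thesis by linarith
  qed
  then show ?thesis by blast
qed

end

end

section \<open>Products of commutators in an ideal\<close>

text \<open>
  A product of \<open>l + 1\<close> commutators (there is no unit for the empty product).
\<close>

primrec comm_prod :: "(nat \<Rightarrow> 'a::ring) \<Rightarrow> (nat \<Rightarrow> 'a) \<Rightarrow> nat \<Rightarrow> 'a" where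
  "comm_prod a b 0 = a 0 * b 0 - b 0 * a 0"
| "comm_prod a b (Suc l) = comm_prod a b l * (a (Suc l) * b (Suc l) - b (Suc l) * a (Suc l))"

context matrix_tower
begin

text \<open>
  The index \<open>i\<close> in the middle of the interval from \<open>a\<close> to \<open>a + 2 M\<close> lies below some \<open>r\<close> of level \<open>k\<close>. The
  copy of the corner unit through \<open>i\<close> joins the partners \<open>s\<close> and \<open>t\<close> of \<open>i\<close> below the first and below
  the last index of level \<open>k\<close>. So \<open>s \<le> i \<le> t\<close> and \<open>t - s \<le> M\<close>, and the copy lies within the interval.
\<close>

lemma long_units_in_ideal:
  assumes left: "\<And>x y. x \<in> AA \<Longrightarrow> y \<in> J \<Longrightarrow> x * y \<in> J"
    and right: "\<And>x y. x \<in> J \<Longrightarrow> y \<in> AA \<Longrightarrow> x * y \<in> J"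
    and corner: "e k 0 (n k - 1) \<in> J"
    and M: "\<And>m s t \<mu>. k \<le> m \<Longrightarrow> s < n m \<Longrightarrow> t < n m \<Longrightarrow> pos k m s = 0 \<Longrightarrow> s \<le> t \<Longrightarrow> cmod \<mu> = 1 \<Longrightarrow>
        e m s s * e k 0 (n k - 1) = \<mu> *\<^sub>C e m s t \<Longrightarrow> t \<le> s + M"
    and km: "k \<le> m" and ab: "a + 2 * M \<le> b" "b < n m"
  shows "e m a b \<in> J"
proof -
  define i where "i = a + M"
  have i: "i < n m" using ab by (simp add: i_def)
  define r where "r = pos k m i"
  have r: "r < n k" using pos_less[OF km i] by (simp add: r_def)
  have k0: "0 < n k" and k1: "n k - 1 < n k" using n_pos[of k] by auto
  \<comment> \<open>the partner of i below index 0, seen from both sides\<close>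
  obtain s \<nu> where s: "s < n m" "cmod \<nu> = 1" "pos k m s = 0"
      "e k 0 r * e m i i = \<nu> *\<^sub>C e m s i" "s \<le> i" "e m s s * e k 0 r = \<nu> *\<^sub>C e m s i"
  proof -
    obtain s \<nu> where *: "s < n m" "cmod \<nu> = 1" "pos k m s = 0"
      "e m i i * e k r 0 = \<nu> *\<^sub>C e m i s" "e k r 0 * e m s s = \<nu> *\<^sub>C e m i s"
      "e k r 0 * e m s s * e k 0 r = e m i i"
      using partner[OF km r k0 i r_def[symmetric]] by metis
    obtain i' \<nu>' where **: "i' < n m" "e m s s * e k 0 r = \<nu>' *\<^sub>C e m s i'" "e k r 0 * e m s s * e k 0 r = e m i' i'" "s \<le> i'"
      using partner[OF km k0 r *(1) *(3)] by (metis le0)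
    have "i' = i"
    proof (rule ccontr)
      assume "i' \<noteq> i"
      then have "e m i i * e m i' i' = 0" using i ** by (simp add: e_mult)
      moreover have "e m i i = e m i' i'" using * ** by simp
      ultimately have "e m i' i' * e m i' i' = 0" by simp
      then show False using e_mult[of i' m i' i' i'] e_nonzero[of i' m] **(1) by simp
    qed
    have "cstar (e k r 0) * cstar (e m i i) = cstar (\<nu> *\<^sub>C e m i s)" by (simp only: cstar_mult[symmetric] *(4))
    then have 1: "e k 0 r * e m i i = cnj \<nu> *\<^sub>C e m s i" using i r k0 *(1) by (simp add: cstar_scaleC e_star)
    have "cstar (e m s s) * cstar (e k r 0) = cstar (\<nu> *\<^sub>C e m i s)" by (simp only: cstar_mult[symmetric] *(5))
    then have 2: "e m s s * e k 0 r = cnj \<nu> *\<^sub>C e m s i" using i r k0 *(1) by (simp add: cstar_scaleC e_star)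
    show ?thesis using that[of s "cnj \<nu>"] * ** 1 2 \<open>i' = i\<close> by simp
  qed
  have rk: "r \<le> n k - 1" using r by simp
  obtain t \<nu>' where t: "t < n m" "cmod \<nu>' = 1" "e m i i * e k r (n k - 1) = \<nu>' *\<^sub>C e m i t" "i \<le> t"
    using partner[OF km r k1 i r_def[symmetric]] rk by metis
  have st: "e m s s * e k 0 (n k - 1) = (\<nu> * \<nu>') *\<^sub>C e m s t"
  proof -
    have "e k 0 (n k - 1) = e k 0 r * e k r (n k - 1)" using r k0 k1 by (simp add: e_mult)
    then have "e m s s * e k 0 (n k - 1) = (e m s s * e k 0 r) * e k r (n k - 1)" by (simp add: mult.assoc)
    also have "\<dots> = \<nu> *\<^sub>C (e m s i * (e m i i * e k r (n k - 1)))"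
      using s i by (simp add: s(6) scaleC_mult_left mult.assoc[symmetric] e_mult)
    also have "\<dots> = (\<nu> * \<nu>') *\<^sub>C e m s t"
      using s t i by (simp add: t(3) scaleC_mult_right scaleC_scaleC e_mult)
    finally show ?thesis .
  qed
  have nu: "cmod (\<nu> * \<nu>') = 1" using s t by (simp add: norm_mult)
  have tM: "t \<le> s + M" using M[OF km s(1) t(1) s(3) _ nu st] s t by simp
  have as: "a \<le> s" and tb: "t \<le> b" using tM s t ab by (auto simp: i_def)
  have "e m s s * e k 0 (n k - 1) \<in> J" using s by (intro left corner unit_AA) auto
  then have "(\<nu> * \<nu>') *\<^sub>C e m s t \<in> J" using st by simp
  then have "(inverse (\<nu> * \<nu>') *\<^sub>C e m a s) * ((\<nu> * \<nu>') *\<^sub>C e m s t) \<in> J"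
    using as s by (intro left AA_scaleC unit_AA)
  moreover have "\<nu> * \<nu>' \<noteq> 0" using nu by auto
  then have "(inverse (\<nu> * \<nu>') *\<^sub>C e m a s) * ((\<nu> * \<nu>') *\<^sub>C e m s t) = e m a s * e m s t"
    unfolding scaleC_mult_scaleC by (simp only: left_inverse scaleC_one not_False_eq_True)
  ultimately have "e m a t \<in> J" using as s t ab by (simp add: e_mult)
  then have "e m a t * e m t b \<in> J" using tb ab by (intro right unit_AA)
  then show ?thesis using ab t as s by (simp add: e_mult)
qed

lemma commutator_level:
  assumes x: "x \<in> upper m" and y: "y \<in> upper m"
  shows "x * y - y * x \<in> lspan (\<lambda>i j. i + 1 \<le> j) m"
proof (rule lspanI_entries)
  have d: "x * y - y * x \<in> upper m" using x y by (intro lspan_diff upper_mult)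
  then show "x * y - y * x \<in> full m" using lspan_full by blast
  fix i j assume ij: "i < n m" "j < n m" "\<not> i + 1 \<le> j"
  show "e m i i * (x * y - y * x) * e m j j = 0"
  proof (cases "i \<le> j")
    case False then show ?thesis using lspan_entry_zero[OF d ij(1,2)] by simp
  next
    case True
    then have "i = j" using ij by simp
    have "compression m (x * y - y * x) = 0"
      using diag_commute[OF compression_in_diag compression_in_diag, of x m y] x y lspan_full
      by (auto simp: compression_diff compression_upper_mult)
    then have "0 = e m i i * compression m (x * y - y * x) * e m i i" by simp
    also have "\<dots> = e m i i * (x * y - y * x) * e m i i" by (rule compression_corner[OF ij(1)])
    finally show ?thesis using ij \<open>i = j\<close> by simp
  qed
qed

lemma comm_prod_level:
  assumes "\<And>i. a i \<in> upper m" "\<And>i. b i \<in> upper m"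
  shows "comm_prod a b l \<in> lspan (\<lambda>i j. i + Suc l \<le> j) m"
proof (induction l)
  case 0 show ?case using commutator_level[OF assms] by simp
next
  case (Suc l)
  show ?case unfolding comm_prod.simps
    by (rule lspan_mult[OF Suc commutator_level[OF assms]]) auto
qed

lemma comm_prod_tendsto:
  fixes a b :: "nat \<Rightarrow> 'a"
  assumes "\<And>i. (\<lambda>m. A m i) \<longlonglongrightarrow> a i" "\<And>i. (\<lambda>m. B m i) \<longlonglongrightarrow> b i"
  shows "(\<lambda>m. comm_prod (A m) (B m) l) \<longlonglongrightarrow> comm_prod a b l"
  by (induction l) (auto intro!: tendsto_mult tendsto_diff assms)

text \<open>
  At a fixed level, \<open>2 M + 1\<close> commutators have a product supported at distance at least \<open>2 M + 1\<close>
  from the diagonal.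
\<close>

theorem comm_prod_in_ideal:
  assumes Z: "Z_analytic CC AA"
    and cl: "closed J" and JA: "J \<subseteq> AA" and J0: "0 \<in> J"
    and add: "\<And>x y. x \<in> J \<Longrightarrow> y \<in> J \<Longrightarrow> x + y \<in> J"
    and left: "\<And>x y. x \<in> AA \<Longrightarrow> y \<in> J \<Longrightarrow> x * y \<in> J"
    and right: "\<And>x y. x \<in> J \<Longrightarrow> y \<in> AA \<Longrightarrow> x * y \<in> J"
    and corner: "e k 0 (n k - 1) \<in> J"
  shows "\<exists>L. \<forall>a b. (\<forall>i. a i \<in> AA) \<longrightarrow> (\<forall>i. b i \<in> AA) \<longrightarrow> comm_prod a b L \<in> J"
proof -
  have k1: "n k - 1 < n k" using n_pos[of k] by simp
  obtain c where c: "cocycle CC AA c" "\<And>p. p \<in> groupoid AA \<Longrightarrow> c p \<in> \<int>" "{p \<in> groupoid AA. c p \<in> {0..}} = spectrum_rel AA"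
    using Z unfolding Z_analytic_def by blast
  obtain M where M: "\<And>m s t \<mu>. k \<le> m \<Longrightarrow> s < n m \<Longrightarrow> t < n m \<Longrightarrow> pos k m s = 0 \<Longrightarrow> s \<le> t \<Longrightarrow> cmod \<mu> = 1 \<Longrightarrow>
        e m s s * e k 0 (n k - 1) = \<mu> *\<^sub>C e m s t \<Longrightarrow> t \<le> s + M"
    using copies_bounded[OF c, of 0 "n k - 1" k] k1 by (metis le0)
  have uA: "u \<in> AA" using u_DD DD_AA by blast
  have Jscale: "z *\<^sub>C x \<in> J" if "x \<in> J" for z x
    using left[OF AA_scaleC[OF uA, of z] that] u_mult[of x] that JA AA_CC by (auto simp: scaleC_mult_left)
  have lev: "x \<in> J" if x: "x \<in> lspan (\<lambda>i j. i + Suc (2 * M) \<le> j) m" and km: "k \<le> m" for x m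
    using x
  proof (induction rule: lspan_induct)
    case (unit i j)
    then show ?case by (intro long_units_in_ideal[OF left right corner M km]) auto
  qed (auto intro: J0 add Jscale)
  have "comm_prod a b (2 * M) \<in> J" if a: "\<forall>i. a i \<in> AA" and b: "\<forall>i. b i \<in> AA" for a b
  proof -
    have "\<forall>i. \<exists>X. (\<forall>m. X m \<in> upper m) \<and> X \<longlonglongrightarrow> a i" "\<forall>i. \<exists>X. (\<forall>m. X m \<in> upper m) \<and> X \<longlonglongrightarrow> b i"
      using a b AA_iff by auto
    then obtain A B where A: "\<And>i m. A i m \<in> upper m" "\<And>i. A i \<longlonglongrightarrow> a i"
      and B: "\<And>i m. B i m \<in> upper m" "\<And>i. B i \<longlonglongrightarrow> b i" by metis
    let ?P = "\<lambda>m. comm_prod (\<lambda>i. A i m) (\<lambda>i. B i m) (2 * M)"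
    have "?P \<longlonglongrightarrow> comm_prod a b (2 * M)" by (rule comm_prod_tendsto) (use A B in auto)
    then have "(\<lambda>m. ?P (m + k)) \<longlonglongrightarrow> comm_prod a b (2 * M)" by (rule LIMSEQ_ignore_initial_segment)
    moreover have "?P (m + k) \<in> J" for m by (rule lev[of _ "m + k"], rule comm_prod_level) (use A B in auto)
    ultimately show ?thesis using closed_sequentially[OF cl, of "\<lambda>m. ?P (m + k)"] by simp
  qed
  then show ?thesis by blast
qed

text \<open>
  The witnesses \<open>[e\<^sub>i\<^sub>i, e\<^sub>i\<^sub>,\<^sub>i\<^sub>+\<^sub>1]\<close> at a level of size larger than \<open>L + 1\<close>; factors with index above \<open>L\<close>
  do not occur in the product.
\<close>

theorem comm_prod_nonzero:
  shows "\<exists>a b. (\<forall>i. a i \<in> AA) \<and> (\<forall>i. b i \<in> AA) \<and> comm_prod a b L \<noteq> 0"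
proof -
  obtain m where m: "L + 1 < n m" using n_unbounded by blast
  define a where "a i = (if i \<le> L then e m i i else 0)" for i
  define b where "b i = (if i \<le> L then e m i (Suc i) else 0)" for i
  have "comm_prod a b l = e m 0 (Suc l)" if "l \<le> L" for l
    using that
  proof (induction l)
    case 0 then show ?case using m by (simp add: a_def b_def e_mult)
  next
    case (Suc l)
    then have "comm_prod a b l = e m 0 (Suc l)" by simp
    moreover have "a (Suc l) * b (Suc l) - b (Suc l) * a (Suc l) = e m (Suc l) (Suc (Suc l))"
      using m Suc.prems by (simp add: a_def b_def e_mult)
    ultimately show ?case using m Suc.prems by (simp add: e_mult)
  qed
  then have "comm_prod a b L \<noteq> 0" using m unit_scaleC_eq_0[of 0 m "Suc L" 1] by simp
  moreover have "a i \<in> AA" "b i \<in> AA" for i using m by (auto simp: a_def b_def intro: unit_AA)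
  ultimately show ?thesis by blast
qed

end

section \<open>The kernel of an epimorphism is closed\<close>

lemma closed_seqI:
  fixes S :: "'x::metric_space set"
  assumes "\<And>f l. \<forall>i. f i \<in> S \<Longrightarrow> f \<longlonglongrightarrow> l \<Longrightarrow> l \<in> S"
  shows "closed S"
  unfolding closed_sequential_limits using assms by blast

text \<open>
  The element \<open>x r * x (r + 1) * \<dots> * x (r + l) * a (r + l)\<close>.
\<close>

primrec tail_prod :: "(nat \<Rightarrow> 'a) \<Rightarrow> (nat \<Rightarrow> 'a) \<Rightarrow> nat \<Rightarrow> nat \<Rightarrow> 'a::times" where
  "tail_prod x a 0 r = x r * a r"
| "tail_prod x a (Suc l) r = x r * tail_prod x a l (Suc r)"

context matrix_tower
begin

text \<open>
  The levels grow without bound, so some index \<open>i\<close> of level \<open>m\<close> has two children at a later level.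
  Conjugation by \<open>e m s i\<close> moves them to two different children of \<open>s\<close>.
\<close>

lemma strict_child:
  assumes s: "s < n m"
  obtains m' s' where "m \<le> m'" "s' < n m'" "pos m m' s' = s" "e m' s' s' \<noteq> e m s s"
proof -
  have mono: "n l \<le> n l'" if ll: "l \<le> l'" for l l'
  proof -
    have "{..<n l} \<subseteq> pos l l' ` {..<n l'}"
    proof
      fix i assume "i \<in> {..<n l}"
      then obtain s where "s < n l'" "pos l l' s = i" using child_exists[OF ll, of i] by auto
      then show "i \<in> pos l l' ` {..<n l'}" by auto
    qed
    then have "card {..<n l} \<le> card (pos l l' ` {..<n l'})" by (intro card_mono) auto
    also have "\<dots> \<le> card {..<n l'}" by (intro card_image_le) auto
    finally show ?thesis by simp
  qed
  obtain m' where m': "n m < n m'" using n_unbounded by blast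
  have mm: "m \<le> m'" using m' mono[of m' m] by (meson linorder_not_less nat_le_linear)
  have "\<not> inj_on (pos m m') {..<n m'}"
  proof
    assume "inj_on (pos m m') {..<n m'}"
    then have "card {..<n m'} \<le> card {..<n m}"
      using pos_less[OF mm] by (intro card_inj_on_le) auto
    then show False using m' by simp
  qed
  then obtain s1 s2 where s12: "s1 < n m'" "s2 < n m'" "s1 \<noteq> s2" "pos m m' s1 = pos m m' s2"
    by (auto simp: inj_on_def)
  define i where "i = pos m m' s1"
  have i: "i < n m" using pos_less[OF mm s12(1)] by (simp add: i_def)
  obtain t1 where t1: "t1 < n m'" "pos m m' t1 = s" "e m s i * e m' s1 s1 * e m i s = e m' t1 t1"
    using partner[OF mm i s s12(1) i_def[symmetric]] by metis
  obtain t2 where t2: "t2 < n m'" "pos m m' t2 = s" "e m s i * e m' s2 s2 * e m i s = e m' t2 t2"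
    using partner[OF mm i s s12(2)] s12(4) i_def by metis
  have "e m' t1 t1 * e m' t2 t2 = 0"
  proof -
    have "e m' t1 t1 * e m' t2 t2 = e m s i * (e m' s1 s1 * (e m i s * e m s i) * e m' s2 s2) * e m i s"
      unfolding t1(3)[symmetric] t2(3)[symmetric] by (simp only: mult.assoc)
    also have "e m i s * e m s i = e m i i" using i s by (simp add: e_mult)
    also have "e m' s1 s1 * e m i i * e m' s2 s2 = 0"
      using unit_mult_child(2)[OF mm s12(1) i] s12 i_def by (simp add: e_mult)
    finally show ?thesis by simp
  qed
  moreover have "e m s s * e m' t2 t2 = e m' t2 t2" using unit_mult_child(1)[OF mm t2(1) s] t2(2) by simp
  ultimately have "e m' t1 t1 \<noteq> e m s s" using e_nonzero[OF t2(1)] by metis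
  then show ?thesis using that mm t1 by blast
qed

lemma decreasing_projections:
  assumes s: "s < n k"
  obtains p :: "nat \<Rightarrow> 'a" where "p 0 = e k s s" "\<And>r. p r \<in> DD" "\<And>r. norm (p r) = 1"
    "\<And>i j. i \<le> j \<Longrightarrow> p i * p j = p j" "\<And>i j. i \<le> j \<Longrightarrow> p j * p i = p j" "\<And>r. p (Suc r) \<noteq> p r"
proof -
  define Q where "Q a b \<longleftrightarrow> fst a \<le> fst b \<and> pos (fst a) (fst b) (snd b) = snd a \<and>
      e (fst b) (snd b) (snd b) \<noteq> e (fst a) (snd a) (snd a)" for a b :: "nat \<times> nat"
  have "\<exists>f. \<forall>r. (snd (f r) < n (fst (f r)) \<and> (r = 0 \<longrightarrow> f r = (k, s))) \<and> Q (f r) (f (Suc r))"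
  proof (rule dependent_nat_choice)
    show "\<exists>x. snd x < n (fst x) \<and> (0 = (0::nat) \<longrightarrow> x = (k, s))" using s by auto
    fix x :: "nat \<times> nat" and r :: nat
    assume x: "snd x < n (fst x) \<and> (r = 0 \<longrightarrow> x = (k, s))"
    obtain m' s' where "fst x \<le> m'" "s' < n m'" "pos (fst x) m' s' = snd x"
        "e m' s' s' \<noteq> e (fst x) (snd x) (snd x)" using strict_child x by blast
    then show "\<exists>y. (snd y < n (fst y) \<and> (Suc r = 0 \<longrightarrow> y = (k, s))) \<and> Q x y"
      by (intro exI[of _ "(m', s')"]) (auto simp: Q_def)
  qed
  then obtain f where f: "\<And>r. snd (f r) < n (fst (f r))" "f 0 = (k, s)" "\<And>r. Q (f r) (f (Suc r))" by blast
  define p where "p r = e (fst (f r)) (snd (f r)) (snd (f r))" for r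
  have pD: "p r \<in> DD" and pn: "norm (p r) = 1" and pp: "p r * p r = p r" for r
    using f(1)[of r] by (simp_all add: p_def unit_DD norm_unit e_mult)
  have step: "p r * p (Suc r) = p (Suc r)" for r
    using f(3)[of r] f(1)[of "Suc r"] pos_mult[of "fst (f r)" "fst (f (Suc r))" "snd (f (Suc r))"]
    by (simp add: p_def Q_def)
  have dec: "p i * p j = p j" if "i \<le> j" for i j
    using that
  proof (induction j rule: dec_induct)
    case (step j)
    have "p i * p (Suc j) = (p i * p j) * p (Suc j)"
      using \<open>\<And>r. p r * p (Suc r) = p (Suc r)\<close>[of j] by (simp add: mult.assoc)
    then show ?case using step \<open>\<And>r. p r * p (Suc r) = p (Suc r)\<close>[of j] by simp
  qed (rule pp)
  show ?thesis
  proof (rule that[of p])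
    show "p 0 = e k s s" using f(2) by (simp add: p_def)
    show "p (Suc r) \<noteq> p r" for r using f(3)[of r] by (simp add: p_def Q_def)
    show "p j * p i = p j" if "i \<le> j" for i j using dec[OF that] DD_commute[OF pD pD, of j i] by simp
  qed (use pD pn dec in auto)
qed

end

text \<open>
  A surjective homomorphism from a Banach algebra \<open>A\<close>, a closed subalgebra of a \<open>C\<^sup>*\<close>-algebra,
  onto a triangular algebra.
\<close>

locale tower_epimorphism = matrix_tower n e u
  for n and e :: "nat \<Rightarrow> nat \<Rightarrow> nat \<Rightarrow> 'a::cstar_algebra" and u +
  fixes A :: "'b::cstar_algebra set" and \<phi> :: "'b \<Rightarrow> 'a"
  assumes clA: "closed A" and A0: "0 \<in> A"
    and Aadd: "\<And>x y. x \<in> A \<Longrightarrow> y \<in> A \<Longrightarrow> x + y \<in> A"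
    and Amult: "\<And>x y. x \<in> A \<Longrightarrow> y \<in> A \<Longrightarrow> x * y \<in> A"
    and Ascale: "\<And>z x. x \<in> A \<Longrightarrow> z *\<^sub>C x \<in> A"
    and epi: "algebra_epimorphism A AA \<phi>"
begin

lemma phi_add: "x \<in> A \<Longrightarrow> y \<in> A \<Longrightarrow> \<phi> (x + y) = \<phi> x + \<phi> y"
  and phi_mult: "x \<in> A \<Longrightarrow> y \<in> A \<Longrightarrow> \<phi> (x * y) = \<phi> x * \<phi> y"
  and phi_scaleC: "x \<in> A \<Longrightarrow> \<phi> (z *\<^sub>C x) = z *\<^sub>C \<phi> x"
  and phi_in: "x \<in> A \<Longrightarrow> \<phi> x \<in> AA"
  using epi by (auto simp: algebra_epimorphism_def alg_hom_on_def)

lemma phi_surj: assumes "b \<in> AA" shows "\<exists>x\<in>A. \<phi> x = b"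
proof -
  have "b \<in> \<phi> ` A" using epi assms by (simp add: algebra_epimorphism_def)
  then show ?thesis by auto
qed

lemma phi_diff: "x \<in> A \<Longrightarrow> y \<in> A \<Longrightarrow> \<phi> (x - y) = \<phi> x - \<phi> y"
  using phi_add[of x "(-1) *\<^sub>C y"] phi_scaleC[of y "-1"] Ascale[of y "-1"] by (simp add: scaleC_minus_one)

lemma A_diff: "x \<in> A \<Longrightarrow> y \<in> A \<Longrightarrow> x - y \<in> A"
  using Aadd[of x "(-1) *\<^sub>C y"] Ascale[of y "-1"] by (simp add: scaleC_minus_one)

lemma A_sum: "(\<And>i. i \<in> I \<Longrightarrow> f i \<in> A) \<Longrightarrow> (\<Sum>i\<in>I. f i) \<in> A"
  by (induction I rule: infinite_finite_induct) (auto intro: A0 Aadd)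

text \<open>
  The limits of images \<open>\<phi> (a\<^sub>i)\<close> of null sequences. If it is \<open>0\<close>, the graph of \<open>\<phi>\<close> is closed.
\<close>

definition separating_space :: "'a set" where
  "separating_space = {b \<in> AA. \<forall>\<epsilon>>0. \<exists>a\<in>A. norm a < \<epsilon> \<and> norm (\<phi> a - b) < \<epsilon>}"

lemma separating_spaceD: "b \<in> separating_space \<Longrightarrow> \<epsilon> > 0 \<Longrightarrow> \<exists>a\<in>A. norm a < \<epsilon> \<and> norm (\<phi> a - b) < \<epsilon>"
  by (simp add: separating_space_def)

lemma separating_space_closed: "closed separating_space"
proof (rule closed_seqI)
  fix b l assume b: "\<forall>i. b i \<in> separating_space" and l: "b \<longlonglongrightarrow> (l::'a)"
  have "l \<in> AA" using closed_sequentially[OF closed_AA _ l] b by (auto simp: separating_space_def)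
  moreover have "\<exists>a\<in>A. norm a < \<epsilon> \<and> norm (\<phi> a - l) < \<epsilon>" if \<epsilon>: "\<epsilon> > 0" for \<epsilon>
  proof -
    obtain i where i: "norm (b i - l) < \<epsilon> / 2" using LIMSEQ_D[OF l, of "\<epsilon>/2"] \<epsilon> by auto
    obtain a where a: "a \<in> A" "norm a < \<epsilon> / 2" "norm (\<phi> a - b i) < \<epsilon> / 2"
      using separating_spaceD[of "b i" "\<epsilon>/2"] b \<epsilon> by auto
    have "norm (\<phi> a - l) \<le> norm (\<phi> a - b i) + norm (b i - l)"
      using norm_triangle_ineq[of "\<phi> a - b i" "b i - l"] by simp
    then show ?thesis using a i \<epsilon> by (intro bexI[of _ a]) auto
  qed
  ultimately show "l \<in> separating_space" by (simp add: separating_space_def)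
qed

lemma separating_space_add: assumes x: "x \<in> separating_space" and y: "y \<in> separating_space" shows "x + y \<in> separating_space"
proof -
  have "\<exists>a\<in>A. norm a < \<epsilon> \<and> norm (\<phi> a - (x + y)) < \<epsilon>" if \<epsilon>: "\<epsilon> > 0" for \<epsilon>
  proof -
    obtain a where a: "a \<in> A" "norm a < \<epsilon> / 2" "norm (\<phi> a - x) < \<epsilon> / 2" using separating_spaceD[OF x, of "\<epsilon>/2"] \<epsilon> by auto
    obtain b where b: "b \<in> A" "norm b < \<epsilon> / 2" "norm (\<phi> b - y) < \<epsilon> / 2" using separating_spaceD[OF y, of "\<epsilon>/2"] \<epsilon> by auto
    have "\<phi> (a + b) - (x + y) = (\<phi> a - x) + (\<phi> b - y)" using a b by (simp add: phi_add)
    then have "norm (\<phi> (a + b) - (x + y)) \<le> norm (\<phi> a - x) + norm (\<phi> b - y)"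
      using norm_triangle_ineq by metis
    then show ?thesis using a b norm_triangle_ineq[of a b] by (intro bexI[of _ "a + b"]) (auto intro: Aadd)
  qed
  then show ?thesis using x y AA_add by (auto simp: separating_space_def)
qed

lemma separating_space_ideal: assumes b: "b \<in> separating_space" and y: "y \<in> AA" shows "y * b \<in> separating_space" "b * y \<in> separating_space"
proof -
  obtain x where x: "x \<in> A" "\<phi> x = y" using phi_surj y by blast
  define K where "K = 1 + norm x + norm y"
  have K: "K > 0" "norm x \<le> K" "norm y \<le> K" by (auto simp: K_def add_pos_nonneg)
  have small: "w * t < \<epsilon>" if "w \<le> K" "t < \<epsilon> / K" "t \<ge> 0" "\<epsilon> > 0" for w t \<epsilon> :: real
  proof -
    have "w * t \<le> K * t" using that by (intro mult_right_mono) auto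
    also have "\<dots> < \<epsilon>" using that K by (simp add: field_simps)
    finally show ?thesis .
  qed
  have "\<exists>a\<in>A. norm a < \<epsilon> \<and> norm (\<phi> a - y * b) < \<epsilon>" "\<exists>a\<in>A. norm a < \<epsilon> \<and> norm (\<phi> a - b * y) < \<epsilon>"
    if \<epsilon>: "\<epsilon> > 0" for \<epsilon>
  proof -
    obtain a where a: "a \<in> A" "norm a < \<epsilon> / K" "norm (\<phi> a - b) < \<epsilon> / K" using separating_spaceD[OF b, of "\<epsilon> / K"] \<epsilon> K by auto
    have xa: "norm x * norm a < \<epsilon>" and ya: "norm y * norm (\<phi> a - b) < \<epsilon>"
      by (rule small; use a K \<epsilon> in simp)+
    have "\<phi> (x * a) - y * b = y * (\<phi> a - b)" "\<phi> (a * x) - b * y = (\<phi> a - b) * y"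
      using x a by (simp_all add: phi_mult algebra_simps)
    then have "norm (\<phi> (x * a) - y * b) < \<epsilon>" "norm (\<phi> (a * x) - b * y) < \<epsilon>"
      using norm_mult_ineq[of y "\<phi> a - b"] norm_mult_ineq[of "\<phi> a - b" y] ya by (simp_all add: mult.commute)
    moreover have "norm (x * a) < \<epsilon>" "norm (a * x) < \<epsilon>"
      using norm_mult_ineq[of x a] norm_mult_ineq[of a x] xa by (simp_all add: mult.commute)
    ultimately show "\<exists>a\<in>A. norm a < \<epsilon> \<and> norm (\<phi> a - y * b) < \<epsilon>" "\<exists>a\<in>A. norm a < \<epsilon> \<and> norm (\<phi> a - b * y) < \<epsilon>"
      using Amult[OF x(1) a(1)] Amult[OF a(1) x(1)] by blast+
  qed
  then show "y * b \<in> separating_space" "b * y \<in> separating_space" using b y AA_mult by (auto simp: separating_space_def)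
qed

text \<open>
  Let \<open>\<phi> (x r) = p r\<close> and \<open>q r = p r - p (r + 1)\<close>. Since \<open>b\<close> is in the separating space and
  \<open>q r * b \<noteq> 0\<close>, there are arbitrarily small \<open>a\<close> for which \<open>q r * \<phi> a\<close> is arbitrarily large. Choose such
  \<open>a r\<close> successively and sum the series \<open>y 0\<close> of the products \<open>x 0 * \<dots> * x r * a r\<close>. The projections
  decrease, so \<open>q r\<close> annihilates the image of the series beyond the term \<open>r\<close>, while it absorbs
  \<open>p 0, \<dots>, p r\<close>. Hence \<open>q r * \<phi> (y 0)\<close> is the sum of the \<open>q r * \<phi> (a m)\<close> with \<open>m \<le> r\<close>, whose norm is at
  least \<open>r\<close>, although it is at most \<open>2 * norm (\<phi> (y 0))\<close>.
\<close>

lemma no_hump: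
  fixes p :: "nat \<Rightarrow> 'a"
  assumes pA: "\<And>r. p r \<in> AA" and pn: "\<And>r. norm (p r) \<le> 1"
    and dec: "\<And>i j. i \<le> j \<Longrightarrow> p i * p j = p j" "\<And>i j. i \<le> j \<Longrightarrow> p j * p i = p j"
    and b: "b \<in> separating_space" and hit: "\<And>r. (p r - p (Suc r)) * b \<noteq> 0"
  shows False
proof -
  define q where "q r = p r - p (Suc r)" for r
  have qn: "norm (q r * c) \<le> 2 * norm c" for r c
  proof -
    have "norm (q r) \<le> 2" using norm_triangle_ineq4[of "p r" "p (Suc r)"] pn[of r] pn[of "Suc r"] by (simp add: q_def)
    then show ?thesis using norm_mult_ineq[of "q r" c] mult_right_mono[of "norm (q r)" 2 "norm c"] by simp
  qed
  have "\<forall>r. \<exists>x. x \<in> A \<and> \<phi> x = p r" using phi_surj pA by blast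
  from choice[OF this] obtain x where x: "\<And>r. x r \<in> A" "\<And>r. \<phi> (x r) = p r" by blast
  define W where "W r = (\<Prod>i<r. max 1 (norm (x i)))" for r
  have W1: "W r \<ge> 1" for r unfolding W_def by (intro prod_ge_1) auto
  \<comment> \<open>the size of a r makes the series converge; q r * phi (a r) exceeds all previous humps by r\<close>
  define good where "good f r a \<longleftrightarrow> a \<in> A \<and> norm a * W (Suc r) \<le> (1/2) ^ r \<and>
      norm (q r * \<phi> a) \<ge> real r + norm (q r * \<phi> (\<Sum>m<r. f m))" for f r a
  have "\<exists>f. \<forall>r. good f r (f r)"
  proof (rule dependent_wellorder_choice)
    fix r f g and y :: nat and z :: 'b
    show "good f y z = good g y z" if "\<And>m. m < y \<Longrightarrow> f m = g m"
    proof -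
      have "(\<Sum>m<y. f m) = (\<Sum>m<y. g m)" using that by (intro sum.cong) auto
      then show ?thesis by (simp add: good_def)
    qed
  next
    fix r f
    define T where "T = real r + norm (q r * \<phi> (\<Sum>m<r. f m))"
    define \<eta> where "\<eta> = norm (q r * b)"
    have \<eta>: "\<eta> > 0" using hit by (simp add: \<eta>_def q_def)
    define N where "N = 2 * T / \<eta> + 1"
    have T0: "T \<ge> 0" by (simp add: T_def)
    have N: "N > 0" "N * (\<eta> / 2) \<ge> T" using \<eta> T0 by (simp_all add: N_def field_simps add_pos_nonneg)
    define \<epsilon> where "\<epsilon> = min (\<eta> / 4) ((1/2) ^ r / (N * W (Suc r)))"
    have NW: "N * W (Suc r) > 0" using N W1[of "Suc r"] by simp
    have \<epsilon>: "\<epsilon> > 0" using \<eta> NW by (simp add: \<epsilon>_def)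
    obtain a where a: "a \<in> A" "norm a < \<epsilon>" "norm (\<phi> a - b) < \<epsilon>" using separating_spaceD[OF b \<epsilon>] by blast
    have "norm a \<le> (1/2) ^ r / (N * W (Suc r))" using a by (simp add: \<epsilon>_def)
    then have "norm a * (N * W (Suc r)) \<le> (1/2) ^ r" unfolding pos_le_divide_eq[OF NW] .
    then have small: "N * norm a * W (Suc r) \<le> (1/2) ^ r" by (simp only: mult_ac)
    have "q r * \<phi> a = q r * b + q r * (\<phi> a - b)" by (simp add: algebra_simps)
    then have "norm (q r * \<phi> a) \<ge> \<eta> - norm (q r * (\<phi> a - b))"
      using norm_diff_ineq[of "q r * b" "q r * (\<phi> a - b)"] by (simp add: \<eta>_def)
    then have "norm (q r * \<phi> a) \<ge> \<eta> / 2" using qn[of r "\<phi> a - b"] a by (simp add: \<epsilon>_def)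
    then have "N * norm (q r * \<phi> a) \<ge> T" using N(2) mult_left_mono[of "\<eta>/2" "norm (q r * \<phi> a)" N] N(1) by linarith
    then have "good f r (complex_of_real N *\<^sub>C a)"
      using a small N Ascale[OF a(1)] by (simp add: good_def T_def phi_scaleC norm_scaleC scaleC_mult_right)
    then show "\<exists>a. good f r a" ..
  qed
  then obtain a where good: "\<And>r. good a r (a r)" by blast
  have aA: "a r \<in> A" and an: "norm (a r) * W (Suc r) \<le> (1/2) ^ r"
    and ag: "norm (q r * \<phi> (a r)) \<ge> real r + norm (q r * \<phi> (\<Sum>m<r. a m))" for r
    using good[of r] by (auto simp: good_def)
  define G where "G r l = tail_prod x a l r" for r l
  have GA: "G r l \<in> A" for r l
  proof (induction l arbitrary: r)
    case 0 show ?case using Amult x aA by (simp add: G_def)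
  next
    case (Suc l) then show ?case using Amult x by (simp add: G_def)
  qed
  have GW: "norm (G r l) * W r \<le> norm (a (r + l)) * W (Suc (r + l))" for r l
  proof (induction l arbitrary: r)
    case 0
    have "norm (x r * a r) * W r \<le> (norm (x r) * norm (a r)) * W r"
      using W1[of r] by (intro mult_right_mono norm_mult_ineq) auto
    also have "\<dots> \<le> (max 1 (norm (x r)) * norm (a r)) * W r"
      using W1[of r] by (intro mult_right_mono) auto
    finally show ?case by (simp add: G_def W_def mult_ac)
  next
    case (Suc l)
    have "norm (x r * G (Suc r) l) * W r \<le> (norm (x r) * norm (G (Suc r) l)) * W r"
      using W1[of r] by (intro mult_right_mono norm_mult_ineq) auto
    also have "\<dots> \<le> (max 1 (norm (x r)) * norm (G (Suc r) l)) * W r"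
      using W1[of r] by (intro mult_right_mono) auto
    also have "\<dots> = norm (G (Suc r) l) * W (Suc r)" by (simp add: W_def mult_ac)
    also have "\<dots> \<le> norm (a (Suc r + l)) * W (Suc (Suc r + l))" by (rule Suc)
    finally show ?case by (simp add: G_def)
  qed
  have Gn: "norm (G r l) \<le> (1/2) ^ l" for r l
  proof -
    have "norm (G r l) \<le> norm (G r l) * W r" using mult_left_mono[OF W1[of r], of "norm (G r l)"] by simp
    also have "\<dots> \<le> (1/2) ^ (r + l)" using GW[of r l] an[of "r + l"] by linarith
    also have "\<dots> \<le> (1/2) ^ l" by (intro power_decreasing) auto
    finally show ?thesis .
  qed
  have sm: "summable (G r)" for r
    by (rule summable_comparison_test'[where g = "\<lambda>l. (1/2) ^ l" and N = 0]) (auto intro: Gn summable_geometric)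
  define y where "y r = suminf (G r)" for r
  have yA: "y r \<in> A" for r
  proof -
    have "(\<lambda>N. \<Sum>l<N. G r l) \<longlonglongrightarrow> y r" unfolding y_def by (rule summable_LIMSEQ[OF sm])
    moreover have "(\<Sum>l<N. G r l) \<in> A" for N by (intro A_sum GA)
    ultimately show ?thesis using closed_sequentially[OF clA, of "\<lambda>N. \<Sum>l<N. G r l"] by simp
  qed
  \<comment> \<open>the tails of the series, so that phi (y r) is a multiple of p r\<close>
  have yrec: "y r = x r * (a r + y (Suc r))" for r
  proof -
    have G0: "G r 0 = x r * a r" and GS: "G r (Suc l) = x r * G (Suc r) l" for l by (simp_all add: G_def)
    show ?thesis
      using suminf_split_head[OF sm[of r]] suminf_mult[OF sm[of "Suc r"], of "x r"]
      unfolding G0 GS y_def by (simp add: algebra_simps)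
  qed
  have phiy: "\<phi> (y r) = p r * (\<phi> (a r) + \<phi> (y (Suc r)))" for r
    using yrec[of r] phi_mult[OF x(1) Aadd[OF aA yA]] phi_add[OF aA yA] x(2) by metis
  have qp: "q r * p j = q r" if "j \<le> r" for j r using dec(2) that by (simp add: q_def left_diff_distrib)
  have qp0: "q r * p (Suc r) = 0" for r using dec(1)[of r "Suc r"] dec(1)[of "Suc r" "Suc r"] by (simp add: q_def left_diff_distrib)
  have phi_sum_Suc: "\<phi> (\<Sum>m<Suc j. a m) = \<phi> (\<Sum>m<j. a m) + \<phi> (a j)" for j
    using phi_add[of "\<Sum>m<j. a m" "a j"] A_sum[of "{..<j}" a] aA by simp
  have split: "q r * \<phi> (y 0) = q r * \<phi> (\<Sum>m<j. a m) + q r * \<phi> (y j)" if "j \<le> Suc r" for r j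
    using that
  proof (induction j)
    case 0
    have "\<phi> 0 = 0" using phi_scaleC[OF A0, of 0] by simp
    then show ?case by simp
  next
    case (Suc j)
    have "q r * \<phi> (y j) = (q r * p j) * (\<phi> (a j) + \<phi> (y (Suc j)))" using phiy[of j] by (simp add: mult.assoc)
    also have "\<dots> = q r * \<phi> (a j) + q r * \<phi> (y (Suc j))" using qp[of j r] Suc by (simp add: distrib_left)
    moreover have "\<phi> (\<Sum>m<Suc j. a m) = \<phi> (\<Sum>m<j. a m) + \<phi> (a j)" by (rule phi_sum_Suc)
    ultimately show ?case using Suc by (simp add: distrib_left)
  qed
  have big: "real r \<le> 2 * norm (\<phi> (y 0))" for r
  proof -
    have "q r * \<phi> (y (Suc r)) = (q r * p (Suc r)) * (\<phi> (a (Suc r)) + \<phi> (y (Suc (Suc r))))"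
      using phiy[of "Suc r"] by (simp add: mult.assoc)
    then have "q r * \<phi> (y 0) = q r * \<phi> (\<Sum>m<Suc r. a m)" using split[of "Suc r" r] qp0 by simp
    also have "\<phi> (\<Sum>m<Suc r. a m) = \<phi> (\<Sum>m<r. a m) + \<phi> (a r)" by (rule phi_sum_Suc)
    finally have "q r * \<phi> (a r) = q r * \<phi> (y 0) - q r * \<phi> (\<Sum>m<r. a m)" by (simp add: distrib_left)
    then have "norm (q r * \<phi> (a r)) \<le> norm (q r * \<phi> (y 0)) + norm (q r * \<phi> (\<Sum>m<r. a m))"
      using norm_triangle_ineq4 by metis
    then show ?thesis using ag[of r] qn[of r "\<phi> (y 0)"] by linarith
  qed
  obtain r :: nat where "2 * norm (\<phi> (y 0)) < real r" using reals_Archimedean2 by blast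
  then show False using big[of r] by simp
qed

text \<open>
  A non-zero separating space contains a corner unit \<open>b\<close> of some level. The range projection of \<open>b\<close> is
  \<open>p 0\<close>, so \<open>b\<close> is not annihilated by any non-zero \<open>p r - p (r + 1)\<close>.
\<close>

lemma separating_space_trivial: assumes b: "b \<in> separating_space" shows "b = 0"
proof (rule ccontr)
  assume b0: "b \<noteq> 0"
  obtain k where k: "e k 0 (n k - 1) \<in> separating_space"
    using closed_ideal_contains_corner[of separating_space b] separating_space_closed separating_space_add separating_space_ideal b b0
    by (auto simp: separating_space_def)
  have k0: "0 < n k" and k1: "n k - 1 < n k" using n_pos[of k] by auto
  obtain p where p: "p 0 = e k 0 0" "\<And>r. p r \<in> DD" "\<And>r. norm (p r) = 1"
    "\<And>i j. i \<le> j \<Longrightarrow> p i * p j = p j" "\<And>i j. i \<le> j \<Longrightarrow> p j * p i = p j" "\<And>r. p (Suc r) \<noteq> p r"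
    using decreasing_projections[OF k0] by blast
  show False
  proof (rule no_hump[of p, OF _ _ p(4,5) k])
    show "p r \<in> AA" for r using p(2) DD_AA by blast
    show "norm (p r) \<le> 1" for r using p(3)[of r] by simp
    fix r
    show "(p r - p (Suc r)) * e k 0 (n k - 1) \<noteq> 0"
    proof
      assume z: "(p r - p (Suc r)) * e k 0 (n k - 1) = 0"
      have "p r - p (Suc r) = (p r - p (Suc r)) * p 0" using p(5)[of 0] by (simp add: left_diff_distrib)
      also have "\<dots> = ((p r - p (Suc r)) * e k 0 (n k - 1)) * e k (n k - 1) 0"
        using k0 k1 by (simp add: p(1) mult.assoc e_mult)
      finally have "p r - p (Suc r) = 0" using z by simp
      then show False using p(6)[of r] by simp
    qed
  qed
qed

lemma kernel_closed: "closed {a \<in> A. \<phi> a = 0}"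
proof (rule closed_seqI)
  fix f l assume f: "\<forall>i. f i \<in> {a \<in> A. \<phi> a = 0}" and l: "f \<longlonglongrightarrow> (l::'b)"
  have lA: "l \<in> A" using closed_sequentially[OF clA _ l] f by auto
  have "\<phi> l \<in> separating_space"
    unfolding separating_space_def
  proof (intro CollectI conjI allI impI phi_in lA)
    fix \<epsilon> :: real assume "\<epsilon> > 0"
    then obtain i where "norm (f i - l) < \<epsilon>" using LIMSEQ_D[OF l] by blast
    then show "\<exists>a\<in>A. norm a < \<epsilon> \<and> norm (\<phi> a - \<phi> l) < \<epsilon>"
      using f lA \<open>\<epsilon> > 0\<close> by (intro bexI[of _ "l - f i"]) (auto simp: norm_minus_commute phi_diff A_diff)
  qed
  then show "l \<in> {a \<in> A. \<phi> a = 0}" using separating_space_trivial lA by simp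
qed

end

section \<open>Direct limits as towers of matrix units\<close>

definition unit_mat :: "nat \<Rightarrow> nat \<Rightarrow> nat \<Rightarrow> complex mat" where
  "unit_mat N i j = mat N N (\<lambda>(a, b). if a = i \<and> b = j then 1 else 0)"

lemma unit_mat_carrier [simp]: "unit_mat N i j \<in> carrier_mat N N"
  by (simp add: unit_mat_def)

lemma unit_mat_mult:
  assumes "j < N" "r < N"
  shows "unit_mat N i j * unit_mat N r s = (if j = r then unit_mat N i s else 0 \<cdot>\<^sub>m unit_mat N i s)"
proof (rule eq_matI)
  fix a b assume "a < dim_row (if j = r then unit_mat N i s else 0 \<cdot>\<^sub>m unit_mat N i s)"
    "b < dim_col (if j = r then unit_mat N i s else 0 \<cdot>\<^sub>m unit_mat N i s)"
  then have ab: "a < N" "b < N" by (auto simp: unit_mat_def split: if_splits)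
  have "(unit_mat N i j * unit_mat N r s) $$ (a, b) =
      (\<Sum>c\<in>{0..<N}. (if a = i \<and> c = j then 1 else 0) * (if c = r \<and> b = s then 1 else 0))"
    using ab by (simp add: unit_mat_def scalar_prod_def)
  also have "\<dots> = (\<Sum>c\<in>{0..<N}. if c = j then (if a = i \<and> j = r \<and> b = s then 1 else 0) else 0)"
    by (intro sum.cong) auto
  also have "\<dots> = (if a = i \<and> j = r \<and> b = s then 1 else 0)" using assms by simp
  finally show "(unit_mat N i j * unit_mat N r s) $$ (a, b) =
      (if j = r then unit_mat N i s else 0 \<cdot>\<^sub>m unit_mat N i s) $$ (a, b)"
    using ab by (auto simp: unit_mat_def)
qed (auto simp: unit_mat_def)

lemma mat_adjoint_index:
  assumes "M \<in> carrier_mat N N" "i < N" "j < N"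
  shows "mat_adjoint M $$ (i, j) = cnj (M $$ (j, i))"
  using assms by (auto simp: mat_adjoint_def mat_of_rows_def)

lemma mat_adjoint_carrier: "M \<in> carrier_mat N N \<Longrightarrow> mat_adjoint M \<in> carrier_mat N N"
  by (auto simp: mat_adjoint_def mat_of_rows_def)

lemma mat_adjoint_unit_mat:
  assumes "i < N" "j < N" shows "mat_adjoint (unit_mat N i j) = unit_mat N j i"
proof (rule eq_matI)
  fix a b assume "a < dim_row (unit_mat N j i)" "b < dim_col (unit_mat N j i)"
  then have ab: "a < N" "b < N" by (auto simp: unit_mat_def)
  show "mat_adjoint (unit_mat N i j) $$ (a, b) = unit_mat N j i $$ (a, b)"
    using ab by (simp add: mat_adjoint_index[of _ N]) (auto simp: unit_mat_def)
qed (use mat_adjoint_carrier[of "unit_mat N i j" N] in \<open>auto simp: unit_mat_def\<close>)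

text \<open>
  Matrices of all sizes form one type without a common zero, so \<open>sum\<close> is not available for them; the
  matrix is built up entry by entry instead.
\<close>

lemma hom_matrix_expansion:
  fixes h :: "complex mat \<Rightarrow> 'a::cstar_algebra"
  assumes hom: "alg_hom_on smult_mat scaleC (full_mats N) C h" and M: "M \<in> carrier_mat N N"
  shows "h M = (\<Sum>i<N. \<Sum>j<N. M $$ (i, j) *\<^sub>C h (unit_mat N i j))"
proof -
  have hadd: "h (A + B) = h A + h B" if "A \<in> carrier_mat N N" "B \<in> carrier_mat N N" for A B
    using hom that by (simp add: alg_hom_on_def full_mats_def)
  have hsm: "h (z \<cdot>\<^sub>m A) = z *\<^sub>C h A" if "A \<in> carrier_mat N N" for A z
    using hom that by (simp add: alg_hom_on_def full_mats_def)
  define R where "R F = mat N N (\<lambda>p. if p \<in> F then M $$ p else 0)" for F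
  have RC: "R F \<in> carrier_mat N N" for F by (simp add: R_def)
  have "h (R F) = (\<Sum>p\<in>F. M $$ p *\<^sub>C h (unit_mat N (fst p) (snd p)))" if "finite F" "F \<subseteq> {..<N} \<times> {..<N}" for F
    using that
  proof (induction F rule: finite_induct)
    case empty
    have "R {} = 0 \<cdot>\<^sub>m R {}" by (rule eq_matI) (auto simp: R_def)
    then have "h (R {}) = 0 *\<^sub>C h (R {})" using hsm[OF RC, of 0] by metis
    then show ?case by simp
  next
    case (insert p F)
    have "R (insert p F) = R F + M $$ p \<cdot>\<^sub>m unit_mat N (fst p) (snd p)"
      by (rule eq_matI) (use insert in \<open>auto simp: R_def unit_mat_def\<close>)
    then have "h (R (insert p F)) = h (R F) + M $$ p *\<^sub>C h (unit_mat N (fst p) (snd p))"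
      using hadd[OF RC, of "M $$ p \<cdot>\<^sub>m unit_mat N (fst p) (snd p)" F] hsm by simp
    then show ?case using insert by (simp add: add.commute)
  qed
  from this[of "{..<N} \<times> {..<N}"]
  have "h (R ({..<N} \<times> {..<N})) = (\<Sum>p\<in>{..<N} \<times> {..<N}. M $$ p *\<^sub>C h (unit_mat N (fst p) (snd p)))" by simp
  moreover have "R ({..<N} \<times> {..<N}) = M" by (rule eq_matI) (use M in \<open>auto simp: R_def\<close>)
  ultimately show ?thesis by (simp add: sum.cartesian_product case_prod_unfold)
qed

text \<open>
  The matrix units are the images under \<open>\<iota> k\<close> of the usual ones. That they normalize the diagonals
  of all later levels follows by iterating the assumption on a single connecting map.
\<close>

lemma triangular_UHF_tower:
  fixes C A :: "'a::cstar_algebra set"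
  assumes "triangular_UHF C A"
  shows "\<exists>n e u. matrix_tower n e u \<and> matrix_tower.CC n e = C \<and> matrix_tower.AA n e = (A :: 'a set)"
proof -
  obtain n \<alpha> \<iota> where sys: "triangular_system n \<alpha>" and lim: "cstar_direct_limit n \<alpha> \<iota> C"
    and A: "A = closure (\<Union>k. \<iota> k ` upper_mats (n k))"
    using assms unfolding triangular_UHF_def by blast
  define e where "e k i j = \<iota> k (unit_mat (n k) i j)" for k i j
  define u where "u = \<iota> 0 (1\<^sub>m (n 0))"
  have npos: "0 < n k" and nunb: "\<exists>k. m < n k" for k m using sys by (auto simp: triangular_system_def)
  have hom: "alg_hom_on smult_mat scaleC (full_mats (n k)) C (\<iota> k)" for k
    using lim unfolding cstar_direct_limit_def by blast
  have \<iota>mult: "\<iota> k (X * Y) = \<iota> k X * \<iota> k Y" and \<iota>sm: "\<iota> k (z \<cdot>\<^sub>m X) = z *\<^sub>C \<iota> k X"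
    if "X \<in> carrier_mat (n k) (n k)" "Y \<in> carrier_mat (n k) (n k)" for X Y k z
    using hom[of k] that by (simp_all add: alg_hom_on_def full_mats_def)
  have \<iota>adj: "\<iota> k (mat_adjoint X) = cstar (\<iota> k X)" if "X \<in> carrier_mat (n k) (n k)" for X k
    using lim that by (simp add: cstar_direct_limit_def full_mats_def)
  have \<iota>inj: "inj_on (\<iota> k) (carrier_mat (n k) (n k))" for k
    using lim by (simp add: cstar_direct_limit_def full_mats_def)
  have \<iota>\<alpha>: "\<iota> (Suc k) (\<alpha> k X) = \<iota> k X" if "X \<in> carrier_mat (n k) (n k)" for X k
    using lim that by (simp add: cstar_direct_limit_def full_mats_def)
  have \<alpha>full: "\<alpha> k X \<in> carrier_mat (n (Suc k)) (n (Suc k))" if "X \<in> carrier_mat (n k) (n k)" for X k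
    using sys that by (simp add: triangular_system_def alg_hom_on_def full_mats_def)
  have \<alpha>upper: "\<alpha> k X \<in> upper_mats (n (Suc k))" if "X \<in> upper_mats (n k)" for X k
    using sys that unfolding triangular_system_def by blast
  have \<alpha>norm: "\<alpha> k X \<in> normalizer mat_adjoint (diag_mats (n (Suc k))) (full_mats (n (Suc k)))"
    if "X \<in> normalizer mat_adjoint (diag_mats (n k)) (full_mats (n k))" for X k
    using sys that unfolding triangular_system_def by blast
  have expand: "\<iota> k X = matrix_comb n e k (\<lambda>i j. X $$ (i, j))" if "X \<in> carrier_mat (n k) (n k)" for X k
    using hom_matrix_expansion[OF hom that] by (simp add: matrix_comb_def e_def)
  have span: "\<iota> k X \<in> level_span n e P k"
    if X: "X \<in> carrier_mat (n k) (n k)" "\<And>i j. i < n k \<Longrightarrow> j < n k \<Longrightarrow> \<not> P i j \<Longrightarrow> X $$ (i, j) = 0" for X k P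
  proof -
    have "\<iota> k X = matrix_comb n e k (\<lambda>i j. if P i j then X $$ (i, j) else 0)"
      unfolding expand[OF X(1)] matrix_comb_def by (intro sum.cong refl) (use X(2) in auto)
    then show ?thesis by (auto simp: level_span_def)
  qed
  have span_conv: "\<exists>X\<in>carrier_mat (n k) (n k). x = \<iota> k X \<and> (\<forall>i<n k. \<forall>j<n k. \<not> P i j \<longrightarrow> X $$ (i, j) = 0)"
    if x: "x \<in> level_span n e P k" for x P k
  proof -
    obtain f where f: "x = matrix_comb n e k f" "\<forall>i j. \<not> P i j \<longrightarrow> f i j = 0" using x by (auto simp: level_span_def)
    have "\<iota> k (mat (n k) (n k) (\<lambda>(i, j). f i j)) = x"
      unfolding f expand[OF mat_carrier] matrix_comb_def by (intro sum.cong refl) simp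
    then show ?thesis using f(2) by (intro bexI[of _ "mat (n k) (n k) (\<lambda>(i, j). f i j)"]) auto
  qed
  have full_eq: "\<iota> k ` full_mats (n k) = level_span n e (\<lambda>_ _. True) k" for k
    using span[of _ k "\<lambda>_ _. True"] span_conv[of _ "\<lambda>_ _. True" k] unfolding full_mats_def by blast
  have upper_eq: "\<iota> k ` upper_mats (n k) = level_span n e (\<le>) k" for k
  proof
    show "\<iota> k ` upper_mats (n k) \<subseteq> level_span n e (\<le>) k"
      by (auto simp: upper_mats_def upper_triangular_def intro!: span)
    show "level_span n e (\<le>) k \<subseteq> \<iota> k ` upper_mats (n k)"
    proof
      fix x assume "x \<in> level_span n e (\<le>) k"
      then obtain X where X: "X \<in> carrier_mat (n k) (n k)" "x = \<iota> k X" "\<forall>i<n k. \<forall>j<n k. \<not> i \<le> j \<longrightarrow> X $$ (i, j) = 0"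
        using span_conv by blast
      then have "X \<in> upper_mats (n k)" by (auto simp: upper_mats_def upper_triangular_def)
      then show "x \<in> \<iota> k ` upper_mats (n k)" using X by blast
    qed
  qed
  have diag_span: "\<iota> k Y \<in> level_span n e (=) k" if "Y \<in> diag_mats (n k)" for k Y
    using that by (intro span) (auto simp: diag_mats_def diagonal_mat_def)
  have one: "\<iota> k (1\<^sub>m (n k)) = u" for k
  proof (induction k)
    case (Suc k)
    have "\<alpha> k (1\<^sub>m (n k)) = 1\<^sub>m (n (Suc k))" using sys by (simp add: triangular_system_def)
    then show ?case using \<iota>\<alpha>[of "1\<^sub>m (n k)" k] Suc by simp
  qed (simp add: u_def)
  have unit_normalizes: "unit_mat (n k) i j \<in> normalizer mat_adjoint (diag_mats (n k)) (full_mats (n k))"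
    if ij: "i < n k" "j < n k" for k i j
  proof -
    let ?E = "unit_mat (n k)"
    have conj: "?E i j * Y * ?E j i \<in> diag_mats (n k)" if ij: "i < n k" "j < n k" and Y: "Y \<in> carrier_mat (n k) (n k)" for i j Y
    proof -
      have c: "?E i j * Y * ?E j i \<in> carrier_mat (n k) (n k)" using Y by (meson mult_carrier_mat unit_mat_carrier)
      have "(?E i j * Y * ?E j i) $$ (a, b) = 0" if ab: "a < n k" "b < n k" "a \<noteq> b" for a b
      proof -
        have EY: "(?E i j * Y) $$ (a, d) = (if a = i then Y $$ (j, d) else 0)" if "d < n k" for d
        proof -
          have "(?E i j * Y) $$ (a, d) = (\<Sum>c\<in>{0..<n k}. (if a = i \<and> c = j then 1 else 0) * Y $$ (c, d))"
            using ab that Y by (simp add: unit_mat_def scalar_prod_def)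
          also have "\<dots> = (\<Sum>c\<in>{0..<n k}. if c = j then (if a = i then Y $$ (j, d) else 0) else 0)"
            by (intro sum.cong) auto
          finally show ?thesis using ij by simp
        qed
        have "(?E i j * Y * ?E j i) $$ (a, b) = (\<Sum>c\<in>{0..<n k}. (?E i j * Y) $$ (a, c) * ?E j i $$ (c, b))"
          using ab Y by (simp add: scalar_prod_def unit_mat_def)
        also have "\<dots> = 0"
          by (rule sum.neutral) (use ab EY in \<open>auto simp: unit_mat_def\<close>)
        finally show ?thesis .
      qed
      then show ?thesis
        using c unfolding diag_mats_def diagonal_mat_def mem_Collect_eq carrier_matD[OF c] by blast
    qed
    have "?E i j * ?E j i * ?E i j = ?E i j" using ij by (simp add: unit_mat_mult)
    then show ?thesis using conj[OF ij] conj[OF ij(2,1)] ij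
      by (auto simp: normalizer_def partial_isometry_def full_mats_def diag_mats_def mat_adjoint_unit_mat)
  qed
  have iter: "\<exists>X \<in> normalizer mat_adjoint (diag_mats (n m)) (full_mats (n m)). \<iota> m X = e k i j"
    if km: "k \<le> m" and ij: "i < n k" "j < n k" for k m i j
    using km
  proof (induction m rule: dec_induct)
    case base then show ?case using unit_normalizes[OF ij] by (auto simp: e_def)
  next
    case (step m)
    then obtain X where X: "X \<in> normalizer mat_adjoint (diag_mats (n m)) (full_mats (n m))" "\<iota> m X = e k i j" by blast
    then have "X \<in> carrier_mat (n m) (n m)" by (simp add: normalizer_def full_mats_def)
    then show ?case using \<alpha>norm[OF X(1)] \<iota>\<alpha>[of X m] X(2) by metis
  qed
  have tower: "matrix_tower n e u"
  proof
    show "0 < n k" for k by (rule npos)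
    show "\<exists>k. m < n k" for m by (rule nunb)
    show mult: "e k i j * e k r s = (if j = r then e k i s else 0)" if "i < n k" "j < n k" "r < n k" "s < n k" for k i j r s
    proof -
      have "e k i j * e k r s = \<iota> k (unit_mat (n k) i j * unit_mat (n k) r s)" by (simp add: e_def \<iota>mult)
      then show ?thesis using that \<iota>sm[of "unit_mat (n k) i s" k "unit_mat (n k) i s" 0] by (simp add: unit_mat_mult e_def)
    qed
    show st: "cstar (e k i j) = e k j i" if "i < n k" "j < n k" for k i j
      using that \<iota>adj[of "unit_mat (n k) i j" k] by (simp add: e_def mat_adjoint_unit_mat)
    show "e k i i \<noteq> 0" if i: "i < n k" for k i
    proof
      assume 0: "e k i i = 0"
      have "\<iota> k (0 \<cdot>\<^sub>m unit_mat (n k) i i) = 0" using \<iota>sm[of "unit_mat (n k) i i" k "unit_mat (n k) i i" 0] by simp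
      then have "\<iota> k (unit_mat (n k) i i) = \<iota> k (0 \<cdot>\<^sub>m unit_mat (n k) i i)" using 0 by (simp add: e_def)
      then have "unit_mat (n k) i i = 0 \<cdot>\<^sub>m unit_mat (n k) i i" by (rule inj_onD[OF \<iota>inj]) auto
      then have "unit_mat (n k) i i $$ (i, i) = (0 \<cdot>\<^sub>m unit_mat (n k) i i) $$ (i, i)" by simp
      then show False using i by (simp add: unit_mat_def)
    qed
    show "(\<Sum>i<n k. e k i i) = u" for k
    proof -
      have "u = (\<Sum>i<n k. \<Sum>j<n k. if j = i then e k i i else 0)"
        unfolding one[of k, symmetric] expand[OF one_carrier_mat] matrix_comb_def
        by (intro sum.cong refl) auto
      then show ?thesis by simp
    qed
    show "e k i j \<in> level_span n e (\<lambda>_ _. True) (Suc k)" if "i < n k" "j < n k" for k i j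
    proof -
      have "e k i j = \<iota> (Suc k) (\<alpha> k (unit_mat (n k) i j))" by (simp add: e_def \<iota>\<alpha>)
      then show ?thesis using span[OF \<alpha>full[OF unit_mat_carrier], of k "\<lambda>_ _. True"] by simp
    qed
    show "e k i j \<in> level_span n e (\<le>) (Suc k)" if "i \<le> j" "j < n k" for k i j
    proof -
      have "unit_mat (n k) i j \<in> upper_mats (n k)"
        using that by (auto simp: upper_mats_def upper_triangular_def unit_mat_def)
      then have "\<alpha> k (unit_mat (n k) i j) \<in> upper_mats (n (Suc k))" by (rule \<alpha>upper)
      moreover have "e k i j = \<iota> (Suc k) (\<alpha> k (unit_mat (n k) i j))" by (simp add: e_def \<iota>\<alpha>)
      ultimately show ?thesis using upper_eq by blast
    qed
    show "e k i j * e m s s * e k j i \<in> level_span n e (=) m" if km: "k \<le> m" and ij: "i < n k" "j < n k" and s: "s < n m" for k m i j s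
    proof -
      obtain X where X: "X \<in> normalizer mat_adjoint (diag_mats (n m)) (full_mats (n m))" "\<iota> m X = e k i j"
        using iter[OF km ij] by blast
      have Xc: "X \<in> carrier_mat (n m) (n m)" using X by (simp add: normalizer_def full_mats_def)
      have "unit_mat (n m) s s \<in> diag_mats (n m)" by (auto simp: diag_mats_def diagonal_mat_def unit_mat_def)
      then have d: "X * unit_mat (n m) s s * mat_adjoint X \<in> diag_mats (n m)" using X by (simp add: normalizer_def)
      have "e k i j * e m s s * e k j i = \<iota> m X * \<iota> m (unit_mat (n m) s s) * cstar (\<iota> m X)"
        using X st[OF ij] by (simp add: e_def)
      also have "\<dots> = \<iota> m (X * unit_mat (n m) s s * mat_adjoint X)"
        using Xc mat_adjoint_carrier[OF Xc] by (simp add: \<iota>adj \<iota>mult)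
      finally show ?thesis using diag_span[OF d] by simp
    qed
  qed
  have "C = closure (\<Union>k. \<iota> k ` full_mats (n k))" using lim by (simp add: cstar_direct_limit_def)
  then have "matrix_tower.CC n e = C" using matrix_tower.CC_def[OF tower] by (simp add: full_eq)
  moreover have "matrix_tower.AA n e = A" using matrix_tower.AA_def[OF tower] A by (simp add: upper_eq)
  ultimately show ?thesis using tower by blast
qed

section \<open>Epimorphisms of analytic algebras\<close>

lemma comm_prod_hom:
  assumes add: "\<And>x y. x \<in> A \<Longrightarrow> y \<in> A \<Longrightarrow> f (x - y) = f x - f y"
    and mult: "\<And>x y. x \<in> A \<Longrightarrow> y \<in> A \<Longrightarrow> f (x * y) = f x * f y"
    and cl: "\<And>x y. x \<in> A \<Longrightarrow> y \<in> A \<Longrightarrow> x - y \<in> A" "\<And>x y. x \<in> A \<Longrightarrow> y \<in> A \<Longrightarrow> x * y \<in> A"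
    and ab: "\<And>i. a i \<in> A" "\<And>i. b i \<in> A"
  shows "f (comm_prod a b l) = comm_prod (\<lambda>i. f (a i)) (\<lambda>i. f (b i)) l \<and> comm_prod a b l \<in> A"
  by (induction l) (simp_all add: add mult cl ab)

theorem theorem3p3:
  fixes C A :: "'a::cstar_algebra set"
    and C' B :: "'b::cstar_algebra set"
    and \<phi> :: "'a \<Rightarrow> 'b"
  assumes "triangular_UHF C A"
    and "Z_analytic C A"
    and "triangular_UHF C' B"
    and "algebra_epimorphism A B \<phi>"
  shows "algebra_isomorphism A B \<phi>"
proof -
  obtain n e u where T: "matrix_tower n e (u::'a)" and CA: "matrix_tower.CC n e = C" "matrix_tower.AA n e = A"
    using triangular_UHF_tower[OF assms(1)] by blast
  obtain n' e' u' where T': "matrix_tower n' e' (u'::'b)" and B: "matrix_tower.AA n' e' = B"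
    using triangular_UHF_tower[OF assms(3)] by blast
  interpret A: matrix_tower n e u by (rule T)
  interpret B: matrix_tower n' e' u' by (rule T')
  have Aeq: "A = A.AA" and Ceq: "C = A.CC" and Beq: "B = B.AA" using CA B by auto
  have epi: "algebra_epimorphism A.AA B.AA \<phi>" using assms(4) Aeq Beq by simp
  interpret \<phi>: tower_epimorphism n' e' u' A.AA \<phi>
    by unfold_locales (use A.closed_AA A.AA_add A.AA_mult A.AA_scaleC epi in auto)
  note phi_add = \<phi>.phi_add and phi_mult = \<phi>.phi_mult and phi_scaleC = \<phi>.phi_scaleC
    and phi_diff = \<phi>.phi_diff and phi_surj = \<phi>.phi_surj
  define J where "J = {a \<in> A.AA. \<phi> a = 0}"
  have cl: "closed J" unfolding J_def by (rule \<phi>.kernel_closed)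
  have JA: "J \<subseteq> A.AA" by (auto simp: J_def)
  have J0: "0 \<in> J" using phi_scaleC[OF A.zero_AA, of 0] by (simp add: J_def)
  have Jadd: "x + y \<in> J" if "x \<in> J" "y \<in> J" for x y using that by (simp add: J_def phi_add A.AA_add)
  have Jl: "x * y \<in> J" if "x \<in> A.AA" "y \<in> J" for x y using that by (simp add: J_def phi_mult A.AA_mult)
  have Jr: "x * y \<in> J" if "x \<in> J" "y \<in> A.AA" for x y using that by (simp add: J_def phi_mult A.AA_mult)
  have "a = 0" if a: "a \<in> J" for a
  proof (rule ccontr)
    assume "a \<noteq> 0"
    then obtain k where k: "e k 0 (n k - 1) \<in> J"
      using A.closed_ideal_contains_corner[OF JA cl Jadd Jl Jr a] by blast
    have "Z_analytic A.CC A.AA" using assms(2) Aeq Ceq by simp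
    then obtain L where L: "\<And>a b. (\<And>i. a i \<in> A.AA) \<Longrightarrow> (\<And>i. b i \<in> A.AA) \<Longrightarrow> comm_prod a b L \<in> J"
      using A.comm_prod_in_ideal[OF _ cl JA J0 Jadd Jl Jr k] by blast
    obtain b b' where b: "\<And>i. b i \<in> B.AA" "\<And>i. b' i \<in> B.AA" "comm_prod b b' L \<noteq> 0"
      using B.comm_prod_nonzero by blast
    have "\<forall>i. \<exists>a. a \<in> A.AA \<and> \<phi> a = b i" "\<forall>i. \<exists>a. a \<in> A.AA \<and> \<phi> a = b' i" using phi_surj b by blast+
    then obtain x x' where x: "\<And>i. x i \<in> A.AA" "\<And>i. \<phi> (x i) = b i" "\<And>i. x' i \<in> A.AA" "\<And>i. \<phi> (x' i) = b' i"
      by metis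
    have "\<phi> (comm_prod x x' L) = comm_prod b b' L"
      using comm_prod_hom[of A.AA \<phi> x x' L] phi_diff phi_mult A.AA_diff A.AA_mult x by simp
    then show False using L[of x x'] x b(3) by (simp add: J_def)
  qed
  then have "inj_on \<phi> A.AA"
    by (intro inj_onI) (metis (mono_tags, lifting) A.AA_diff J_def mem_Collect_eq phi_diff right_minus_eq)
  then have "bij_betw \<phi> A.AA B.AA" using epi by (simp add: bij_betw_def algebra_epimorphism_def)
  then show ?thesis using epi Aeq Beq by (simp add: algebra_isomorphism_def algebra_epimorphism_def)
qed

end
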